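(* Let $\mathbf{X}$ and $\mathbf{Y}$ be disjoint node sets in a causal maximal PDAG $\mathcal{G}=(\mathbf{V},\mathbf{E})$, such that $\mathbf{Y}\subseteq\mathrm{possde}(\mathbf{X},\mathcal{G})$. Let the density $f$ of $\mathbf{V}$ be compatible with $\mathcal{G}$ and let $$\mathbf{O}=\mathbf{O}(\mathbf{X},\mathbf{Y},\mathcal{G})=\mathrm{pa}(\mathrm{cn}(\mathbf{X},\mathbf{Y},\mathcal{G}),\mathcal{G})\setminus\mathrm{forb}(\mathbf{X},\mathbf{Y},\mathcal{G}).$$ Then the following three statements hold: (i) The set $\mathbf{O}$ is a valid adjustment set relative to $(\mathbf{X},\mathbf{Y})$ in $\mathcal{G}$ if and only if there exists a valid adjustment set relative to $(\mathbf{X},\mathbf{Y})$ in $\mathcal{G}$. (ii) Let $\mathbf{Z}$ be a valid adjustment set relative to $(\mathbf{X},\mathbf{Y})$ in $\mathcal{G}$. If $\mathbf{V}$ follows a causal linear model compatible with $\mathcal{G}$, then $a.var(\hat{\tau}^{\mathbf{o}}_{\mathbf{yx}})\le a.var(\hat{\tau}^{\mathbf{z}}_{\mathbf{yx}})$ (entrywise). (iii) Let $\mathbf{Z}$ be a valid adjustment set relative to $(\mathbf{X},\mathbf{Y})$ in $\mathcal{G}$ such that $a.var(\hat{\tau}^{\mathbf{o}}_{\mathbf{yx}})=a.var(\hat{\tau}^{\mathbf{z}}_{\mathbf{yx}})$. If $\mathbf{V}$ follows a causal linear model compatible with $\mathcal{G}$ and $f$ is faithful to $\mathcal{G}$, then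 $\mathbf{O}\subseteq\mathbf{Z}$.
   Context: **Graphs.** Graphs are simple with finite node set; each edge is directed ($\to$) or undirected ($-$). A PDAG is such a graph without directed cycles; a DAG is a PDAG with only directed edges. A path is a sequence of distinct nodes in which successive nodes are adjacent; a path from a node set $\mathbf{X}$ to a node set $\mathbf{Y}$ goes from some $X\in\mathbf{X}$ to some $Y\in\mathbf{Y}$, and is proper if only its first node is in $\mathbf{X}$. A path $(V_1,\dots,V_m)$ is causal (directed) if $V_i\to V_{i+1}$ for all $i$; it is possibly causal (possibly directed) if there are no $i<j$ such that the edge $V_i\leftarrow V_j$ is in the graph; otherwise it is non-causal. $\mathrm{pa}(X,\mathcal{G})$ is the set of nodes $W$ with $W\to X$; $\mathrm{de}(X,\mathcal{G})$ (resp. $\mathrm{possde}(X,\mathcal{G})$) is the set of nodes reachable from $X$ by a directed (resp. possibly directed) path, including $X$ itself; for node sets take unions. **Maximal PDAGs.** A v-structure is $U\to V\leftarrow W$ with $U,W$ non-adjacent. A PDAG is maximal if none of these is an induced subgraph: (a) $A\to B-C$, with $A,C$ non-adjacent; (b) $A\to B\to C$, $A-C$; (c) $B\to D$, $C\to D$, $A-D$, $A-B$, $A-C$, with $B,C$ non-adjacent; (d) $B\to C\to D$, $A-B$, $A-C$, $A-D$, with $B,D$ non-adjacent. A maximal PDAG $\mathcal{G}$ represents the (non-empty) set $[\mathcal{G}]$ of DAGs that have the same adjacencies and v-structures as $\mathcal{G}$ and contain all its directed edges; for each undirected edge of $\mathcal{G}$ both orientations occur in $[\mathcal{G}]$. DAGs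 are special cases, with $[\mathcal{G}]=\{\mathcal{G}\}$. **d-separation and faithfulness.** A node $V$ is a collider on a path if the path contains $U\to V\leftarrow W$; a non-collider if it contains a subpath $(U,V,W)$ with $U\leftarrow V$, or $V\to W$, or $U-V-W$ with $U,W$ non-adjacent. A path is of definite status if every non-endpoint is a collider or a non-collider on it. A definite status path is blocked by a node set $\mathbf{Z}$ if it contains a non-collider in $\mathbf{Z}$ or a collider $C$ with $\mathrm{de}(C,\mathcal{G})\cap\mathbf{Z}=\emptyset$; otherwise it is open given $\mathbf{Z}$. For pairwise disjoint $\mathbf{A},\mathbf{B},\mathbf{Z}$, $\mathbf{A}\perp_{\mathcal{G}}\mathbf{B}\mid\mathbf{Z}$ means that $\mathbf{Z}$ blocks every definite status path between a node of $\mathbf{A}$ and a node of $\mathbf{B}$. A density $f$ is faithful to $\mathcal{G}$ if, for all pairwise disjoint $\mathbf{A},\mathbf{B},\mathbf{Z}$, $\mathbf{A}\perp_{\mathcal{G}}\mathbf{B}\mid\mathbf{Z}$ holds if and only if $\mathbf{A}$ is conditionally independent of $\mathbf{B}$ given $\mathbf{Z}$ under $f$. **Causal and forbidden nodes, valid adjustment sets.** For disjoint $\mathbf{X},\mathbf{Y}$, $\mathrm{cn}(\mathbf{X},\mathbf{Y},\mathcal{G})$ (resp. $\mathrm{posscn}(\mathbf{X},\mathbf{Y},\mathcal{G})$) is the set of all nodes on proper causal (resp. proper possibly causal) paths from $\mathbf{X}$ to $\mathbf{Y}$, excluding nodes in $\mathbf{X}$, and $\mathrm{forb}(\mathbf{X},\mathbf{Y},\mathcal{G})=\mathrm{possde}(\mathrm{posscn}(\mathbf{X},\mathbf{Y},\mathcal{G}),\mathcal{G})\cup\mathbf{X}$.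 A node set $\mathbf{Z}$ disjoint from $\mathbf{X}\cup\mathbf{Y}$ is a valid adjustment set relative to $(\mathbf{X},\mathbf{Y})$ in $\mathcal{G}$ if: (1) $\mathcal{G}$ is amenable relative to $(\mathbf{X},\mathbf{Y})$, i.e. every proper possibly causal path from $\mathbf{X}$ to $\mathbf{Y}$ starts with a directed edge out of $\mathbf{X}$; (2) $\mathbf{Z}\cap\mathrm{forb}(\mathbf{X},\mathbf{Y},\mathcal{G})=\emptyset$; (3) all proper non-causal definite status paths from $\mathbf{X}$ to $\mathbf{Y}$ are blocked by $\mathbf{Z}$. **Compatibility and causal linear model.** A density $f$ of $\mathbf{V}=(V_1,\dots,V_p)$ is compatible with a causal DAG $\mathcal{D}$ if all interventional densities satisfy $f(\mathbf{v}\mid do(\mathbf{x}))=\prod_{V_i\in\mathbf{V}\setminus\mathbf{X}}f(v_i\mid\mathrm{pa}(V_i,\mathcal{D}))$ for values consistent with $\mathbf{X}=\mathbf{x}$ and $0$ otherwise; it is compatible with a causal maximal PDAG $\mathcal{G}$ if it is compatible with some $\mathcal{D}\in[\mathcal{G}]$. $\mathbf{V}$ follows a causal linear model compatible with a DAG $\mathcal{D}$ if its distribution is compatible with $\mathcal{D}$ and $V_i=\sum_{V_j\in\mathrm{pa}(V_i,\mathcal{D})}\alpha_{ij}V_j+\epsilon_{v_i}$, $i=1,\dots,p$, with $\alpha_{ij}\in\mathbb{R}$ and jointly independent errors $\epsilon_{v_i}$ of mean $0$ and finite variance (not necessarily Gaussian). It is compatible with a maximal PDAG $\mathcal{G}$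 if it is compatible with some $\mathcal{D}\in[\mathcal{G}]$. In (ii) and (iii) the covariance matrix of $\mathbf{V}$ is assumed non-singular. **Asymptotic variance.** $\Sigma_{\mathbf{st}}$ is the covariance matrix between $\mathbf{S}$ and $\mathbf{T}$, $\Sigma_{\mathbf{ss}.\mathbf{t}}=\Sigma_{\mathbf{ss}}-\Sigma_{\mathbf{st}}\Sigma_{\mathbf{tt}}^{-1}\Sigma_{\mathbf{ts}}$, written $\sigma_{ss.\mathbf{t}}$ if $|\mathbf{S}|=1$ (juxtaposed subscripts denote unions of conditioning sets); $\mathbf{X}_{-i}=\mathbf{X}\setminus\{X_i\}$. For a valid adjustment set $\mathbf{Z}$, $\hat{\tau}^{\mathbf{z}}_{\mathbf{yx}}$ is the matrix whose $(j,i)$ entry is the least squares coefficient of $X_i$ in the regression of $Y_j$ on $\mathbf{X}$ and $\mathbf{Z}$, and $a.var(\hat{\tau}^{\mathbf{z}}_{\mathbf{yx}})$ is the matrix of its asymptotic variances, with entries $$a.var(\hat{\tau}^{\mathbf{z}}_{\mathbf{yx}})_{j,i}=\frac{\sigma_{y_jy_j.\mathbf{xz}}}{\sigma_{x_ix_i.\mathbf{x}_{-i}\mathbf{z}}}.$$ *)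

theory Defs
  imports "HOL-Probability.Probability"
begin

section \<open>Partially directed graphs\<close>

text \<open>\<open>(u, v) \<in> dir G\<close> is the edge \<open>u \<rightarrow> v\<close>; the undirected edge \<open>u - v\<close> is
  stored as both pairs \<open>(u, v)\<close> and \<open>(v, u)\<close> in \<open>und G\<close>.\<close>

record 'v pgraph =
  nodes :: "'v set"
  dir :: "('v \<times> 'v) set"
  und :: "('v \<times> 'v) set"

definition adj :: "'v pgraph \<Rightarrow> 'v \<Rightarrow> 'v \<Rightarrow> bool" where
  "adj G u v \<longleftrightarrow> (u, v) \<in> dir G \<or> (v, u) \<in> dir G \<or> (u, v) \<in> und G"

definition simple_graph :: "'v pgraph \<Rightarrow> bool" where
  "simple_graph G \<longleftrightarrow>
     finite (nodes G) \<and>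
     dir G \<subseteq> nodes G \<times> nodes G \<and> und G \<subseteq> nodes G \<times> nodes G \<and>
     irrefl (dir G) \<and> irrefl (und G) \<and> sym (und G) \<and>
     dir G \<inter> (dir G)\<inverse> = {} \<and> dir G \<inter> und G = {}"

definition PDAG :: "'v pgraph \<Rightarrow> bool" where
  "PDAG G \<longleftrightarrow> simple_graph G \<and> acyclic (dir G)"

definition DAG :: "'v pgraph \<Rightarrow> bool" where
  "DAG D \<longleftrightarrow> PDAG D \<and> und D = {}"

definition gpath :: "'v pgraph \<Rightarrow> 'v list \<Rightarrow> bool" where
  "gpath G p \<longleftrightarrow> p \<noteq> [] \<and> distinct p \<and> set p \<subseteq> nodes G \<and>
     (\<forall>i. Suc i < length p \<longrightarrow> adj G (p ! i) (p ! Suc i))"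

definition causal_path :: "'v pgraph \<Rightarrow> 'v list \<Rightarrow> bool" where
  "causal_path G p \<longleftrightarrow> gpath G p \<and>
     (\<forall>i. Suc i < length p \<longrightarrow> (p ! i, p ! Suc i) \<in> dir G)"

definition poss_causal_path :: "'v pgraph \<Rightarrow> 'v list \<Rightarrow> bool" where
  "poss_causal_path G p \<longleftrightarrow> gpath G p \<and>
     \<not> (\<exists>i j. i < j \<and> j < length p \<and> (p ! j, p ! i) \<in> dir G)"

definition noncausal_path :: "'v pgraph \<Rightarrow> 'v list \<Rightarrow> bool" where
  "noncausal_path G p \<longleftrightarrow> gpath G p \<and> \<not> poss_causal_path G p"

definition path_from_to :: "'v pgraph \<Rightarrow> 'v set \<Rightarrow> 'v set \<Rightarrow> 'v list \<Rightarrow> bool" where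
  "path_from_to G X Y p \<longleftrightarrow> gpath G p \<and> hd p \<in> X \<and> last p \<in> Y"

definition proper_path :: "'v pgraph \<Rightarrow> 'v set \<Rightarrow> 'v set \<Rightarrow> 'v list \<Rightarrow> bool" where
  "proper_path G X Y p \<longleftrightarrow> path_from_to G X Y p \<and> set (tl p) \<inter> X = {}"

text \<open>The operators below take node sets. One-element paths are allowed, so
  \<open>S \<subseteq> de G S\<close> for every set \<open>S\<close> of nodes of \<open>G\<close>.\<close>

definition pa :: "'v pgraph \<Rightarrow> 'v set \<Rightarrow> 'v set" where
  "pa G S = {w. \<exists>v\<in>S. (w, v) \<in> dir G}"

definition de :: "'v pgraph \<Rightarrow> 'v set \<Rightarrow> 'v set" where
  "de G S = {w. \<exists>p. causal_path G p \<and> hd p \<in> S \<and> last p = w}"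

definition possde :: "'v pgraph \<Rightarrow> 'v set \<Rightarrow> 'v set" where
  "possde G S = {w. \<exists>p. poss_causal_path G p \<and> hd p \<in> S \<and> last p = w}"


section \<open>Maximal PDAGs\<close>

definition nonadj :: "'v pgraph \<Rightarrow> 'v \<Rightarrow> 'v \<Rightarrow> bool" where
  "nonadj G u v \<longleftrightarrow> u \<noteq> v \<and> \<not> adj G u v"

definition v_structures :: "'v pgraph \<Rightarrow> ('v \<times> 'v \<times> 'v) set" where
  "v_structures G = {(u, v, w). (u, v) \<in> dir G \<and> (w, v) \<in> dir G \<and> nonadj G u w}"

definition DAG_class :: "'v pgraph \<Rightarrow> 'v pgraph set" where
  "DAG_class G = {D. DAG D \<and> nodes D = nodes G \<and> (\<forall>u v. adj D u v \<longleftrightarrow> adj G u v) \<and>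
     v_structures D = v_structures G \<and> dir G \<subseteq> dir D}"

definition orientation_closed :: "'v pgraph \<Rightarrow> bool" where
  "orientation_closed G \<longleftrightarrow>
     \<not> (\<exists>A B C. (A, B) \<in> dir G \<and> (B, C) \<in> und G \<and> nonadj G A C) \<and>
     \<not> (\<exists>A B C. (A, B) \<in> dir G \<and> (B, C) \<in> dir G \<and> (A, C) \<in> und G) \<and>
     \<not> (\<exists>A B C D. (B, D) \<in> dir G \<and> (C, D) \<in> dir G \<and> (A, D) \<in> und G \<and>
          (A, B) \<in> und G \<and> (A, C) \<in> und G \<and> nonadj G B C) \<and>
     \<not> (\<exists>A B C D. (B, C) \<in> dir G \<and> (C, D) \<in> dir G \<and> (A, B) \<in> und G \<and>
          (A, C) \<in> und G \<and> (A, D) \<in> und G \<and> nonadj G B D)"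

text \<open>The four forbidden patterns alone do not exclude graphs such as the undirected
  4-cycle, for which \<open>DAG_class G = {}\<close>; the last two conjuncts record that a maximal PDAG
  represents a non-empty class in which every undirected edge occurs in both orientations.
  As \<open>und G\<close> is symmetric, requiring \<open>u \<rightarrow> v\<close> for each pair covers both orientations.\<close>

definition maximal_PDAG :: "'v pgraph \<Rightarrow> bool" where
  "maximal_PDAG G \<longleftrightarrow> PDAG G \<and> orientation_closed G \<and>
     DAG_class G \<noteq> {} \<and>
     (\<forall>(u, v) \<in> und G. \<exists>D \<in> DAG_class G. (u, v) \<in> dir D)"


section \<open>d-separation\<close>

definition inner_pos :: "'v list \<Rightarrow> nat \<Rightarrow> bool" where
  "inner_pos p i \<longleftrightarrow> 0 < i \<and> Suc i < length p"

definition collider :: "'v pgraph \<Rightarrow> 'v list \<Rightarrow> nat \<Rightarrow> bool" where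
  "collider G p i \<longleftrightarrow> inner_pos p i \<and>
     (p ! (i - 1), p ! i) \<in> dir G \<and> (p ! Suc i, p ! i) \<in> dir G"

definition noncollider :: "'v pgraph \<Rightarrow> 'v list \<Rightarrow> nat \<Rightarrow> bool" where
  "noncollider G p i \<longleftrightarrow> inner_pos p i \<and>
     ((p ! i, p ! (i - 1)) \<in> dir G \<or> (p ! i, p ! Suc i) \<in> dir G \<or>
      ((p ! (i - 1), p ! i) \<in> und G \<and> (p ! i, p ! Suc i) \<in> und G \<and>
       nonadj G (p ! (i - 1)) (p ! Suc i)))"

definition definite_status :: "'v pgraph \<Rightarrow> 'v list \<Rightarrow> bool" where
  "definite_status G p \<longleftrightarrow> gpath G p \<and>
     (\<forall>i. inner_pos p i \<longrightarrow> collider G p i \<or> noncollider G p i)"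

definition blocked :: "'v pgraph \<Rightarrow> 'v set \<Rightarrow> 'v list \<Rightarrow> bool" where
  "blocked G Z p \<longleftrightarrow>
     (\<exists>i. noncollider G p i \<and> p ! i \<in> Z) \<or>
     (\<exists>i. collider G p i \<and> de G {p ! i} \<inter> Z = {})"

definition pairwise_disjoint_nodes :: "'v set \<Rightarrow> 'v set \<Rightarrow> 'v set \<Rightarrow> 'v set \<Rightarrow> bool" where
  "pairwise_disjoint_nodes N A B Z \<longleftrightarrow>
     A \<subseteq> N \<and> B \<subseteq> N \<and> Z \<subseteq> N \<and> A \<inter> B = {} \<and> A \<inter> Z = {} \<and> B \<inter> Z = {}"

definition d_separated :: "'v pgraph \<Rightarrow> 'v set \<Rightarrow> 'v set \<Rightarrow> 'v set \<Rightarrow> bool" where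
  "d_separated G A B Z \<longleftrightarrow>
     (\<forall>p. definite_status G p \<and> path_from_to G A B p \<longrightarrow> blocked G Z p)"


section \<open>Valid adjustment sets\<close>

definition cn :: "'v set \<Rightarrow> 'v set \<Rightarrow> 'v pgraph \<Rightarrow> 'v set" where
  "cn X Y G = (\<Union>p \<in> {p. proper_path G X Y p \<and> causal_path G p}. set p) - X"

definition posscn :: "'v set \<Rightarrow> 'v set \<Rightarrow> 'v pgraph \<Rightarrow> 'v set" where
  "posscn X Y G = (\<Union>p \<in> {p. proper_path G X Y p \<and> poss_causal_path G p}. set p) - X"

definition forb :: "'v set \<Rightarrow> 'v set \<Rightarrow> 'v pgraph \<Rightarrow> 'v set" where
  "forb X Y G = possde G (posscn X Y G) \<union> X"

definition opt_set :: "'v set \<Rightarrow> 'v set \<Rightarrow> 'v pgraph \<Rightarrow> 'v set" where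
  "opt_set X Y G = pa G (cn X Y G) - forb X Y G"

definition amenable :: "'v set \<Rightarrow> 'v set \<Rightarrow> 'v pgraph \<Rightarrow> bool" where
  "amenable X Y G \<longleftrightarrow>
     (\<forall>p. proper_path G X Y p \<and> poss_causal_path G p \<longrightarrow> (p ! 0, p ! 1) \<in> dir G)"

definition valid_adjustment_set :: "'v set \<Rightarrow> 'v set \<Rightarrow> 'v pgraph \<Rightarrow> 'v set \<Rightarrow> bool" where
  "valid_adjustment_set X Y G Z \<longleftrightarrow>
     Z \<subseteq> nodes G \<and> Z \<inter> (X \<union> Y) = {} \<and>
     amenable X Y G \<and>
     Z \<inter> forb X Y G = {} \<and>
     (\<forall>p. proper_path G X Y p \<and> noncausal_path G p \<and> definite_status G p \<longrightarrow> blocked G Z p)"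


section \<open>Densities\<close>

text \<open>Densities of a random vector indexed by a finite set \<open>N\<close> are taken with respect to the
  product of \<open>\<sigma>\<close>-finite measures \<open>\<mu> i\<close> on the Borel sets of the reals; \<open>\<mu> = (\<lambda>_. lborel)\<close>
  is the case of Lebesgue densities. Points are extensional functions in
  \<open>space (Pi\<^sub>M N \<mu>)\<close>.\<close>

definition reference_measures :: "'v set \<Rightarrow> ('v \<Rightarrow> real measure) \<Rightarrow> bool" where
  "reference_measures N \<mu> \<longleftrightarrow>
     (\<forall>i\<in>N. sigma_finite_measure (\<mu> i) \<and> sets (\<mu> i) = sets borel)"

definition has_density ::
  "'w measure \<Rightarrow> 'v set \<Rightarrow> ('v \<Rightarrow> real measure) \<Rightarrow> ('v \<Rightarrow> 'w \<Rightarrow> real) \<Rightarrow>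
   (('v \<Rightarrow> real) \<Rightarrow> real) \<Rightarrow> bool" where
  "has_density P N \<mu> V f \<longleftrightarrow>
     (\<forall>v. 0 \<le> f v) \<and>
     distributed P (Pi\<^sub>M N \<mu>) (\<lambda>\<omega>. \<lambda>i\<in>N. V i \<omega>) (\<lambda>v. ennreal (f v))"

definition marginal ::
  "'v set \<Rightarrow> ('v \<Rightarrow> real measure) \<Rightarrow> (('v \<Rightarrow> real) \<Rightarrow> real) \<Rightarrow> 'v set \<Rightarrow> ('v \<Rightarrow> real) \<Rightarrow> real" where
  "marginal N \<mu> f S v = (\<integral>w. f (merge S (N - S) (v, w)) \<partial>Pi\<^sub>M (N - S) \<mu>)"

definition cond_density ::
  "'v set \<Rightarrow> ('v \<Rightarrow> real measure) \<Rightarrow> (('v \<Rightarrow> real) \<Rightarrow> real) \<Rightarrow> 'v set \<Rightarrow> 'v set \<Rightarrow>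
   ('v \<Rightarrow> real) \<Rightarrow> real" where
  "cond_density N \<mu> f A Z v = marginal N \<mu> f (A \<union> Z) v / marginal N \<mu> f Z v"

definition cond_indep ::
  "'v set \<Rightarrow> ('v \<Rightarrow> real measure) \<Rightarrow> (('v \<Rightarrow> real) \<Rightarrow> real) \<Rightarrow>
   'v set \<Rightarrow> 'v set \<Rightarrow> 'v set \<Rightarrow> bool" where
  "cond_indep N \<mu> f A B Z \<longleftrightarrow>
     (AE v in Pi\<^sub>M N \<mu>. marginal N \<mu> f Z v > 0 \<longrightarrow>
        cond_density N \<mu> f (A \<union> B) Z v = cond_density N \<mu> f A Z v * cond_density N \<mu> f B Z v)"

definition faithful :: "('v \<Rightarrow> real measure) \<Rightarrow> (('v \<Rightarrow> real) \<Rightarrow> real) \<Rightarrow> 'v pgraph \<Rightarrow> bool" where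
  "faithful \<mu> f G \<longleftrightarrow>
     (\<forall>A B Z. pairwise_disjoint_nodes (nodes G) A B Z \<longrightarrow>
        (d_separated G A B Z \<longleftrightarrow> cond_indep (nodes G) \<mu> f A B Z))"


section \<open>Compatibility with a causal graph\<close>

text \<open>A regular version \<open>k\<close> of the conditional density of coordinate \<open>i\<close> given the
  coordinates in \<open>S\<close>. Quotients of marginals do not suffice for interventions: they leave
  the conditional density undefined at values of the conditioning variables of density 0,
  which an intervention may nevertheless set.\<close>

definition cond_density_version ::
  "'v set \<Rightarrow> ('v \<Rightarrow> real measure) \<Rightarrow> (('v \<Rightarrow> real) \<Rightarrow> real) \<Rightarrow> 'v \<Rightarrow> 'v set \<Rightarrow>
   (('v \<Rightarrow> real) \<Rightarrow> real) \<Rightarrow> bool" where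
  "cond_density_version N \<mu> f i S k \<longleftrightarrow>
     k \<in> borel_measurable (Pi\<^sub>M (insert i S) \<mu>) \<and>
     (\<forall>v. 0 \<le> k v) \<and>
     (\<forall>z \<in> space (Pi\<^sub>M S \<mu>). (\<integral>\<^sup>+ t. ennreal (k (z(i := t))) \<partial>\<mu> i) = 1) \<and>
     (AE v in Pi\<^sub>M (insert i S) \<mu>.
        marginal N \<mu> f (insert i S) v = k v * marginal N \<mu> f S v)"

text \<open>\<open>fdo W x v\<close> is the interventional density \<open>f(v | do(W = x))\<close>, for arbitrary \<open>W \<subseteq> N\<close>;
  only the values of \<open>x\<close> on \<open>W\<close> matter, and the empty intervention gives \<open>f\<close>. Densities being
  determined up to null sets, the truncated factorization holds for almost all values of the
  non-intervened coordinates. The conditional densities are the same for all interventions.\<close>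

definition compatible_DAG ::
  "('v \<Rightarrow> real measure) \<Rightarrow> (('v \<Rightarrow> real) \<Rightarrow> real) \<Rightarrow>
   ('v set \<Rightarrow> ('v \<Rightarrow> real) \<Rightarrow> ('v \<Rightarrow> real) \<Rightarrow> real) \<Rightarrow> 'v pgraph \<Rightarrow> bool" where
  "compatible_DAG \<mu> f fdo D \<longleftrightarrow>
     (\<forall>x. fdo {} x = f) \<and>
     (\<exists>k. (\<forall>i \<in> nodes D. cond_density_version (nodes D) \<mu> f i (pa D {i}) (k i)) \<and>
        (\<forall>W x. W \<subseteq> nodes D \<longrightarrow>
           (AE w in Pi\<^sub>M (nodes D - W) \<mu>.
              let v = merge (nodes D - W) W (w, x)
              in fdo W x v = (\<Prod>i \<in> nodes D - W. k i (restrict v (insert i (pa D {i}))))) \<and>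
           (\<forall>v. (\<exists>i\<in>W. v i \<noteq> x i) \<longrightarrow> fdo W x v = 0)))"

definition compatible ::
  "('v \<Rightarrow> real measure) \<Rightarrow> (('v \<Rightarrow> real) \<Rightarrow> real) \<Rightarrow>
   ('v set \<Rightarrow> ('v \<Rightarrow> real) \<Rightarrow> ('v \<Rightarrow> real) \<Rightarrow> real) \<Rightarrow> 'v pgraph \<Rightarrow> bool" where
  "compatible \<mu> f fdo G \<longleftrightarrow> (\<exists>D \<in> DAG_class G. compatible_DAG \<mu> f fdo D)"

definition causal_linear_model_DAG ::
  "'w measure \<Rightarrow> ('v \<Rightarrow> real measure) \<Rightarrow> ('v \<Rightarrow> 'w \<Rightarrow> real) \<Rightarrow> (('v \<Rightarrow> real) \<Rightarrow> real) \<Rightarrow>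
   ('v set \<Rightarrow> ('v \<Rightarrow> real) \<Rightarrow> ('v \<Rightarrow> real) \<Rightarrow> real) \<Rightarrow> 'v pgraph \<Rightarrow> bool" where
  "causal_linear_model_DAG P \<mu> V f fdo D \<longleftrightarrow>
     compatible_DAG \<mu> f fdo D \<and>
     (\<exists>(\<alpha> :: 'v \<Rightarrow> 'v \<Rightarrow> real) (\<epsilon> :: 'v \<Rightarrow> 'w \<Rightarrow> real).
        prob_space.indep_vars P (\<lambda>_. borel) \<epsilon> (nodes D) \<and>
        (\<forall>i \<in> nodes D.
           integrable P (\<epsilon> i) \<and> integrable P (\<lambda>\<omega>. (\<epsilon> i \<omega>)\<^sup>2) \<and> (\<integral>\<omega>. \<epsilon> i \<omega> \<partial>P) = 0 \<and>
           (AE \<omega> in P. V i \<omega> = (\<Sum>j \<in> pa D {i}. \<alpha> i j * V j \<omega>) + \<epsilon> i \<omega>)))"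

definition causal_linear_model ::
  "'w measure \<Rightarrow> ('v \<Rightarrow> real measure) \<Rightarrow> ('v \<Rightarrow> 'w \<Rightarrow> real) \<Rightarrow> (('v \<Rightarrow> real) \<Rightarrow> real) \<Rightarrow>
   ('v set \<Rightarrow> ('v \<Rightarrow> real) \<Rightarrow> ('v \<Rightarrow> real) \<Rightarrow> real) \<Rightarrow> 'v pgraph \<Rightarrow> bool" where
  "causal_linear_model P \<mu> V f fdo G \<longleftrightarrow>
     (\<exists>D \<in> DAG_class G. causal_linear_model_DAG P \<mu> V f fdo D)"


section \<open>Asymptotic variance\<close>

text \<open>Matrices are functions of two indices; \<open>inverse_on T A\<close> is the inverse of the \<open>T \<times> T\<close>
  block of \<open>A\<close>, uniquely determined on \<open>T \<times> T\<close> when it exists.\<close>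

definition is_inverse_on ::
  "'v set \<Rightarrow> ('v \<Rightarrow> 'v \<Rightarrow> real) \<Rightarrow> ('v \<Rightarrow> 'v \<Rightarrow> real) \<Rightarrow> bool" where
  "is_inverse_on T A B \<longleftrightarrow>
     (\<forall>i\<in>T. \<forall>j\<in>T. (\<Sum>k\<in>T. A i k * B k j) = (if i = j then 1 else 0) \<and>
                   (\<Sum>k\<in>T. B i k * A k j) = (if i = j then 1 else 0))"

definition inverse_on :: "'v set \<Rightarrow> ('v \<Rightarrow> 'v \<Rightarrow> real) \<Rightarrow> 'v \<Rightarrow> 'v \<Rightarrow> real" where
  "inverse_on T A = (SOME B. is_inverse_on T A B)"

definition nonsingular_on :: "'v set \<Rightarrow> ('v \<Rightarrow> 'v \<Rightarrow> real) \<Rightarrow> bool" where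
  "nonsingular_on T A \<longleftrightarrow> (\<exists>B. is_inverse_on T A B)"

definition cov_matrix :: "'w measure \<Rightarrow> ('v \<Rightarrow> 'w \<Rightarrow> real) \<Rightarrow> 'v \<Rightarrow> 'v \<Rightarrow> real" where
  "cov_matrix P V i j =
     (\<integral>\<omega>. (V i \<omega> - (\<integral>\<omega>'. V i \<omega>' \<partial>P)) * (V j \<omega> - (\<integral>\<omega>'. V j \<omega>' \<partial>P)) \<partial>P)"

definition cond_cov :: "('v \<Rightarrow> 'v \<Rightarrow> real) \<Rightarrow> 'v set \<Rightarrow> 'v \<Rightarrow> 'v \<Rightarrow> real" where
  "cond_cov \<Sigma> T i j = \<Sigma> i j - (\<Sum>k\<in>T. \<Sum>l\<in>T. \<Sigma> i k * inverse_on T \<Sigma> k l * \<Sigma> l j)"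

text \<open>The entry for \<open>y \<in> Y\<close> and \<open>x \<in> X\<close> of the matrix of asymptotic variances of the least
  squares coefficients of \<open>X\<close> in the regression of \<open>Y\<close> on \<open>X\<close> and \<open>Z\<close>, for a valid
  adjustment set \<open>Z\<close>.\<close>

definition avar :: "('v \<Rightarrow> 'v \<Rightarrow> real) \<Rightarrow> 'v set \<Rightarrow> 'v set \<Rightarrow> 'v \<Rightarrow> 'v \<Rightarrow> real" where
  "avar \<Sigma> X Z y x = cond_cov \<Sigma> (X \<union> Z) y y / cond_cov \<Sigma> ((X - {x}) \<union> Z) x x"

end

theory Submission
  imports Defs
begin

text \<open>
  Write \<open>O\<close> for the optimal set, \<open>cn\<^sub>D\<close> for the causal nodes of a represented DAG \<open>D\<close>, and \<open>F\<close> for the nodes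
  that possibly descend from possibly causal nodes, so that the forbidden set is \<open>F \<union> X\<close>. Questions
  about the graph are reduced to represented DAGs: possible descent in the graph is descent
  in some of them, and definite status is the status in all of them.

  The existence of a valid adjustment set \<open>Z\<close> has two consequences. First, \<open>F\<close> contains no source
  (\<open>no_source_below_cn\<close>, \<open>X_F\<close>): a causal node above a source would be the top of a fork from a source to a
  target that \<open>Z\<close> may not block. Second, every node of \<open>F\<close> is a descendant of a source in the graph
  itself (\<open>forbidden_reach\<close>), because amenability together with the orientation rules leaves no room for
  an undirected edge at a source. Therefore \<open>O\<close>, which is defined by the graph, works for every \<open>D\<close>: a
  parent in \<open>D\<close> of a node of \<open>cn\<^sub>D\<close> lies in \<open>cn\<^sub>D\<close>, \<open>X\<close> or \<open>O\<close> (\<open>parents_of_causal\<close>). Validity of \<open>O\<close> follows by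
  reading a non-causal path backwards from the target (\<open>optimal_set_blocks\<close>).

  For the variances, the covariance matrix is a positive definite form on coefficient vectors. Let
  \<open>D\<close> be the true DAG. Solving the structural equations of \<open>cn\<^sub>D\<close> writes a target as a combination of \<open>X\<close> and \<open>O\<close>
  plus errors of nodes in \<open>cn\<^sub>D\<close>. No node of \<open>X\<close>, \<open>O\<close> or \<open>Z\<close> descends from \<open>cn\<^sub>D\<close>, so these errors are
  uncorrelated with all of them, and regression on \<open>X\<close> and \<open>O\<close> leaves the least variance
  (\<open>regression_with_error\<close>). This compares the numerators. For the denominators, the nodes of \<open>O - Z\<close>
  have to be uncorrelated with \<open>X\<close> after regression on \<open>Z\<close> (\<open>optimal_node_uncorrelated\<close>,
  \<open>regression_without_gain\<close>). By the linear Markov property (\<open>separation\<close>) it is enough that no open walk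
  in \<open>D\<close> joins them to \<open>X\<close>. A shortest such walk, chosen with as few descendants of its nodes as
  possible, would be an open path of definite status in the graph (\<open>open_walk_transfer\<close>), and
  continuing it from \<open>O\<close> through causal nodes to a target would contradict the validity of \<open>Z\<close>
  (\<open>optimal_set_separated\<close>).

  If the variances agree, so do the numerators, and by definiteness the combination for the target has
  coefficient zero on \<open>O - Z\<close>. The errors are not only uncorrelated but independent of \<open>X\<close> and \<open>O\<close>, so
  the target is conditionally independent of \<open>O - Z\<close> given the rest, whatever the distribution of the
  errors (\<open>cond_indep_of_coefficients\<close>). This is what faithfulness speaks about: a zero partial correlation
  alone would not do. Faithfulness yields a separation in the graph, but a node of \<open>O\<close> has a causal path
  to a target, and this path is open (\<open>optimal_node_connected\<close>).
\<close>


section \<open>Sequences and induced paths\<close>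

lemma seq_relpow:
  assumes "\<And>k. i \<le> k \<Longrightarrow> k < i + m \<Longrightarrow> (f k, f (Suc k)) \<in> R"
  shows "(f i, f (i + m)) \<in> R ^^ m"
  using assms by (induction m) auto

lemma seq_rtrancl:
  assumes "i \<le> j" "\<And>k. i \<le> k \<Longrightarrow> k < j \<Longrightarrow> (f k, f (Suc k)) \<in> R"
  shows "(f i, f j) \<in> R\<^sup>*"
  using seq_relpow[of i "j - i" f R] assms by (auto intro: relpow_imp_rtrancl)

lemma seq_trancl:
  assumes "i < j" "\<And>k. i \<le> k \<Longrightarrow> k < j \<Longrightarrow> (f k, f (Suc k)) \<in> R"
  shows "(f i, f j) \<in> R\<^sup>+"
proof -
  have "(f i, f (i + (j - i))) \<in> R ^^ (j - i)" by (rule seq_relpow) (use assms in auto)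
  then show ?thesis
    unfolding trancl_power using assms(1) by (intro exI[of _ "j - i"]) auto
qed

lemma relpow_sequence:
  assumes "(a, b) \<in> R ^^ n"
  obtains f where "f 0 = a" "f n = b" "\<And>i. i < n \<Longrightarrow> (f i, f (Suc i)) \<in> R"
  using assms relpow_fun_conv[of a b n R] by auto

lemma relpow_shortcut:
  assumes "\<And>i. i < n \<Longrightarrow> (f i, f (Suc i)) \<in> R" "Suc i < j" "j \<le> n" "(f i, f j) \<in> R"
  shows "(f 0, f n) \<in> R ^^ (Suc i + (n - j))"
proof -
  have "(f 0, f i) \<in> R ^^ i" "(f j, f n) \<in> R ^^ (n - j)"
    using seq_relpow[of 0 i f R] seq_relpow[of j "n - j" f R] assms by auto
  with assms(4) have "(f 0, f n) \<in> R ^^ (i + (1 + (n - j)))"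
    unfolding relpow_add relpow_1 by blast
  then show ?thesis by simp
qed

lemma induced_sequence:
  assumes "(a, b) \<in> R\<^sup>*"
  obtains n f where "f 0 = a" "f n = b" "\<And>i. i < n \<Longrightarrow> (f i, f (Suc i)) \<in> R"
    "\<And>i j. Suc i < j \<Longrightarrow> j \<le> n \<Longrightarrow> (f i, f j) \<notin> R"
proof -
  define n where "n = (LEAST n. (a, b) \<in> R ^^ n)"
  have n: "(a, b) \<in> R ^^ n"
    unfolding n_def using assms by (metis LeastI rtrancl_imp_relpow)
  have least: "n \<le> m" if "(a, b) \<in> R ^^ m" for m
    unfolding n_def using that by (rule Least_le)
  obtain f where f: "f 0 = a" "f n = b" "\<And>i. i < n \<Longrightarrow> (f i, f (Suc i)) \<in> R"
    using relpow_sequence[OF n] by blast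
  have "(f i, f j) \<notin> R" if ij: "Suc i < j" "j \<le> n" for i j
  proof
    assume "(f i, f j) \<in> R"
    from relpow_shortcut[OF f(3) ij this] have "(a, b) \<in> R ^^ (Suc i + (n - j))"
      using f by simp
    with least[of "Suc i + (n - j)"] ij show False by auto
  qed
  with f that show ?thesis by blast
qed

lemma concat_sequences:
  assumes "\<And>i. i < n \<Longrightarrow> (f i, f (Suc i)) \<in> R" "\<And>i. i < m \<Longrightarrow> (g i, g (Suc i)) \<in> R" "f n = g 0"
  obtains h where "h 0 = f 0" "h n = f n" "h (n + m) = g m"
    "\<And>i. i < n + m \<Longrightarrow> (h i, h (Suc i)) \<in> R"
proof -
  define h where "h i = (if i \<le> n then f i else g (i - n))" for i
  show ?thesis
  proof (rule that[of h])
    show "h 0 = f 0" "h n = f n" "h (n + m) = g m"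
      using assms(3) by (auto simp: h_def)
    show "(h i, h (Suc i)) \<in> R" if i: "i < n + m" for i
    proof -
      consider "i < n" | "i = n" | "n < i" by linarith
      then show ?thesis
      proof cases
        case 3
        then have "Suc i - n = Suc (i - n)" by simp
        then show ?thesis using 3 i assms(2)[of "i - n"] by (simp add: h_def)
      qed (use i assms in \<open>auto simp: h_def\<close>)
    qed
  qed
qed


section \<open>Paths as lists\<close>

lemma map_upt_ends:
  "hd (map h [0..<Suc k]) = h 0" "last (map h [0..<Suc k]) = h k"
  "set (tl (map h [0..<Suc k])) = h ` {1..k}"
proof -
  show "hd (map h [0..<Suc k]) = h 0" by (subst hd_map) (simp_all del: upt_Suc)
  show "last (map h [0..<Suc k]) = h k" by simp
  have "tl [0..<Suc k] = [1..<Suc k]" by (simp add: tl_upt del: upt_Suc)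
  then show "set (tl (map h [0..<Suc k])) = h ` {1..k}"
    by (simp add: map_tl[symmetric] atLeastLessThanSuc_atLeastAtMost del: upt_Suc)
qed

lemma gpath_successively:
  "gpath G p \<longleftrightarrow> p \<noteq> [] \<and> distinct p \<and> set p \<subseteq> nodes G \<and> successively (adj G) p"
  by (auto simp: gpath_def successively_conv_nth)

lemma poss_causal_sorted_wrt:
  "poss_causal_path G p \<longleftrightarrow> gpath G p \<and> sorted_wrt (\<lambda>u v. (v, u) \<notin> dir G) p"
  by (auto simp: poss_causal_path_def sorted_wrt_iff_nth_less)

lemma proper_path_last_source:
  assumes "gpath G p" "hd p \<in> X"
  obtains ys x zs where "p = ys @ x # zs" "x \<in> X" "set zs \<inter> X = {}"
proof -
  have "\<exists>v\<in>set p. v \<in> X" using assms by (auto simp: gpath_def intro!: bexI[of _ "hd p"])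
  then show ?thesis using split_list_last_prop[of p "\<lambda>v. v \<in> X"] that by blast
qed

lemma simple_graphD:
  assumes "simple_graph H"
  shows "finite (nodes H)" "(u, v) \<in> dir H \<Longrightarrow> u \<in> nodes H" "(u, v) \<in> dir H \<Longrightarrow> v \<in> nodes H"
    "(u, v) \<in> und H \<Longrightarrow> u \<in> nodes H" "(u, v) \<in> und H \<Longrightarrow> v \<in> nodes H"
    "(u, u) \<notin> dir H" "(u, u) \<notin> und H" "(u, v) \<in> und H \<Longrightarrow> (v, u) \<in> und H"
    "(u, v) \<in> dir H \<Longrightarrow> (v, u) \<notin> dir H" "(u, v) \<in> dir H \<Longrightarrow> (u, v) \<notin> und H"
    "(u, v) \<in> dir H \<Longrightarrow> (v, u) \<notin> und H"
  using assms unfolding simple_graph_def irrefl_def sym_def by blast+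

lemma PDAGD: "PDAG H \<Longrightarrow> simple_graph H" "PDAG H \<Longrightarrow> acyclic (dir H)"
  by (auto simp: PDAG_def)

lemma adj_sym: "simple_graph H \<Longrightarrow> adj H u v \<Longrightarrow> adj H v u"
  by (auto simp: adj_def dest: simple_graphD)

lemma acyclic_seq_neq:
  assumes "acyclic R" "\<And>k. k < n \<Longrightarrow> (f k, f (Suc k)) \<in> R" "i < j" "j \<le> n"
  shows "f i \<noteq> f j"
proof
  assume "f i = f j"
  moreover have "(f i, f j) \<in> R\<^sup>+" using assms by (intro seq_trancl) auto
  ultimately show False using assms(1) by (auto simp: acyclic_def)
qed

lemma causal_path_of_sequence:
  assumes "PDAG H" "f 0 \<in> nodes H" "\<And>i. i < n \<Longrightarrow> (f i, f (Suc i)) \<in> dir H"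
  shows "causal_path H (map f [0..<Suc n])"
proof -
  note S = simple_graphD[OF PDAGD(1)[OF assms(1)]]
  have "f i \<in> nodes H" if "i \<le> n" for i
    using that assms(2) S(3)[OF assms(3)[of "i - 1"]] by (cases i) auto
  moreover have "inj_on f {0..<Suc n}"
    by (rule linorder_inj_onI)
       (use acyclic_seq_neq[of "dir H" n f] PDAGD(2)[OF assms(1)] assms(3) in \<open>auto\<close>)
  ultimately show ?thesis
    unfolding causal_path_def gpath_def
    using assms(3) by (auto simp: distinct_map adj_def simp del: upt_Suc)
qed

lemma causal_path_trancl:
  assumes "causal_path H p" "set (tl p) \<inter> X = {}" "i < j" "j < length p"
  shows "(p ! i, p ! j) \<in> (dir H \<inter> UNIV \<times> - X)\<^sup>+"
proof (rule seq_trancl[OF assms(3)])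
  fix k assume k: "i \<le> k" "k < j"
  then have "tl p ! k = p ! Suc k" "k < length (tl p)"
    using assms(4) by (auto simp: nth_tl)
  then have "p ! Suc k \<in> set (tl p)" by (metis nth_mem)
  then show "(p ! k, p ! Suc k) \<in> dir H \<inter> UNIV \<times> - X"
    using assms k by (auto simp: causal_path_def)
qed

lemma cn_iff:
  assumes "PDAG H" "X \<subseteq> nodes H"
  shows "c \<in> cn X Y H \<longleftrightarrow>
    (\<exists>x\<in>X. \<exists>y\<in>Y. (x, c) \<in> (dir H \<inter> UNIV \<times> - X)\<^sup>+ \<and> (c, y) \<in> (dir H \<inter> UNIV \<times> - X)\<^sup>*)"
    (is "_ \<longleftrightarrow> (\<exists>x\<in>X. \<exists>y\<in>Y. _ \<in> ?R\<^sup>+ \<and> _)")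
proof
  assume "c \<in> cn X Y H"
  then obtain p where p: "proper_path H X Y p" "causal_path H p" "c \<in> set p" "c \<notin> X"
    by (auto simp: cn_def)
  then obtain i where i: "i < length p" "c = p ! i" by (auto simp: in_set_conv_nth)
  from p have ne: "p \<noteq> []" and h: "hd p \<in> X" "last p \<in> Y" and tl: "set (tl p) \<inter> X = {}"
    by (auto simp: proper_path_def path_from_to_def gpath_def)
  have "0 < i" using i p h ne by (cases i) (auto simp: hd_conv_nth)
  then have "(p ! 0, c) \<in> ?R\<^sup>+" using causal_path_trancl[OF p(2) tl, of 0 i] i by auto
  moreover have "(c, last p) \<in> ?R\<^sup>*"
  proof (cases "i = length p - 1")
    case True then show ?thesis using i ne by (auto simp: last_conv_nth)
  next
    case False
    then have "i < length p - 1" using i by auto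
    from causal_path_trancl[OF p(2) tl this] show ?thesis
      using i ne by (auto simp: last_conv_nth)
  qed
  ultimately show "\<exists>x\<in>X. \<exists>y\<in>Y. (x, c) \<in> ?R\<^sup>+ \<and> (c, y) \<in> ?R\<^sup>*"
    using h ne by (auto simp: hd_conv_nth)
next
  assume "\<exists>x\<in>X. \<exists>y\<in>Y. (x, c) \<in> ?R\<^sup>+ \<and> (c, y) \<in> ?R\<^sup>*"
  then obtain x y n m where x: "x \<in> X" "y \<in> Y" "(x, c) \<in> ?R ^^ n" "n > 0" "(c, y) \<in> ?R ^^ m"
    by (auto simp: trancl_power rtrancl_power)
  obtain f where f: "f 0 = x" "f n = c" "\<And>i. i < n \<Longrightarrow> (f i, f (Suc i)) \<in> ?R"
    using relpow_sequence[OF x(3)] by blast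
  obtain g where g: "g 0 = c" "g m = y" "\<And>i. i < m \<Longrightarrow> (g i, g (Suc i)) \<in> ?R"
    using relpow_sequence[OF x(5)] by blast
  obtain h where h: "h 0 = x" "h n = c" "h (n + m) = y"
    "\<And>i. i < n + m \<Longrightarrow> (h i, h (Suc i)) \<in> ?R"
    by (rule concat_sequences[of n f ?R m g]) (use f g in auto)
  let ?p = "map h [0..<Suc (n + m)]"
  have cp: "causal_path H ?p"
    by (rule causal_path_of_sequence) (use assms x(1) h in auto)
  have "set (tl ?p) \<inter> X = {}"
  proof (rule ccontr)
    assume "\<not> ?thesis"
    then obtain v where v: "v \<in> set (tl ?p)" "v \<in> X" by blast
    from v(1) obtain j where "v = h j" "1 \<le> j" "j \<le> n + m"
      unfolding map_upt_ends by auto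
    then show False using h(4)[of "j - 1"] v(2) by auto
  qed
  moreover have "hd ?p = x" "last ?p = y"
    unfolding map_upt_ends using h by simp_all
  ultimately have "proper_path H X Y ?p"
    using cp x unfolding proper_path_def path_from_to_def causal_path_def by metis
  moreover have "c \<in> set ?p" using h(2) by (auto simp del: upt_Suc)
  moreover have "c \<notin> X" using x(3,4) f(2) f(3)[of "n - 1"] by auto
  ultimately show "c \<in> cn X Y H" using cp unfolding cn_def by blast
qed

lemma de_iff:
  assumes "PDAG H"
  shows "w \<in> de H S \<longleftrightarrow> (\<exists>s\<in>S. s \<in> nodes H \<and> (s, w) \<in> (dir H)\<^sup>*)"
proof
  assume "w \<in> de H S"
  then obtain p where p: "causal_path H p" "hd p \<in> S" "last p = w" by (auto simp: de_def)
  then have ne: "p \<noteq> []" "hd p \<in> nodes H" by (auto simp: causal_path_def gpath_def)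
  have "(p ! 0, p ! (length p - 1)) \<in> (dir H)\<^sup>*"
    by (rule seq_rtrancl) (use p in \<open>auto simp: causal_path_def\<close>)
  then show "\<exists>s\<in>S. s \<in> nodes H \<and> (s, w) \<in> (dir H)\<^sup>*"
    using p ne by (auto simp: hd_conv_nth last_conv_nth)
next
  assume "\<exists>s\<in>S. s \<in> nodes H \<and> (s, w) \<in> (dir H)\<^sup>*"
  then obtain s n where s: "s \<in> S" "s \<in> nodes H" "(s, w) \<in> dir H ^^ n"
    by (auto simp: rtrancl_power)
  obtain f where f: "f 0 = s" "f n = w" "\<And>i. i < n \<Longrightarrow> (f i, f (Suc i)) \<in> dir H"
    using relpow_sequence[OF s(3)] by blast
  have "causal_path H (map f [0..<Suc n])"
    by (rule causal_path_of_sequence) (use assms s f in auto)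
  moreover have "hd (map f [0..<Suc n]) = s" "last (map f [0..<Suc n]) = w"
    unfolding map_upt_ends using f by simp_all
  ultimately show "w \<in> de H S" using s unfolding de_def by blast
qed


section \<open>Maximal PDAGs and the DAGs they represent\<close>

locale max_pdag =
  fixes G :: "'v pgraph"
  assumes max: "maximal_PDAG G"
begin

lemma PDAG_G: "PDAG G" using max by (simp add: maximal_PDAG_def)

lemmas SG = simple_graphD[OF PDAGD(1)[OF PDAG_G]]
lemmas acyclic_G = PDAGD(2)[OF PDAG_G]
lemmas adj_G_sym = adj_sym[OF PDAGD(1)[OF PDAG_G]]

lemma rule_a: "(A, B) \<in> dir G \<Longrightarrow> (B, C) \<in> und G \<Longrightarrow> A \<noteq> C \<Longrightarrow> adj G A C"
  using max unfolding maximal_PDAG_def orientation_closed_def nonadj_def by blast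

lemma rule_b: "(A, B) \<in> dir G \<Longrightarrow> (B, C) \<in> dir G \<Longrightarrow> (A, C) \<notin> und G"
  using max unfolding maximal_PDAG_def orientation_closed_def by blast

lemma rule_d: "(B, C) \<in> dir G \<Longrightarrow> (C, D) \<in> dir G \<Longrightarrow> (A, B) \<in> und G \<Longrightarrow>
    (A, C) \<in> und G \<Longrightarrow> (A, D) \<in> und G \<Longrightarrow> \<not> nonadj G B D"
  using max unfolding maximal_PDAG_def orientation_closed_def by blast

lemma class_nonempty: "DAG_class G \<noteq> {}"
  using max by (simp add: maximal_PDAG_def)

lemma orient: "(u, v) \<in> und G \<Longrightarrow> \<exists>D\<in>DAG_class G. (u, v) \<in> dir D"
  using max unfolding maximal_PDAG_def by blast

context
  fixes D assumes D: "D \<in> DAG_class G"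
begin

lemma PDAG_D: "PDAG D" using D by (simp add: DAG_class_def DAG_def)
lemmas SD = simple_graphD[OF PDAGD(1)[OF PDAG_D]]
lemmas acyclic_D = PDAGD(2)[OF PDAG_D]

lemma nodes_D: "nodes D = nodes G" using D by (simp add: DAG_class_def)
lemma dir_sub: "(u, v) \<in> dir G \<Longrightarrow> (u, v) \<in> dir D" using D by (auto simp: DAG_class_def)
lemma dir_subset: "dir G \<subseteq> dir D" using D by (auto simp: DAG_class_def)
lemma adj_D: "adj D u v = adj G u v" using D by (simp add: DAG_class_def)

lemma adj_iff_dir: "adj G u v \<longleftrightarrow> (u, v) \<in> dir D \<or> (v, u) \<in> dir D"
  using D by (auto simp: DAG_class_def DAG_def adj_def)

lemma dir_D_cases: "(u, v) \<in> dir D \<Longrightarrow> (u, v) \<in> dir G \<or> (u, v) \<in> und G"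
  using adj_iff_dir[of u v] SD(9)[of u v] dir_sub[of v u] by (auto simp: adj_def)

lemma no_cycle: "(u, v) \<in> (dir D)\<^sup>+ \<Longrightarrow> (v, u) \<notin> (dir D)\<^sup>*"
  using acyclic_D by (meson acyclic_def trancl_rtrancl_trancl)

lemma dir_rtrancl_D: "(u, v) \<in> (dir G)\<^sup>* \<Longrightarrow> (u, v) \<in> (dir D)\<^sup>*"
  using dir_subset rtrancl_mono by blast

lemma v_structure_G:
  assumes "(u, v) \<in> dir D" "(w, v) \<in> dir D" "\<not> adj G u w" "u \<noteq> w"
  shows "(u, v) \<in> dir G" "(w, v) \<in> dir G"
proof -
  have "(u, v, w) \<in> v_structures D"
    using assms adj_D by (auto simp: v_structures_def nonadj_def)
  then have "(u, v, w) \<in> v_structures G" using D by (simp add: DAG_class_def)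
  then show "(u, v) \<in> dir G" "(w, v) \<in> dir G" by (auto simp: v_structures_def)
qed

text \<open>Rule (a) read inside a represented DAG: an undirected edge behind an arrow is shielded, and
  acyclicity orients the shielding edge.\<close>

lemma shortcut:
  assumes "(a, b) \<in> dir G" "(b, c) \<in> dir D" "(b, c) \<notin> dir G"
  shows "(a, c) \<in> dir D"
proof -
  have bc: "(b, c) \<in> und G" using assms dir_D_cases by blast
  have ab: "(a, b) \<in> dir D" using assms dir_sub by blast
  have "a \<noteq> c" using ab assms(2) SD(9) by blast
  then have "adj G a c" using rule_a[OF assms(1) bc] by blast
  moreover have "(c, a) \<notin> dir D"
    using no_cycle[of a c] ab assms(2) by (meson r_into_rtrancl trancl.simps)
  ultimately show ?thesis using adj_iff_dir by blast
qed

text \<open>An unshielded triple that is not a collider in one represented DAG has this status in the graph already: if the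
  graph had an arrow into the middle node, rule (a) would direct the other edge, and it cannot point
  inwards as well.\<close>

lemma noncollider_cases:
  assumes "(b, a) \<in> dir D \<or> (b, c) \<in> dir D" "adj G a b" "adj G b c" "nonadj G a c"
  shows "(b, a) \<in> dir G \<or> (b, c) \<in> dir G \<or> (a, b) \<in> und G \<and> (b, c) \<in> und G \<and> nonadj G a c"
proof (rule ccontr)
  assume n: "\<not> ?thesis"
  have ac: "a \<noteq> c" "\<not> adj G a c" using assms(4) by (auto simp: nonadj_def)
  consider "(a, b) \<in> dir G" | "(c, b) \<in> dir G" "(a, b) \<in> und G"
    using n assms by (auto simp: adj_def)
  then show False
  proof cases
    case 1
    then have "(b, c) \<notin> und G" using rule_a ac by blast
    then have "(c, b) \<in> dir G" using n assms(3) by (auto simp: adj_def)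
    with 1 have "(a, b) \<in> dir D" "(c, b) \<in> dir D" using dir_sub by auto
    then show False using assms(1) SD(9) by blast
  next
    case 2
    then show False using rule_a[of c b a] SG(8) ac adj_G_sym by blast
  qed
qed

lemma noncollider_into_D:
  assumes "noncollider G p i" "(p ! Suc i, p ! i) \<in> dir D"
  shows "(p ! i, p ! (i - 1)) \<in> dir D"
proof -
  consider "(p ! i, p ! (i - 1)) \<in> dir G" | "(p ! i, p ! Suc i) \<in> dir G"
    | "(p ! (i - 1), p ! i) \<in> und G" "(p ! i, p ! Suc i) \<in> und G" "nonadj G (p ! (i - 1)) (p ! Suc i)"
    using assms by (auto simp: noncollider_def)
  then show ?thesis
  proof cases
    case 3
    show ?thesis
    proof (rule ccontr)
      assume "\<not> ?thesis"
      then have "(p ! (i - 1), p ! i) \<in> dir D"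
        using 3 adj_iff_dir[of "p ! (i - 1)" "p ! i"] by (auto simp: adj_def)
      from v_structure_G(1)[OF this assms(2)] 3 SG(10) show False
        by (auto simp: nonadj_def)
    qed
  qed (use assms dir_sub SD(9) in blast)+
qed

end

text \<open>An undirected edge is oriented both ways by represented DAGs, one of which would close a cycle.\<close>

lemma und_not_trancl:
  assumes "(u, v) \<in> und G" shows "(u, v) \<notin> (dir G)\<^sup>+" "(v, u) \<notin> (dir G)\<^sup>+"
proof -
  have *: "(u, v) \<notin> (dir G)\<^sup>+" if "(u, v) \<in> und G" for u v
  proof
    assume uv: "(u, v) \<in> (dir G)\<^sup>+"
    obtain D where D: "D \<in> DAG_class G" "(v, u) \<in> dir D" using orient SG(8) \<open>(u, v) \<in> und G\<close> by blast
    then have "(u, v) \<in> (dir D)\<^sup>+" using uv dir_subset[OF D(1)] trancl_mono by blast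
    then show False using no_cycle[OF D(1)] D(2) by blast
  qed
  from *[of u v] *[of v u] assms SG(8) show "(u, v) \<notin> (dir G)\<^sup>+" "(v, u) \<notin> (dir G)\<^sup>+" by blast+
qed

lemma causal_in_class_poss_causal:
  assumes "D \<in> DAG_class G" "causal_path D p"
  shows "poss_causal_path G p"
proof -
  have "gpath G p"
    using assms nodes_D[OF assms(1)] adj_D[OF assms(1)] by (auto simp: causal_path_def gpath_def)
  moreover have "(p ! j, p ! i) \<notin> dir G" if "i < j" "j < length p" for i j
  proof
    assume "(p ! j, p ! i) \<in> dir G"
    then have "(p ! j, p ! i) \<in> dir D" using dir_sub assms by blast
    moreover have "(p ! i, p ! j) \<in> (dir D)\<^sup>+"
      by (rule seq_trancl) (use that assms in \<open>auto simp: causal_path_def\<close>)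
    ultimately show False using no_cycle[OF assms(1)] by blast
  qed
  ultimately show ?thesis by (auto simp: poss_causal_path_def)
qed

text \<open>A shortest path among the forward adjacencies of a possibly causal path. Since possible causality
  forbids backward arrows between any two positions, not only between neighbours, every subsequence
  that is a path is possibly causal again.\<close>

lemma unshielded_subsequence:
  assumes "poss_causal_path G p" "i \<le> j" "j < length p"
  obtains n f where "f 0 = i" "f n = j" "\<And>k. k \<le> n \<Longrightarrow> i \<le> f k \<and> f k \<le> j"
    "\<And>k. k < n \<Longrightarrow> adj G (p ! f k) (p ! f (Suc k))"
    "\<And>k. k < n \<Longrightarrow> (p ! f (Suc k), p ! f k) \<notin> dir G"
    "\<And>k. Suc k < n \<Longrightarrow> nonadj G (p ! f k) (p ! f (Suc (Suc k)))"
    "\<And>k. k < n \<Longrightarrow> f k < f (Suc k)"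
proof -
  define W where "W = {(i, j). i < j \<and> j < length p \<and> adj G (p ! i) (p ! j)}"
  have d: "distinct p" using assms(1) by (auto simp: poss_causal_path_def gpath_def)
  have "(i, j) \<in> W\<^sup>*"
    using seq_rtrancl[of i j "\<lambda>k. k" W] assms
    by (auto simp: W_def poss_causal_path_def gpath_def)
  then obtain n f where f: "f 0 = i" "f n = j" "\<And>k. k < n \<Longrightarrow> (f k, f (Suc k)) \<in> W"
    "\<And>k l. Suc k < l \<Longrightarrow> l \<le> n \<Longrightarrow> (f k, f l) \<notin> W"
    by (rule induced_sequence) blast
  have mono: "f k \<le> f l" if "k \<le> l" "l \<le> n" for k l
    using that
  proof (induction l)
    case (Suc l)
    then show ?case using f(3)[of l] by (cases "k = Suc l") (auto simp: W_def)
  qed auto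
  show ?thesis
  proof (rule that[OF f(1,2)])
    show "i \<le> f k \<and> f k \<le> j" if "k \<le> n" for k using mono[of 0 k] mono[of k n] f that by auto
    show "adj G (p ! f k) (p ! f (Suc k))" if "k < n" for k using f(3)[OF that] by (auto simp: W_def)
    show "f k < f (Suc k)" if "k < n" for k using f(3)[OF that] by (auto simp: W_def)
    show "(p ! f (Suc k), p ! f k) \<notin> dir G" if "k < n" for k
      using f(3)[OF that] assms(1) by (auto simp: W_def poss_causal_path_def)
    show "nonadj G (p ! f k) (p ! f (Suc (Suc k)))" if k: "Suc k < n" for k
    proof -
      have "f k < f (Suc (Suc k))" "f (Suc (Suc k)) < length p"
        using f(3)[of k] f(3)[of "Suc k"] k by (auto simp: W_def)
      then show ?thesis
        using f(4)[of k "Suc (Suc k)"] k d by (auto simp: W_def nonadj_def nth_eq_iff_index_eq)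
    qed
  qed
qed

text \<open>A possibly causal path contains an unshielded one between the same ends. Orienting its first
  edge forwards in some represented DAG forces all later edges forwards, because a first backward
  edge would create a v-structure.\<close>

lemma possde_iff:
  "w \<in> possde G S \<longleftrightarrow> (\<exists>D\<in>DAG_class G. \<exists>s\<in>S. s \<in> nodes G \<and> (s, w) \<in> (dir D)\<^sup>*)"
proof
  assume "w \<in> possde G S"
  then obtain p where p: "poss_causal_path G p" "hd p \<in> S" "last p = w" by (auto simp: possde_def)
  then have ne: "p \<noteq> []" "hd p \<in> nodes G" by (auto simp: poss_causal_path_def gpath_def)
  obtain n f where f: "f 0 = 0" "f n = length p - 1"
    "\<And>k. k < n \<Longrightarrow> adj G (p ! f k) (p ! f (Suc k))"
    "\<And>k. k < n \<Longrightarrow> (p ! f (Suc k), p ! f k) \<notin> dir G"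
    "\<And>k. Suc k < n \<Longrightarrow> nonadj G (p ! f k) (p ! f (Suc (Suc k)))"
    by (rule unshielded_subsequence[OF p(1), of 0 "length p - 1"]) (use ne in auto)
  obtain D where D: "D \<in> DAG_class G" "n > 0 \<Longrightarrow> (p ! f 0, p ! f (Suc 0)) \<in> dir D"
  proof (cases "n > 0 \<and> (p ! f 0, p ! f (Suc 0)) \<in> und G")
    case True
    then show ?thesis using orient that by blast
  next
    case False
    obtain D where "D \<in> DAG_class G" using class_nonempty by blast
    then show ?thesis using that f(3)[of 0] f(4)[of 0] False dir_sub by (auto simp: adj_def)
  qed
  have "(p ! f k, p ! f (Suc k)) \<in> dir D" if "k < n" for k
    using that
  proof (induction k)
    case (Suc k)
    show ?case
    proof (rule ccontr)
      assume "\<not> ?case"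
      then have "(p ! f (Suc (Suc k)), p ! f (Suc k)) \<in> dir D"
        using f(3)[of "Suc k"] Suc.prems adj_iff_dir[OF D(1)] by blast
      from v_structure_G(2)[OF D(1) Suc.IH this] f(4)[of "Suc k"] f(5)[of k] Suc.prems
      show False by (auto simp: nonadj_def)
    qed
  qed (use D in auto)
  then have "(p ! f 0, p ! f n) \<in> (dir D)\<^sup>*"
    using seq_rtrancl[of 0 n "\<lambda>k. p ! f k" "dir D"] by auto
  then show "\<exists>D\<in>DAG_class G. \<exists>s\<in>S. s \<in> nodes G \<and> (s, w) \<in> (dir D)\<^sup>*"
    using D(1) p ne f(1,2) by (auto simp: hd_conv_nth last_conv_nth)
next
  assume "\<exists>D\<in>DAG_class G. \<exists>s\<in>S. s \<in> nodes G \<and> (s, w) \<in> (dir D)\<^sup>*"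
  then obtain D s where D: "D \<in> DAG_class G" "s \<in> S" "s \<in> nodes G" "(s, w) \<in> (dir D)\<^sup>*" by blast
  then have "w \<in> de D {s}" using de_iff[OF PDAG_D[OF D(1)]] nodes_D[OF D(1)] by auto
  then obtain p where "causal_path D p" "hd p = s" "last p = w" by (auto simp: de_def)
  then have "poss_causal_path G p \<and> hd p \<in> S \<and> last p = w"
    using causal_in_class_poss_causal[OF D(1)] D(2) by simp
  then show "w \<in> possde G S" unfolding possde_def by (intro CollectI exI)
qed

lemma possdeI:
  "D \<in> DAG_class G \<Longrightarrow> s \<in> S \<Longrightarrow> s \<in> nodes G \<Longrightarrow> (s, w) \<in> (dir D)\<^sup>* \<Longrightarrow> w \<in> possde G S"
  using possde_iff by blast

end


section \<open>Sources and causal nodes under a valid adjustment set\<close>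

locale adjustable = max_pdag G for G :: "'v pgraph" +
  fixes X Y Z :: "'v set"
  assumes X_nodes: "X \<subseteq> nodes G" and Y_nodes: "Y \<subseteq> nodes G" and XY: "X \<inter> Y = {}"
    and Y_possde: "Y \<subseteq> possde G X"
    and valid: "valid_adjustment_set X Y G Z"
begin

text \<open>Directed paths whose nodes after the first lie outside \<open>X\<close>, that is, proper causal paths, are
  chains of this relation.\<close>

abbreviation avoid :: "'v pgraph \<Rightarrow> ('v \<times> 'v) set" where
  "avoid H \<equiv> dir H \<inter> UNIV \<times> - X"

text \<open>The part of the forbidden set that is not put there by \<open>X\<close> itself.\<close>

abbreviation F :: "'v set" where
  "F \<equiv> possde G (posscn X Y G)"

lemma Z_facts: "Z \<subseteq> nodes G" "Z \<inter> X = {}" "Z \<inter> Y = {}" "Z \<inter> F = {}"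
  using valid by (auto simp: valid_adjustment_set_def forb_def)

lemma blocked_Z:
  "proper_path G X Y p \<Longrightarrow> noncausal_path G p \<Longrightarrow> definite_status G p \<Longrightarrow> blocked G Z p"
  using valid by (auto simp: valid_adjustment_set_def)

lemma amenable_cons:
  assumes "poss_causal_path G (x # d # r)" "x \<in> X" "last (d # r) \<in> Y" "set (d # r) \<inter> X = {}"
  shows "(x, d) \<in> dir G"
proof -
  have "proper_path G X Y (x # d # r)"
    using assms by (auto simp: proper_path_def path_from_to_def poss_causal_path_def)
  then show ?thesis
    using valid assms(1) unfolding valid_adjustment_set_def amenable_def by fastforce
qed

lemma proper_pathD:
  assumes "proper_path G X Y p"
  shows "gpath G p" "p \<noteq> []" "p ! 0 \<in> X" "last p \<in> Y" "p ! (length p - 1) \<in> Y"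
    "1 \<le> j \<Longrightarrow> j < length p \<Longrightarrow> p ! j \<notin> X"
proof -
  show *: "gpath G p" "p \<noteq> []" "p ! 0 \<in> X" "last p \<in> Y" "p ! (length p - 1) \<in> Y"
    using assms by (auto simp: proper_path_def path_from_to_def gpath_def hd_conv_nth last_conv_nth)
  show "p ! j \<notin> X" if j: "1 \<le> j" "j < length p"
  proof -
    have "tl p ! (j - 1) = p ! j" "j - 1 < length (tl p)" using j by (auto simp: nth_tl)
    then have "p ! j \<in> set (tl p)" by (metis nth_mem)
    then show ?thesis using assms by (auto simp: proper_path_def)
  qed
qed

lemma poss_causal_drop:
  assumes "poss_causal_path G p" "j < length p"
  shows "poss_causal_path G (drop j p)"
  using assms unfolding poss_causal_path_def gpath_def
  by (auto dest: in_set_dropD)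

text \<open>The source followed by the rest of the path from its neighbour onwards is itself a possibly causal
  path to the targets, so amenability applies to its first edge.\<close>

lemma source_edge:
  assumes p: "proper_path G X Y p" "poss_causal_path G p" and j: "1 \<le> j" "j < length p"
    and a: "adj G (p ! 0) (p ! j)"
  shows "(p ! 0, p ! j) \<in> dir G"
proof -
  note P = proper_pathD[OF p(1)]
  have d: "drop j p = p ! j # drop (Suc j) p" using j by (simp add: Cons_nth_drop_Suc)
  have later: "\<exists>k. 1 \<le> k \<and> k < length p \<and> v = p ! k" if "v \<in> set (drop j p)" for v
  proof -
    from that obtain i where "i < length (drop j p)" "v = drop j p ! i"
      by (metis in_set_conv_nth)
    then show ?thesis using j by (intro exI[of _ "j + i"]) auto
  qed
  have pc: "poss_causal_path G (drop j p)" using poss_causal_drop p(2) j by blast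
  have 1: "p ! 0 \<notin> set (drop j p)" using later P(3,6) by metis
  have 2: "(v, p ! 0) \<notin> dir G" if "v \<in> set (drop j p)" for v
    using later[OF that] p(2) by (auto simp: poss_causal_path_def)
  have "poss_causal_path G (p ! 0 # drop j p)"
    using pc 1 2 a P(3) X_nodes
    unfolding poss_causal_sorted_wrt gpath_successively d by auto
  then have "poss_causal_path G (p ! 0 # p ! j # drop (Suc j) p)" unfolding d .
  moreover have "last (drop j p) \<in> Y" using P(4) j by simp
  moreover have "set (drop j p) \<inter> X = {}" using later P(6) by blast
  ultimately show ?thesis using amenable_cons P(3) unfolding d by blast
qed

text \<open>Amenability directs the first edge of a shortest possibly causal path out of a source, and
  then rule (a) directs all of it.\<close>

lemma source_reach:
  assumes p: "proper_path G X Y p" "poss_causal_path G p" and i: "1 \<le> i" "i < length p"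
  shows "(p ! 0, p ! i) \<in> (avoid G)\<^sup>+"
proof -
  note P = proper_pathD[OF p(1)]
  obtain n f where f: "f 0 = 0" "f n = i" "\<And>k. k \<le> n \<Longrightarrow> 0 \<le> f k \<and> f k \<le> i"
    "\<And>k. k < n \<Longrightarrow> adj G (p ! f k) (p ! f (Suc k))"
    "\<And>k. k < n \<Longrightarrow> (p ! f (Suc k), p ! f k) \<notin> dir G"
    "\<And>k. Suc k < n \<Longrightarrow> nonadj G (p ! f k) (p ! f (Suc (Suc k)))"
    "\<And>k. k < n \<Longrightarrow> f k < f (Suc k)"
    by (rule unshielded_subsequence[OF p(2), of 0 i]) (use i in auto)
  have n: "0 < n" using f(1,2) i by (cases n) auto
  have step: "(p ! f k, p ! f (Suc k)) \<in> dir G" if "k < n" for k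
    using that
  proof (induction k)
    case 0
    then show ?case
      using source_edge[OF p, of "f (Suc 0)"] f(1) f(3)[of "Suc 0"] f(4)[of 0] f(7)[of 0] i by auto
  next
    case (Suc k)
    then have "(p ! f k, p ! f (Suc k)) \<in> dir G" by simp
    from rule_a[OF this, of "p ! f (Suc (Suc k))"] show ?case
      using f(4)[of "Suc k"] f(5)[of "Suc k"] f(6)[of k] Suc.prems by (auto simp: nonadj_def adj_def)
  qed
  have "p ! f (Suc k) \<notin> X" if "k < n" for k
    using P(6)[of "f (Suc k)"] f(3)[of "Suc k"] f(7)[of k] that i by auto
  then have "(p ! f 0, p ! f n) \<in> (avoid G)\<^sup>+"
    using seq_trancl[of 0 n "\<lambda>k. p ! f k" "avoid G"] n step by auto
  then show ?thesis using f by simp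
qed

lemma posscnE:
  assumes "a \<in> posscn X Y G"
  obtains p i where "proper_path G X Y p" "poss_causal_path G p" "1 \<le> i" "i < length p" "a = p ! i"
proof -
  from assms obtain p where p: "proper_path G X Y p" "poss_causal_path G p" "a \<in> set p" "a \<notin> X"
    by (auto simp: posscn_def)
  then obtain i where i: "i < length p" "a = p ! i" by (auto simp: in_set_conv_nth)
  have "i \<noteq> 0" using i p(4) proper_pathD(3)[OF p(1)] by metis
  then show ?thesis using that p i by (metis less_one linorder_not_less)
qed

lemma posscn_notin_X: "a \<in> posscn X Y G \<Longrightarrow> a \<notin> X"
  by (auto simp: posscn_def)

lemma posscn_nodes: "a \<in> posscn X Y G \<Longrightarrow> a \<in> nodes G"
  by (auto simp: posscn_def proper_path_def path_from_to_def gpath_def)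

lemma Y_posscn: "Y \<subseteq> posscn X Y G"
proof
  fix y assume y: "y \<in> Y"
  then obtain p where p: "poss_causal_path G p" "hd p \<in> X" "last p = y"
    using Y_possde by (auto simp: possde_def)
  have ne: "p \<noteq> []" using p by (auto simp: poss_causal_path_def gpath_def)
  have "gpath G p" using p by (simp add: poss_causal_path_def)
  then obtain ys x zs where q: "p = ys @ x # zs" "x \<in> X" "set zs \<inter> X = {}"
    using p(2) by (rule proper_path_last_source)
  have "x # zs = drop (length ys) p" using q by simp
  then have pc: "poss_causal_path G (x # zs)"
    using poss_causal_drop[OF p(1), of "length ys"] q by simp
  have l: "last (x # zs) = y" using p(3) q by simp
  have "y \<noteq> x" using y q XY by blast
  then have "y \<in> set (x # zs)" using l last_in_set[of "x # zs"] by blast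
  moreover have "proper_path G X Y (x # zs)"
    using pc q l y unfolding proper_path_def path_from_to_def poss_causal_path_def by simp
  moreover have "y \<notin> X" using y XY by blast
  ultimately show "y \<in> posscn X Y G" using pc unfolding posscn_def by blast
qed

lemmas cn_G_iff = cn_iff[OF PDAG_G X_nodes]

lemma avoid_mono:
  assumes "D \<in> DAG_class G"
  shows "(u, v) \<in> (avoid G)\<^sup>+ \<Longrightarrow> (u, v) \<in> (avoid D)\<^sup>+" "(u, v) \<in> (avoid G)\<^sup>* \<Longrightarrow> (u, v) \<in> (avoid D)\<^sup>*"
proof -
  have "avoid G \<subseteq> avoid D" using dir_subset[OF assms] by blast
  then show "(u, v) \<in> (avoid G)\<^sup>+ \<Longrightarrow> (u, v) \<in> (avoid D)\<^sup>+" "(u, v) \<in> (avoid G)\<^sup>* \<Longrightarrow> (u, v) \<in> (avoid D)\<^sup>*"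
    using trancl_mono rtrancl_mono by blast+
qed

lemma cn_D_iff:
  assumes "D \<in> DAG_class G"
  shows "c \<in> cn X Y D \<longleftrightarrow>
    (\<exists>x\<in>X. \<exists>y\<in>Y. (x, c) \<in> (avoid D)\<^sup>+ \<and> (c, y) \<in> (avoid D)\<^sup>*)"
  using cn_iff[OF PDAG_D[OF assms]] X_nodes nodes_D[OF assms] by auto

lemma cn_mono: "D \<in> DAG_class G \<Longrightarrow> cn X Y G \<subseteq> cn X Y D"
  unfolding cn_G_iff cn_D_iff subset_iff using avoid_mono by blast

lemma cn_D_posscn: "D \<in> DAG_class G \<Longrightarrow> cn X Y D \<subseteq> posscn X Y G"
proof
  fix c assume D: "D \<in> DAG_class G" and "c \<in> cn X Y D"
  then obtain p where p: "proper_path D X Y p" "causal_path D p" "c \<in> set p" "c \<notin> X"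
    by (auto simp: cn_def)
  have pc: "poss_causal_path G p" using causal_in_class_poss_causal D p by blast
  then have "proper_path G X Y p"
    using p(1) by (auto simp: proper_path_def path_from_to_def poss_causal_path_def)
  then show "c \<in> posscn X Y G" using pc p unfolding posscn_def by blast
qed

lemma cn_posscn: "cn X Y G \<subseteq> posscn X Y G"
  using cn_mono cn_D_posscn class_nonempty by blast

lemma posscn_reach: "a \<in> posscn X Y G \<Longrightarrow> \<exists>x\<in>X. (x, a) \<in> (avoid G)\<^sup>+"
  by (metis posscnE source_reach proper_pathD(3))

lemma Y_cn: "Y \<subseteq> cn X Y G"
  unfolding cn_G_iff subset_iff using posscn_reach Y_posscn by blast

text \<open>An unshielded possibly causal path has no collider in a represented DAG, so there it is a
  fork: some node on it is an ancestor of both its ends.\<close>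

lemma posscn_below_cn:
  assumes D: "D \<in> DAG_class G" and a: "a \<in> posscn X Y G"
  shows "\<exists>u\<in>cn X Y D. (u, a) \<in> (dir D)\<^sup>*"
proof -
  from a obtain p i where p: "proper_path G X Y p" "poss_causal_path G p"
    and i: "1 \<le> i" "i < length p" "a = p ! i" by (rule posscnE)
  note P = proper_pathD[OF p(1)]
  obtain n f where f: "f 0 = i" "f n = length p - 1" "\<And>k. k \<le> n \<Longrightarrow> i \<le> f k \<and> f k \<le> length p - 1"
    "\<And>k. k < n \<Longrightarrow> adj G (p ! f k) (p ! f (Suc k))"
    "\<And>k. k < n \<Longrightarrow> (p ! f (Suc k), p ! f k) \<notin> dir G"
    "\<And>k. Suc k < n \<Longrightarrow> nonadj G (p ! f k) (p ! f (Suc (Suc k)))"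
    by (rule unshielded_subsequence[OF p(2), of i "length p - 1"]) (use i in auto)
  have nX: "p ! f k \<notin> X" if "k \<le> n" for k
    using f(3)[OF that] i by (intro P(6)) auto
  have "\<exists>j\<le>k. (p ! f j, p ! f 0) \<in> (dir D)\<^sup>* \<and> (p ! f j, p ! f k) \<in> (avoid D)\<^sup>* \<and>
      (j = k \<or> (p ! f (k - 1), p ! f k) \<in> dir D)" if "k \<le> n" for k
    using that
  proof (induction k)
    case (Suc k)
    then obtain j where j: "j \<le> k" "(p ! f j, p ! f 0) \<in> (dir D)\<^sup>*" "(p ! f j, p ! f k) \<in> (avoid D)\<^sup>*"
      "j = k \<or> (p ! f (k - 1), p ! f k) \<in> dir D" by auto
    consider "(p ! f k, p ! f (Suc k)) \<in> dir D" | "(p ! f (Suc k), p ! f k) \<in> dir D"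
      using f(4)[of k] Suc.prems adj_iff_dir[OF D] by auto
    then show ?case
    proof cases
      case 1
      then have "(p ! f j, p ! f (Suc k)) \<in> (avoid D)\<^sup>*"
        using j(3) nX[of "Suc k"] Suc.prems by (auto intro: rtrancl_into_rtrancl)
      then show ?thesis using j 1 by (intro exI[of _ j]) auto
    next
      case 2
      show ?thesis
      proof (cases "j = k")
        case True
        then show ?thesis using j 2 by (intro exI[of _ "Suc k"]) (auto intro: converse_rtrancl_into_rtrancl)
      next
        case False
        then have k: "k > 0" "(p ! f (k - 1), p ! f k) \<in> dir D" using j by auto
        have "nonadj G (p ! f (k - 1)) (p ! f (Suc k))" using f(6)[of "k - 1"] k Suc.prems by auto
        then have "(p ! f (Suc k), p ! f k) \<in> dir G"
          using v_structure_G(2)[OF D k(2) 2] by (auto simp: nonadj_def)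
        then show ?thesis using f(5)[of k] Suc.prems by auto
      qed
    qed
  qed auto
  from this[of n] obtain j where j: "j \<le> n" "(p ! f j, a) \<in> (dir D)\<^sup>*" "(p ! f j, p ! f n) \<in> (avoid D)\<^sup>*"
    using f(1) i(3) by auto
  have "(p ! 0, p ! f j) \<in> (avoid D)\<^sup>+"
    using source_reach[OF p, of "f j"] f(3)[OF j(1)] i avoid_mono(1)[OF D] by auto
  then have "p ! f j \<in> cn X Y D"
    unfolding cn_D_iff[OF D] using P(3,5) j(3) f(2) by auto
  then show ?thesis using j(2) by blast
qed

text \<open>Possible descent from possibly causal nodes is actual descent from causal nodes, but in a
  represented DAG that may depend on the node.\<close>

lemma F_iff: "w \<in> F \<longleftrightarrow> (\<exists>D\<in>DAG_class G. \<exists>u\<in>cn X Y D. (u, w) \<in> (dir D)\<^sup>*)"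
proof
  assume "w \<in> F"
  then obtain D a where D: "D \<in> DAG_class G" "a \<in> posscn X Y G" "(a, w) \<in> (dir D)\<^sup>*"
    unfolding possde_iff by blast
  then show "\<exists>D\<in>DAG_class G. \<exists>u\<in>cn X Y D. (u, w) \<in> (dir D)\<^sup>*"
    using posscn_below_cn[OF D(1,2)] rtrancl_trans by metis
next
  assume "\<exists>D\<in>DAG_class G. \<exists>u\<in>cn X Y D. (u, w) \<in> (dir D)\<^sup>*"
  then show "w \<in> F" unfolding possde_iff using cn_D_posscn posscn_nodes by blast
qed

lemma posscn_F: "posscn X Y G \<subseteq> F"
  unfolding possde_iff subset_iff using class_nonempty posscn_nodes by blast

lemma F_nodes: "F \<subseteq> nodes G"
proof
  fix w assume "w \<in> F"
  then obtain p where "gpath G p" "last p = w" by (auto simp: possde_def poss_causal_path_def)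
  then show "w \<in> nodes G" using last_in_set[of p] by (auto simp: gpath_def)
qed

lemma descendants_F:
  "D \<in> DAG_class G \<Longrightarrow> a \<in> posscn X Y G \<Longrightarrow> (a, w) \<in> (dir D)\<^sup>* \<Longrightarrow> w \<in> F"
  using possdeI posscn_nodes by blast

lemma neighbour_F:
  assumes "a \<in> posscn X Y G" "(a, w) \<in> und G \<or> (w, a) \<in> und G" shows "w \<in> F"
  using assms orient SG(8) descendants_F by (meson r_into_rtrancl)

text \<open>If some causal node had a descendant in the sources, a closest one together with
  a causal path to the targets would form a non-causal path without colliders whose nodes are all
  forbidden, so no valid adjustment set could block it. Minimality of the two branches makes
  the path unshielded and therefore of definite status.\<close>

lemma no_source_below_cn:
  assumes D: "D \<in> DAG_class G"
  shows "X \<inter> (dir D)\<^sup>* `` cn X Y D = {}"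
proof (rule ccontr)
  assume "\<not> ?thesis"
  then obtain c0 x0 where c0: "c0 \<in> cn X Y D" "x0 \<in> X" "(c0, x0) \<in> (dir D)\<^sup>*" by blast
  \<comment> \<open>The branch towards the sources meets them only at its end, hence steps start outside \<open>X\<close>.\<close>
  define B where "B = dir D \<inter> (- X) \<times> UNIV"
  define T where "T s \<longleftrightarrow> (\<exists>c n m x y. s = n + m \<and> c \<in> cn X Y D \<and> x \<in> X \<and> y \<in> Y \<and>
      (c, x) \<in> B ^^ n \<and> (c, y) \<in> avoid D ^^ m)" for s :: nat
  have "\<exists>x\<in>X. (c, x) \<in> B\<^sup>*" if "(c, x0) \<in> (dir D)\<^sup>*" for c
    using that
  proof (induction rule: converse_rtrancl_induct)
    case base then show ?case using c0 by blast
  next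
    case (step u v)
    then obtain x where x: "x \<in> X" "(v, x) \<in> B\<^sup>*" by blast
    show ?case
    proof (cases "u \<in> X")
      case False
      then have "(u, v) \<in> B" using step by (auto simp: B_def)
      then show ?thesis using x by (meson converse_rtrancl_into_rtrancl)
    qed blast
  qed
  then obtain x1 n1 where "x1 \<in> X" "(c0, x1) \<in> B ^^ n1"
    using c0 by (metis rtrancl_imp_relpow)
  moreover obtain y1 m1 where "y1 \<in> Y" "(c0, y1) \<in> avoid D ^^ m1"
    using c0(1) unfolding cn_D_iff[OF D] by (metis rtrancl_imp_relpow)
  ultimately have "T (n1 + m1)" using c0(1) unfolding T_def by blast
  then obtain s where s: "T s" "\<And>s'. T s' \<Longrightarrow> s \<le> s'"
    by (meson LeastI Least_le)
  then obtain c n m x y where c: "c \<in> cn X Y D" "x \<in> X" "y \<in> Y" and sn: "s = n + m"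
    and cx: "(c, x) \<in> B ^^ n" and cy: "(c, y) \<in> avoid D ^^ m"
    unfolding T_def by auto
  have least: "n + m \<le> n' + m'" if "c' \<in> cn X Y D" "x' \<in> X" "y' \<in> Y"
    "(c', x') \<in> B ^^ n'" "(c', y') \<in> avoid D ^^ m'" for c' n' m' x' y'
    using s(2)[of "n' + m'"] that unfolding T_def sn by blast
  obtain f where f: "f 0 = c" "f n = x" "\<And>i. i < n \<Longrightarrow> (f i, f (Suc i)) \<in> B"
    using relpow_sequence[OF cx] by blast
  obtain g where g: "g 0 = c" "g m = y" "\<And>i. i < m \<Longrightarrow> (g i, g (Suc i)) \<in> avoid D"
    using relpow_sequence[OF cy] by blast
  have cX: "c \<notin> X" using c(1) by (auto simp: cn_def)
  have n: "0 < n" using f cX c(2) by (cases n) auto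
  have fD: "(f i, f (Suc i)) \<in> dir D" if "i < n" for i using f(3)[OF that] by (auto simp: B_def)
  have gD: "(g i, g (Suc i)) \<in> dir D" if "i < m" for i using g(3)[OF that] by auto
  have fX: "f i \<notin> X" if "i < n" for i using f(3)[OF that] by (auto simp: B_def)
  have gX: "g j \<notin> X" if "j \<le> m" for j using g(3)[of "j - 1"] that g(1) cX by (cases j) auto
  have fx: "(f i, x) \<in> B ^^ (n - i)" if "i \<le> n" for i
    using seq_relpow[of i "n - i" f B] f that by auto
  have gy: "(g j, y) \<in> avoid D ^^ (m - j)" if "j \<le> m" for j
    using seq_relpow[of j "m - j" g "avoid D"] g that by auto
  obtain x2 where x2: "x2 \<in> X" "(x2, c) \<in> (avoid D)\<^sup>+" using c(1) unfolding cn_D_iff[OF D] by blast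
  have cg: "(c, g j) \<in> (avoid D)\<^sup>*" if "j \<le> m" for j
    using seq_rtrancl[of 0 j g "avoid D"] g that by auto
  have g_cn: "g j \<in> cn X Y D" if "j \<le> m" for j
    unfolding cn_D_iff[OF D] using x2 cg[OF that] gy[OF that] c(3)
    by (meson trancl_rtrancl_trancl relpow_imp_rtrancl)
  have f_ind: "(f i, f j) \<notin> dir D" if ij: "Suc i < j" "j \<le> n" for i j
  proof
    assume "(f i, f j) \<in> dir D"
    then have "(f i, f j) \<in> B" using fX[of i] ij by (auto simp: B_def)
    from relpow_shortcut[OF f(3) ij this] have "(c, x) \<in> B ^^ (Suc i + (n - j))" using f by simp
    from least[OF c this cy] ij show False by simp
  qed
  have g_ind: "(g i, g j) \<notin> dir D" if ij: "Suc i < j" "j \<le> m" for i j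
  proof
    assume "(g i, g j) \<in> dir D"
    then have "(g i, g j) \<in> avoid D" using gX[of j] ij by auto
    from relpow_shortcut[OF g(3) ij this] have "(c, y) \<in> avoid D ^^ (Suc i + (m - j))" using g by simp
    from least[OF c cx this] ij show False by simp
  qed
  have f_less: "f i \<noteq> f j" if "i < j" "j \<le> n" for i j
    using acyclic_seq_neq[of "dir D" n f i j] acyclic_D[OF D] fD that by blast
  have g_less: "g i \<noteq> g j" if "i < j" "j \<le> m" for i j
    using acyclic_seq_neq[of "dir D" m g i j] acyclic_D[OF D] gD that by blast
  have cross: "f i \<noteq> g j" if "0 < i" "i \<le> n" "0 < j" "j \<le> m" for i j
  proof
    assume e: "f i = g j"
    have "(g j, x) \<in> B ^^ (n - i)" using fx[of i] e that by simp
    from least[OF g_cn[of j] c(2,3) this gy[of j]] that show False by auto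
  qed
  \<comment> \<open>At the top of the fork the two neighbours may be adjacent. Minimality leaves only the case that
    the source is the child of \<open>c\<close>; then amenability makes the edge from \<open>c\<close> to it directed.\<close>
  have fork: "(c, f 1) \<in> dir G \<or> nonadj G (f 1) (g 1)" if m: "0 < m"
  proof -
    have c_f1: "(c, f 1) \<in> dir D" using fD[of 0] f(1) n by simp
    have c_g1: "(c, g 1) \<in> dir D" using gD[of 0] g(1) m by simp
    have 1: "(g 1, f 1) \<notin> dir D"
    proof
      assume "(g 1, f 1) \<in> dir D"
      then have "(g 1, f 1) \<in> B" using gX[of 1] m by (auto simp: B_def)
      then have "(g 1, x) \<in> B ^^ n" using relpow_Suc_I2[OF _ fx[of 1]] n by simp
      from least[OF g_cn[of 1] c(2,3) this gy[of 1]] m show False by auto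
    qed
    have 2: "(f 1, g 1) \<notin> dir D" if n2: "n \<noteq> 1"
    proof
      assume a: "(f 1, g 1) \<in> dir D"
      have f1: "f 1 \<notin> X" using fX[of 1] n n2 by simp
      have a': "(f 1, g 1) \<in> avoid D" using a gX[of 1] m by auto
      then have y: "(f 1, y) \<in> avoid D ^^ m"
        using relpow_Suc_I2[OF _ gy[of 1]] m by simp
      have "(x2, f 1) \<in> (avoid D)\<^sup>+" using x2 c_f1 f1 by (auto intro: trancl_into_trancl)
      then have "f 1 \<in> cn X Y D"
        unfolding cn_D_iff[OF D] using x2(1) c(3) relpow_imp_rtrancl[OF y] by blast
      from least[OF this c(2,3) fx[of 1] y] n show False by auto
    qed
    have 3: "(c, f 1) \<in> dir G" if a: "(f 1, g 1) \<in> dir D" and n1: "n = 1"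
    proof (rule ccontr)
      assume "(c, f 1) \<notin> dir G"
      then have u: "(c, x) \<in> und G" using dir_D_cases[OF D c_f1] f(2) n1 by auto
      let ?q = "map g [0..<Suc m]"
      have q: "poss_causal_path G ?q"
        by (rule causal_in_class_poss_causal[OF D], rule causal_path_of_sequence[OF PDAG_D[OF D]])
           (use g(1) SD(2)[OF D c_g1] gD in auto)
      have q_cons: "?q = c # map g [1..<Suc m]"
        using g(1) by (simp add: upt_conv_Cons del: upt_Suc)
      have 1: "x \<notin> set ?q" using gX c(2) by (auto simp del: upt_Suc)
      have no_back: "(v, x) \<notin> dir G" if v: "v \<in> set ?q" for v
      proof
        assume vx: "(v, x) \<in> dir G"
        obtain j where j: "v = g j" "j \<le> m" using v by (auto simp del: upt_Suc)
        show False
        proof (cases j)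
          case 0
          then show False using vx u j g(1) SG(10) by auto
        next
          case (Suc i)
          have "(g 1, g j) \<in> (dir D)\<^sup>*" using seq_rtrancl[of 1 j g "dir D"] gD j Suc by auto
          then have "(x, g j) \<in> (dir D)\<^sup>+" using a n1 f(2) by (auto intro: rtrancl_into_trancl2)
          then show False using no_cycle[OF D] vx j dir_sub[OF D] by blast
        qed
      qed
      have "poss_causal_path G (x # ?q)"
        using q 1 no_back u SG(8)[OF u] SG(5)[OF u]
        unfolding poss_causal_sorted_wrt gpath_successively q_cons
        by (auto simp: adj_def)
      then have "poss_causal_path G (x # c # map g [1..<Suc m])" unfolding q_cons .
      moreover have "last ?q \<in> Y" unfolding map_upt_ends using g(2) c(3) by simp
      moreover have "set ?q \<inter> X = {}" using gX by (auto simp del: upt_Suc)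
      ultimately have "(x, c) \<in> dir G" using amenable_cons c(2) unfolding q_cons by blast
      then show False using SG(11) u by blast
    qed
    show ?thesis
    proof (cases "adj G (f 1) (g 1)")
      case True
      then have "(f 1, g 1) \<in> dir D" using 1 adj_iff_dir[OF D] by blast
      then show ?thesis using 2 3 by blast
    next
      case False
      then show ?thesis using cross[of 1 1] n m by (auto simp: nonadj_def)
    qed
  qed
  \<comment> \<open>The path runs from the source up the first branch to \<open>c\<close>, at position \<open>n\<close>, and down the second.\<close>
  define h where "h k = (if k \<le> n then f (n - k) else g (k - n))" for k
  define p where "p = map h [0..<Suc (n + m)]"
  have len: "length p = Suc (n + m)" by (simp add: p_def)
  have nth: "p ! k = h k" if "k \<le> n + m" for k using that by (simp add: p_def del: upt_Suc)
  have E1: "(h (Suc k), h k) \<in> dir D" if "k < n" for k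
    using fD[of "n - Suc k"] that by (simp add: h_def Suc_diff_Suc)
  have E2: "(h k, h (Suc k)) \<in> dir D" if "n \<le> k" "k < n + m" for k
  proof (cases "k = n")
    case True then show ?thesis using gD[of 0] that f(1) g(1) by (simp add: h_def)
  next
    case False
    then show ?thesis using gD[of "k - n"] that by (simp add: h_def Suc_diff_le)
  qed
  have E1': "(h k, h (k - 1)) \<in> dir D" if "0 < k" "k \<le> n" for k
    using E1[of "k - 1"] that by (cases k) auto
  have E2': "(h (k - 1), h k) \<in> dir D" if "n < k" "k \<le> n + m" for k
    using E2[of "k - 1"] that by (cases k) auto
  have h_adj: "adj G (h k) (h (Suc k))" if "k < n + m" for k
    using E1[of k] E2[of k] that adj_iff_dir[OF D] by (cases "k < n") auto
  have h_neq: "h k \<noteq> h l" if kl: "k < l" "l \<le> n + m" for k l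
  proof -
    consider "l \<le> n" | "n \<le> k" | "k < n" "n < l" by linarith
    then show ?thesis
    proof cases
      case 1
      then have "n - l < n - k" using kl by linarith
      then show ?thesis using f_less[of "n - l" "n - k"] kl 1 by (auto simp: h_def)
    next
      case 2
      then have "h k = g (k - n)" using f(1) g(1) by (auto simp: h_def)
      then show ?thesis using g_less[of "k - n" "l - n"] kl 2 by (auto simp: h_def)
    next
      case 3 then show ?thesis using cross[of "n - k" "l - n"] kl by (auto simp: h_def)
    qed
  qed
  have h_reach: "(c, h k) \<in> (dir D)\<^sup>*" if "k \<le> n + m" for k
  proof (cases "k \<le> n")
    case True
    then show ?thesis using seq_rtrancl[of 0 "n - k" f "dir D"] fD f(1) by (auto simp: h_def)
  next
    case False
    then show ?thesis using seq_rtrancl[of 0 "k - n" g "dir D"] gD g(1) that by (auto simp: h_def)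
  qed
  have c_pcn: "c \<in> posscn X Y G" using cn_D_posscn[OF D] c(1) by blast
  have h_F: "h k \<in> F" if "k \<le> n + m" for k
    using descendants_F[OF D c_pcn h_reach[OF that]] .
  have "inj_on h {0..<Suc (n + m)}"
    by (rule linorder_inj_onI) (use h_neq in auto)
  moreover have "h k \<in> nodes G" if "k \<le> n + m" for k
    using h_F[OF that] F_nodes by blast
  ultimately have gp: "gpath G p"
    unfolding gpath_def using h_adj len nth
    by (auto simp: p_def distinct_map simp del: upt_Suc)
  have nonadj: "nonadj G (h (k - 1)) (h (Suc k))" if k: "0 < k" "k < n + m" "k \<noteq> n" for k
  proof -
    have "(h (k - 1), h (Suc k)) \<notin> dir D \<and> (h (Suc k), h (k - 1)) \<notin> dir D"
    proof (cases "k < n")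
      case True
      have "(h (Suc k), h (k - 1)) \<in> (dir D)\<^sup>+" using E1'[of k] E1[of k] k True by (meson less_imp_le_nat trancl.simps)
      then have "(h (k - 1), h (Suc k)) \<notin> dir D" using no_cycle[OF D] by blast
      moreover have "(h (Suc k), h (k - 1)) \<notin> dir D"
        using f_ind[of "n - Suc k" "n - (k - 1)"] k True by (auto simp: h_def)
      ultimately show ?thesis by blast
    next
      case False
      have "(h (k - 1), h (Suc k)) \<in> (dir D)\<^sup>+" using E2'[of k] E2[of k] k False by (meson trancl.simps not_less less_imp_le_nat le_neq_implies_less)
      then have "(h (Suc k), h (k - 1)) \<notin> dir D" using no_cycle[OF D] by blast
      moreover have "h (k - 1) = g (k - 1 - n)" using False k f(1) g(1) by (auto simp: h_def)
      then have "(h (k - 1), h (Suc k)) \<notin> dir D"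
        using g_ind[of "k - 1 - n" "Suc k - n"] k False by (auto simp: h_def)
      ultimately show ?thesis by blast
    qed
    then show ?thesis using h_neq[of "k - 1" "Suc k"] k adj_iff_dir[OF D] by (auto simp: nonadj_def)
  qed
  have nc: "noncollider G p k" if "inner_pos p k" for k
  proof -
    have k: "0 < k" "k < n + m" using that by (auto simp: inner_pos_def len)
    have hn: "p ! (k - 1) = h (k - 1)" "p ! k = h k" "p ! Suc k = h (Suc k)" using k nth by auto
    have out: "(h k, h (k - 1)) \<in> dir D \<or> (h k, h (Suc k)) \<in> dir D"
      using E1'[of k] E2[of k] k by (cases "k \<le> n") auto
    have adjs: "adj G (h (k - 1)) (h k)" "adj G (h k) (h (Suc k))"
      using h_adj[of "k - 1"] h_adj[of k] k by auto
    show ?thesis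
    proof (cases "k = n \<and> (c, f 1) \<in> dir G")
      case True
      then have "h k = c" "h (k - 1) = f 1" using f(1) k by (auto simp: h_def)
      then have "(p ! k, p ! (k - 1)) \<in> dir G" using True hn(1,2) by metis
      then show ?thesis using that unfolding noncollider_def by blast
    next
      case False
      have "nonadj G (h (k - 1)) (h (Suc k))"
      proof (cases "k = n")
        case True
        then have "h (k - 1) = f 1" "h (Suc k) = g 1" using k by (auto simp: h_def)
        then show ?thesis using fork False True k by auto
      qed (use nonadj k in auto)
      from noncollider_cases[OF D out adjs this] show ?thesis
        using that unfolding noncollider_def hn by blast
    qed
  qed
  have no_coll: "\<not> collider G p k" for k
  proof
    assume col: "collider G p k"
    then have k: "0 < k" "k < n + m" by (auto simp: collider_def inner_pos_def len)
    have "p ! (k - 1) = h (k - 1)" "p ! k = h k" "p ! Suc k = h (Suc k)" using k nth by auto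
    then have "(h (k - 1), h k) \<in> dir D" "(h (Suc k), h k) \<in> dir D"
      using col dir_sub[OF D] by (auto simp: collider_def)
    then show False using E1'[of k] E2[of k] k SD(9)[OF D] by (cases "k \<le> n") auto
  qed
  have ds: "definite_status G p" using gp nc by (auto simp: definite_status_def)
  have ends: "hd p = x" "last p = y"
    unfolding p_def map_upt_ends using f(1,2) g(1,2) by (auto simp: h_def)
  have tl: "set (tl p) \<inter> X = {}"
  proof -
    have "h k \<notin> X" if "1 \<le> k" "k \<le> n + m" for k
      using fX[of "n - k"] gX[of "k - n"] that n by (auto simp: h_def)
    then show ?thesis unfolding p_def map_upt_ends by auto
  qed
  have proper: "proper_path G X Y p"
    using gp ends c tl by (auto simp: proper_path_def path_from_to_def)
  have "\<not> poss_causal_path G p"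
  proof
    assume "poss_causal_path G p"
    then have "(p ! 0, p ! 1) \<in> dir G"
      using source_edge[OF proper, of 1] h_adj[of 0] n len nth[of 0] nth[of 1] by auto
    then have "(h 0, h 1) \<in> dir D" using nth[of 0] nth[of 1] n dir_sub[OF D] by auto
    then show False using E1[of 0] n SD(9)[OF D] by auto
  qed
  then have "noncausal_path G p" using gp by (simp add: noncausal_path_def)
  from blocked_Z[OF proper this ds] no_coll obtain k where "noncollider G p k" "p ! k \<in> Z"
    by (auto simp: blocked_def)
  then show False
    using h_F[of k] nth[of k] Z_facts(4) by (auto simp: noncollider_def inner_pos_def len)
qed

lemma X_F: "X \<inter> F = {}"
  using no_source_below_cn unfolding F_iff disjoint_iff by blast

end


context adjustable
begin

section \<open>Forbidden nodes are descendants of the sources\<close>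

text \<open>Undirected edges propagate backwards along a directed path: if its last node has an
  undirected neighbour, then every node of the path is adjacent to that neighbour, by rule (a).\<close>

lemma undirected_neighbour_back:
  assumes r: "\<And>i. i < m \<Longrightarrow> (r i, r (Suc i)) \<in> dir G" and t: "(r m, t) \<in> und G" and j: "j \<le> m"
  shows "(\<exists>k\<le>m. (r k, t) \<in> dir G) \<or> (r j, t) \<in> und G"
  using j
proof (induction j rule: inc_induct)
  case base then show ?case using t by simp
next
  case (step j)
  show ?case
  proof (cases "\<exists>k\<le>m. (r k, t) \<in> dir G")
    case False
    then have u: "(r (Suc j), t) \<in> und G" using step by blast
    have e: "(r j, r (Suc j)) \<in> dir G" using r step by simp
    have reach: "(r j, r m) \<in> (dir G)\<^sup>+" using step by (intro seq_trancl r) auto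
    have "r j \<noteq> t" using und_not_trancl(2)[OF t] reach by blast
    then have "adj G (r j) t" using rule_a[OF e u] by blast
    moreover have "(t, r j) \<notin> dir G"
      using und_not_trancl(2)[OF t] reach by (meson trancl_into_trancl2)
    ultimately show ?thesis using False step by (auto simp: adj_def)
  qed simp
qed

text \<open>Possible descent from possibly causal nodes becomes actual descent from a source. Otherwise an
  undirected edge would join a source \<open>x\<close> to some node on a possibly directed path that starts in
  a possibly causal node; rules (a), (b) and (d) let this path be run backwards and continued towards
  \<open>Y\<close>, giving a possibly causal path that starts with an undirected edge.\<close>

lemma forbidden_reach:
  assumes w: "w \<in> F"
  shows "\<exists>x\<in>X. (x, w) \<in> (avoid G)\<^sup>+"
proof -
  obtain D a where D: "D \<in> DAG_class G" "a \<in> posscn X Y G" "(a, w) \<in> (dir D)\<^sup>*"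
    using w unfolding possde_iff by blast
  obtain p ia where p: "proper_path G X Y p" "poss_causal_path G p"
    and ia: "1 \<le> ia" "ia < length p" "a = p ! ia" using posscnE[OF D(2)] .
  note P = proper_pathD[OF p(1)]
  define x where "x = p ! 0"
  have x: "x \<in> X" using P(3) by (simp add: x_def)
  have xa: "(x, a) \<in> (avoid G)\<^sup>+" using source_reach[OF p ia(1,2)] ia(3) by (simp add: x_def)
  have no_back: "(p ! j, x) \<notin> dir G" if "1 \<le> j" "j < length p" for j
    using p(2) that by (auto simp: poss_causal_path_def x_def)
  obtain n t where t: "t 0 = a" "t n = w" "\<And>i. i < n \<Longrightarrow> (t i, t (Suc i)) \<in> dir D"
    "\<And>i j. Suc i < j \<Longrightarrow> j \<le> n \<Longrightarrow> (t i, t j) \<notin> dir D"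
    using D(3) by (rule induced_sequence) blast
  have tF: "t i \<in> F" if "i \<le> n" for i
    using descendants_F[OF D(1,2)] seq_rtrancl[of 0 i t "dir D"] t(1,3) that by auto
  have tX: "t i \<notin> X" if "i \<le> n" for i using tF[OF that] X_F by blast
  have t_neq: "t i \<noteq> t j" if "i < j" "j \<le> n" for i j
    using acyclic_seq_neq[of "dir D" n t i j] acyclic_D[OF D(1)] t(3) that by blast
  have t_nonadj: "\<not> adj G (t i) (t j)" if "Suc i < j" "j \<le> n" for i j
  proof -
    have "(t i, t j) \<in> (dir D)\<^sup>+" using seq_trancl[of i j t "dir D"] t(3) that by auto
    then show ?thesis using t(4)[OF that] no_cycle[OF D(1)] adj_iff_dir[OF D(1)] by blast
  qed
  have "(x, t l) \<in> (avoid G)\<^sup>+" if "l \<le> n" for l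
    using that
  proof (induction l rule: less_induct)
    case (less l)
    show ?case
    proof (cases l)
      case 0 then show ?thesis using xa t(1) by simp
    next
      case (Suc k)
      have IH: "(x, t i) \<in> (avoid G)\<^sup>+" if "i < l" for i using less that by auto
      have kl: "(t k, t l) \<in> dir D" using t(3)[of k] Suc less.prems by auto
      have lX: "t l \<notin> X" using tX less.prems by blast
      show ?thesis
      proof (cases "(t k, t l) \<in> dir G")
        case True
        then show ?thesis using IH[of k] Suc lX by (auto intro: trancl_into_trancl)
      next
        case False
        then have u: "(t k, t l) \<in> und G" using kl dir_D_cases[OF D(1)] by blast
        have "(x, t k) \<in> (avoid G)\<^sup>*" using IH[of k] Suc by auto
        then obtain m r where r: "r 0 = x" "r m = t k" "\<And>i. i < m \<Longrightarrow> (r i, r (Suc i)) \<in> avoid G"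
          "\<And>i j. Suc i < j \<Longrightarrow> j \<le> m \<Longrightarrow> (r i, r j) \<notin> avoid G"
          by (rule induced_sequence) blast
        have rG: "(r i, r (Suc i)) \<in> dir G" if "i < m" for i using r(3)[OF that] by blast
        have u': "(r m, t l) \<in> und G" using u r(2) by simp
        show ?thesis
        proof (cases "\<exists>j\<le>m. (r j, t l) \<in> dir G")
          case True
          then obtain j where j: "j \<le> m" "(r j, t l) \<in> dir G" by blast
          have "(r 0, r j) \<in> (avoid G)\<^sup>*" using seq_rtrancl[of 0 j r "avoid G"] r(3) j by auto
          then show ?thesis using j(2) lX r(1) by (auto intro: rtrancl_into_trancl1)
        next
          case False
          then have all_und: "(r j, t l) \<in> und G" if "j \<le> m" for j
            using undirected_neighbour_back[OF rG u' that] by blast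
          then have xl: "(x, t l) \<in> und G" using r(1) by blast
          have "x \<noteq> t k" using x tX[of k] Suc less.prems by auto
          then have m: "m \<noteq> 0" using r(1,2) by (cases m) auto
          \<comment> \<open>All nodes of the chain from \<open>x\<close> have undirected edges to \<open>t l\<close>, so rule (d) leaves only one step.\<close>
          have m1: "m = 1"
          proof (rule ccontr)
            assume "m \<noteq> 1"
            then obtain q where q: "m = Suc (Suc q)" using m by (metis One_nat_def not0_implies_Suc)
            have e: "(r q, r (Suc q)) \<in> dir G" "(r (Suc q), r (Suc (Suc q))) \<in> dir G"
              using rG q by auto
            have "(r (Suc (Suc q)), r q) \<notin> dir G"
              using e acyclic_G unfolding acyclic_def by (meson trancl.simps)
            moreover have "r (Suc (Suc q)) \<notin> X" using r(3)[of "Suc q"] q by auto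
            then have "(r q, r (Suc (Suc q))) \<notin> dir G" using r(4)[of q "Suc (Suc q)"] q by auto
            moreover have "(r q, r (Suc (Suc q))) \<notin> und G" using rule_b e by blast
            moreover have "r q \<noteq> r (Suc (Suc q))" using e SG(9) by metis
            ultimately have "nonadj G (r q) (r (Suc (Suc q)))" by (auto simp: nonadj_def adj_def)
            moreover have "(t l, r q) \<in> und G" "(t l, r (Suc q)) \<in> und G" "(t l, r (Suc (Suc q))) \<in> und G"
              using all_und SG(8) q by auto
            ultimately show False using rule_d e by blast
          qed
          have xk: "(x, t k) \<in> dir G" using rG[of 0] r(1,2) m1 by simp
          have t_und: "(t i, t (Suc i)) \<in> und G" if "i \<le> k" for i
            using that
          proof (induction i rule: inc_induct)
            case base then show ?case using u Suc by simp
          next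
            case (step i)
            have "(t i, t (Suc i)) \<in> dir D" using t(3) step Suc less.prems by auto
            moreover have "(t i, t (Suc i)) \<notin> dir G"
              using rule_a[of "t i" "t (Suc i)" "t (Suc (Suc i))"] step
                t_nonadj[of i "Suc (Suc i)"] t_neq[of i "Suc (Suc i)"] Suc less.prems by auto
            ultimately show ?case using dir_D_cases[OF D(1)] by blast
          qed
          \<comment> \<open>Consequently \<open>x\<close> points to every earlier node of the path.\<close>
          have xt: "(x, t i) \<in> dir G" if "i \<le> k" for i
            using that
          proof (induction i rule: inc_induct)
            case base then show ?case using xk by simp
          next
            case (step i)
            have ti: "t i \<notin> X" using tX step Suc less.prems by auto
            have "(t (Suc i), t i) \<in> und G" using t_und[of i] step SG(8) by auto
            then have "adj G x (t i)" using rule_a[OF step.IH] ti x by metis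
            moreover have tr: "(x, t i) \<in> (dir G)\<^sup>+"
              using IH[of i] step Suc trancl_mono[of _ "avoid G" "dir G"] by (meson Int_lower1 less_Suc_eq less_trans)
            moreover have "(t i, x) \<notin> dir G" using tr acyclic_G unfolding acyclic_def by (meson trancl_into_trancl)
            ultimately show ?case using und_not_trancl(1) by (auto simp: adj_def)
          qed
          \<comment> \<open>Walk back from \<open>t l\<close> until the path can be left for the possibly causal path \<open>p\<close>, as early as
            possible and joining \<open>p\<close> as late as possible. Maximality of \<open>i\<close> and \<open>j\<close> excludes backward edges.\<close>
          define R where "R i j \<longleftrightarrow> ia \<le> j \<and> j < length p \<and> (t i = p ! j \<or> adj G (t i) (p ! j))" for i j
          have R0: "\<exists>j. R 0 j" using ia t(1) by (auto simp: R_def)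
          define i where "i = (GREATEST i. i \<le> l \<and> (\<exists>j. R i j))"
          have i: "i \<le> l" "\<exists>j. R i j"
            using GreatestI_nat[of "\<lambda>i. i \<le> l \<and> (\<exists>j. R i j)" 0 l] R0 by (auto simp: i_def)
          have i_max: "\<not> R i' j" if "i < i'" "i' \<le> l" for i' j
            using Greatest_le_nat[of "\<lambda>i. i \<le> l \<and> (\<exists>j. R i j)" i' l] that by (auto simp: i_def)
          define j where "j = (GREATEST j. R i j)"
          have j: "R i j"
            unfolding j_def by (rule GreatestI_ex_nat[OF i(2), of "length p"]) (simp add: R_def)
          have j_max: "\<not> R i j'" if "j < j'" for j'
          proof
            assume "R i j'"
            moreover have "k' \<le> length p" if "R i k'" for k' using that by (simp add: R_def)
            ultimately have "j' \<le> j" unfolding j_def by (rule Greatest_le_nat)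
            then show False using that by simp
          qed
          have jb: "ia \<le> j" "j < length p" using j by (auto simp: R_def)
          have x_pj: "(x, p ! j') \<in> dir G" if "ia \<le> j'" "j' < length p" "adj G x (p ! j')" for j'
            using source_edge[OF p, of j'] that ia by (auto simp: x_def)
          have fwd: "(p ! j', t i) \<notin> dir G" if j': "ia \<le> j'" "j' < length p" for j'
          proof
            assume a: "(p ! j', t i) \<in> dir G"
            show False
            proof (cases "i = l")
              case True
              have "(t l, x) \<in> und G" using xl SG(8) by blast
              moreover have "p ! j' \<noteq> x" using P(6)[of j'] j' ia x by auto
              ultimately have "adj G (p ! j') x" using rule_a a True by blast
              then have "(x, p ! j') \<in> dir G" using x_pj j' adj_G_sym by blast
              then show False using rule_b a True xl by blast
            next
              case False
              then have "(t i, t (Suc i)) \<in> und G" using t_und i(1) Suc by auto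
              then have "R (Suc i) j'" using rule_a[OF a] j' adj_G_sym unfolding R_def by metis
              then show False using i_max[of "Suc i" j'] False i(1) by auto
            qed
          qed
          \<comment> \<open>If the two paths meet in a node, it must not be repeated.\<close>
          define s where "s = (if t i = p ! j then Suc j else j)"
          have s: "ia \<le> s" "s \<le> length p" using jb by (auto simp: s_def)
          define ts where "ts = map t (rev [i..<Suc l])"
          define q where "q = ts @ drop s p"
          have ts_cons: "ts = t l # map t (rev [i..<l])" using i(1) by (simp add: ts_def)
          have set_ts: "set ts = t ` {i..l}" by (auto simp: ts_def)
          have last_ts: "last ts = t i" using i(1) by (simp add: ts_def last_map last_rev del: upt_Suc)
          have in_drop: "\<exists>j'\<ge>s. j' < length p \<and> v = p ! j'" if "v \<in> set (drop s p)" for v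
          proof -
            from that obtain k where "k < length (drop s p)" "v = drop s p ! k" by (metis in_set_conv_nth)
            then show ?thesis using s by (intro exI[of _ "s + k"]) auto
          qed
          have d1: "distinct ts"
            unfolding ts_def distinct_map distinct_rev set_rev
            by (intro conjI distinct_upt linorder_inj_onI) (use t_neq less.prems in auto)
          have ts_p: "t i' \<noteq> p ! j' \<and> (p ! j', t i') \<notin> dir G"
            if a: "i \<le> i'" "i' \<le> l" "s \<le> j'" "j' < length p" for i' j'
          proof (cases "i' = i")
            case True
            have "t i \<noteq> p ! j'"
            proof
              assume e: "t i = p ! j'"
              then have "R i j'" using a s by (auto simp: R_def)
              then have "j' \<le> j" using j_max by (meson not_less)
              then have "j' = j" using a by (auto simp: s_def split: if_splits)
              then show False using e a by (auto simp: s_def)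
            qed
            then show ?thesis using True fwd[of j'] a s by auto
          next
            case False
            then have "\<not> R i' j'" using i_max a by auto
            then show ?thesis using a s adj_G_sym by (auto simp: R_def adj_def)
          qed
          have succ_ts: "successively (adj G) ts"
            unfolding ts_def successively_conv_nth
          proof (intro allI impI)
            fix k' assume k': "Suc k' < length (map t (rev [i..<Suc l]))"
            then have b: "k' < l - i" using i(1) by simp
            have e1: "map t (rev [i..<Suc l]) ! k' = t (l - k')"
              using b by (simp add: rev_nth del: upt_Suc)
            have e2: "map t (rev [i..<Suc l]) ! Suc k' = t (l - Suc k')"
              using b by (simp add: rev_nth del: upt_Suc)
            have "(t (l - Suc k'), t (Suc (l - Suc k'))) \<in> und G" using t_und b Suc by auto
            moreover have "Suc (l - Suc k') = l - k'" using b by simp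
            ultimately show "adj G (map t (rev [i..<Suc l]) ! k') (map t (rev [i..<Suc l]) ! Suc k')"
              unfolding e1 e2 adj_def using SG(8) by metis
          qed
          have gp: "gpath G p" using P(1) .
          have succ_p: "successively (adj G) (drop s p)" if "s < length p"
            using poss_causal_drop[OF p(2) that] by (simp add: poss_causal_path_def gpath_successively)
          have link: "adj G (t i) (hd (drop s p))" if "s < length p"
          proof (cases "t i = p ! j")
            case True
            then show ?thesis using gp that by (simp add: hd_drop_conv_nth gpath_def s_def)
          next
            case False
            then show ?thesis using j that by (simp add: hd_drop_conv_nth R_def s_def)
          qed
          have "successively (adj G) q"
            unfolding q_def successively_append_iff last_ts
            using succ_ts succ_p link by (cases "s < length p") auto
          moreover have "distinct q"
            unfolding q_def distinct_append using d1 gp ts_p in_drop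
            by (auto simp: gpath_def set_ts) blast
          moreover have "set q \<subseteq> nodes G"
            using gp tF F_nodes less.prems by (auto simp: q_def set_ts gpath_def dest: in_set_dropD)
          moreover have "sorted_wrt (\<lambda>u v. (v, u) \<notin> dir G) q"
            unfolding q_def sorted_wrt_append
          proof (intro conjI ballI)
            show "sorted_wrt (\<lambda>u v. (v, u) \<notin> dir G) ts"
              unfolding ts_def sorted_wrt_map sorted_wrt_rev
            proof (rule sorted_wrt_mono_rel[of _ "(<)"])
              fix i1 i2 assume b: "i1 \<in> set [i..<Suc l]" "i2 \<in> set [i..<Suc l]" "i1 < i2"
              show "(t i1, t i2) \<notin> dir G"
              proof (cases "i2 = Suc i1")
                case True then show ?thesis using t_und[of i1] b Suc SG(10) by auto
              next
                case False then show ?thesis using t_nonadj[of i1 i2] b less.prems by (auto simp: adj_def)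
              qed
            qed (rule sorted_wrt_upt)
            show "sorted_wrt (\<lambda>u v. (v, u) \<notin> dir G) (drop s p)"
              using p(2) by (simp add: poss_causal_sorted_wrt sorted_wrt_drop)
            show "(v, u') \<notin> dir G" if "u' \<in> set ts" "v \<in> set (drop s p)" for u' v
              using ts_p in_drop[OF that(2)] that(1) by (auto simp: set_ts)
          qed
          ultimately have pc: "gpath G q" "poss_causal_path G q"
            unfolding poss_causal_sorted_wrt gpath_successively by (auto simp: q_def ts_cons)
          have q_cons: "q = t l # (map t (rev [i..<l]) @ drop s p)" by (simp add: q_def ts_cons)
          have qX: "set q \<inter> X = {}"
          proof -
            have "t i' \<notin> X" if "i' \<le> l" for i' using tX that less.prems by auto
            moreover have "p ! j' \<notin> X" if "s \<le> j'" "j' < length p" for j' using P(6) that s ia by auto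
            ultimately show ?thesis using in_drop by (fastforce simp: q_def set_ts)
          qed
          have q_x: "(v, x) \<notin> dir G" if "v \<in> set q" for v
          proof -
            have "(t l, x) \<notin> dir G" using xl SG(11) by blast
            moreover have "(t i', x) \<notin> dir G" if "i' \<le> k" for i' using xt[OF that] SG(9) by blast
            ultimately have "(t i', x) \<notin> dir G" if "i' \<le> l" for i' using that Suc by (cases "i' = l") auto
            then show ?thesis using that in_drop no_back s ia by (fastforce simp: q_def set_ts)
          qed
          have "poss_causal_path G (x # q)"
            using pc qX q_x x X_nodes xl
            unfolding poss_causal_sorted_wrt gpath_successively q_cons by (auto simp: adj_def)
          moreover have "last q \<in> Y"
          proof (cases "s < length p")
            case True then show ?thesis using P(4) by (simp add: q_def)
          next
            case False
            then have "t i = p ! j" "j = length p - 1" using s jb by (auto simp: s_def split: if_splits)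
            then show ?thesis using False P(5) last_ts by (simp add: q_def)
          qed
          ultimately have "(x, t l) \<in> dir G" using amenable_cons x qX unfolding q_cons by blast
          then show ?thesis using xl SG(10) by blast
        qed
      qed
    qed
  qed
  from this[of n] x t(2) show ?thesis by auto
qed


section \<open>The optimal set in represented DAGs\<close>

abbreviation O_set :: "'v set" where "O_set \<equiv> opt_set X Y G"

lemma forb_eq: "forb X Y G = F \<union> X" by (simp add: forb_def)

lemma O_facts: "O_set \<inter> F = {}" "O_set \<inter> X = {}" "O_set \<subseteq> nodes G" "O_set \<inter> Y = {}"
  using Y_posscn posscn_F SG(2) by (auto simp: opt_set_def forb_eq pa_def)

text \<open>The chain starts with the step from the optimal set into a causal node; all later nodes are causal
  because they lie between the sources and the targets.\<close>

lemma optimal_node_causal_path: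
  assumes "s \<in> O_set"
  obtains m h where "h 0 = s" "h (Suc m) \<in> Y" "\<And>j. j < Suc m \<Longrightarrow> (h j, h (Suc j)) \<in> avoid G"
    "\<And>j. 1 \<le> j \<Longrightarrow> j \<le> Suc m \<Longrightarrow> h j \<in> cn X Y G"
proof -
  obtain c where c: "c \<in> cn X Y G" "(s, c) \<in> dir G" using assms by (auto simp: opt_set_def pa_def)
  obtain x y where y: "x \<in> X" "(x, c) \<in> (avoid G)\<^sup>+" "y \<in> Y" "(c, y) \<in> (avoid G)\<^sup>*"
    using c(1) unfolding cn_G_iff by blast
  obtain m where m: "(c, y) \<in> avoid G ^^ m" using y(4) by (metis rtrancl_imp_relpow)
  obtain g where g: "g 0 = c" "g m = y" "\<And>i. i < m \<Longrightarrow> (g i, g (Suc i)) \<in> avoid G"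
    using relpow_sequence[OF m] by blast
  have cX: "c \<notin> X" using c(1) by (auto simp: cn_def)
  define h where "h j = (case j of 0 \<Rightarrow> s | Suc j \<Rightarrow> g j)" for j
  have cn: "h j \<in> cn X Y G" if "1 \<le> j" "j \<le> Suc m" for j
  proof -
    from that obtain k where k: "j = Suc k" "k \<le> m" by (cases j) auto
    have "(g 0, g k) \<in> (avoid G)\<^sup>*" "(g k, g m) \<in> (avoid G)\<^sup>*"
      using seq_rtrancl[of 0 k g "avoid G"] seq_rtrancl[of k m g "avoid G"] g(3) k by auto
    then have "(x, g k) \<in> (avoid G)\<^sup>+" "(g k, y) \<in> (avoid G)\<^sup>*" using y(2) g(1,2) by auto
    then show ?thesis unfolding cn_G_iff k(1) using y(1,3) by (auto simp: h_def)
  qed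
  have "(h j, h (Suc j)) \<in> avoid G" if "j < Suc m" for j
    using that g(1,3) c(2) cX by (cases j) (auto simp: h_def)
  with cn show ?thesis using that[of h m] g(2) y(3) by (auto simp: h_def)
qed

text \<open>A parent in \<open>F\<close> descends from a source, so it is causal itself. For any other parent outside \<open>X\<close>, take a
  causal child from which the targets are nearest: minimality and rule (a) make the whole directed
  path to the targets visible in the graph, so that the parent belongs to the optimal set.\<close>

lemma parents_of_causal:
  assumes D: "D \<in> DAG_class G" and c: "c \<in> cn X Y D" and w: "(w, c) \<in> dir D"
  shows "w \<in> cn X Y D \<union> X \<union> O_set"
proof (rule ccontr)
  assume n: "\<not> ?thesis"
  then have wX: "w \<notin> X" by blast
  obtain y0 where y0: "y0 \<in> Y" "(c, y0) \<in> (avoid D)\<^sup>*" using c unfolding cn_D_iff[OF D] by blast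
  have cX: "c \<notin> X" using c by (auto simp: cn_def)
  have wF: "w \<notin> F"
  proof
    assume "w \<in> F"
    then obtain x where x: "x \<in> X" "(x, w) \<in> (avoid D)\<^sup>+"
      using forbidden_reach avoid_mono(1)[OF D] by blast
    have "(w, y0) \<in> (avoid D)\<^sup>*" using w cX y0(2) by (auto intro: converse_rtrancl_into_rtrancl)
    then have "w \<in> cn X Y D" unfolding cn_D_iff[OF D] using x y0(1) by blast
    then show False using n by blast
  qed
  define T where "T k \<longleftrightarrow> (\<exists>c\<in>cn X Y D. \<exists>y\<in>Y. (w, c) \<in> dir D \<and> (c, y) \<in> avoid D ^^ k)" for k
  have "\<exists>k. T k" unfolding T_def using c w y0 by (meson rtrancl_imp_relpow)
  then obtain k where k: "T k" "\<And>k'. T k' \<Longrightarrow> k \<le> k'" by (meson LeastI_ex Least_le)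
  then obtain c' y where c': "c' \<in> cn X Y D" "y \<in> Y" "(w, c') \<in> dir D" "(c', y) \<in> avoid D ^^ k"
    unfolding T_def by blast
  obtain f where f: "f 0 = c'" "f k = y" "\<And>i. i < k \<Longrightarrow> (f i, f (Suc i)) \<in> avoid D"
    using relpow_sequence[OF c'(4)] by blast
  have wG: "(w, v) \<in> dir G" if "v \<in> cn X Y D" "(w, v) \<in> dir D" for v
    using neighbour_F cn_D_posscn[OF D] dir_D_cases[OF D that(2)] that(1) wF by blast
  have step: "(f i, f (Suc i)) \<in> dir G" if "i < k" for i
    using that
  proof (induction i)
    case 0
    show ?case
    proof (rule ccontr)
      assume a: "\<not> ?thesis"
      then have e: "(w, f 1) \<in> dir D"
        using shortcut[OF D wG[OF c'(1,3)], of "f 1"] f(1) f(3)[of 0] 0 by auto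
      have "(f 1, y) \<in> avoid D ^^ (k - 1)"
        using seq_relpow[of 1 "k - 1" f "avoid D"] f 0 by auto
      moreover have "f 1 \<in> cn X Y D"
      proof -
        obtain x where "x \<in> X" "(x, c') \<in> (avoid D)\<^sup>+" using c'(1) unfolding cn_D_iff[OF D] by blast
        then have "(x, f 1) \<in> (avoid D)\<^sup>+" using f(1) f(3)[of 0] 0 by (auto intro: trancl_into_trancl)
        then show ?thesis
          unfolding cn_D_iff[OF D] using \<open>x \<in> X\<close> c'(2) relpow_imp_rtrancl[OF calculation] by blast
      qed
      ultimately have "T (k - 1)" using e c'(2) unfolding T_def by blast
      then show False using k(2)[of "k - 1"] 0 by auto
    qed
  next
    case (Suc i)
    show ?case
    proof (rule ccontr)
      assume a: "\<not> ?thesis"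
      have "(f i, f (Suc (Suc i))) \<in> dir D"
        using shortcut[OF D, of "f i" "f (Suc i)"] a Suc f(3)[of "Suc i"] by auto
      then have "(f i, f (Suc (Suc i))) \<in> avoid D" using f(3)[of "Suc i"] Suc.prems by auto
      from relpow_shortcut[OF f(3) _ _ this] Suc.prems
      have "(c', y) \<in> avoid D ^^ (Suc i + (k - Suc (Suc i)))" using f by auto
      then have "T (Suc i + (k - Suc (Suc i)))" using c' unfolding T_def by blast
      then show False using k(2) Suc.prems by fastforce
    qed
  qed
  have "(f 0, f k) \<in> (avoid G)\<^sup>*" using seq_rtrancl[of 0 k f "avoid G"] step f(3) by auto
  moreover obtain x where "x \<in> X" "(x, c') \<in> (avoid G)\<^sup>+"
    using posscn_reach cn_D_posscn[OF D] c'(1) by blast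
  ultimately have "c' \<in> cn X Y G" unfolding cn_G_iff using c'(2) f by auto
  then have "w \<in> O_set" using wG[OF c'(1,3)] wF wX by (auto simp: opt_set_def forb_eq pa_def)
  then show False using n by blast
qed


section \<open>Validity of the optimal set\<close>

lemma noncollider_next:
  assumes "definite_status G p" "inner_pos p k" "(p ! (k - 1), p ! k) \<in> dir G" "\<not> collider G p k"
  shows "(p ! k, p ! Suc k) \<in> dir G"
proof -
  have "noncollider G p k" using assms by (auto simp: definite_status_def)
  then show ?thesis using assms(3) SG(9,10) by (auto simp: noncollider_def)
qed

text \<open>Consider a proper non-causal path of definite status and its last run of causal nodes. Entering
  this run by an arrow means passing through the optimal set, or having a collider
  inside the run; otherwise the path can be directed out of the run in some represented DAG, and
  followed backwards it meets a collider among the forbidden nodes or ends in a forbidden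
  source. Every collider met has only forbidden descendants, which the optimal set avoids.\<close>

lemma optimal_set_blocks:
  assumes p: "proper_path G X Y p" "noncausal_path G p" "definite_status G p"
  shows "blocked G O_set p"
proof (rule ccontr)
  assume open_p: "\<not> blocked G O_set p"
  note P = proper_pathD[OF p(1)]
  have adjp: "adj G (p ! i) (p ! Suc i)" if "Suc i < length p" for i using P(1) that by (auto simp: gpath_def)
  have coll_F: "p ! i \<notin> F" if "collider G p i" for i
  proof
    assume a: "p ! i \<in> F"
    have "de G {p ! i} \<subseteq> F"
    proof
      fix v assume "v \<in> de G {p ! i}"
      then have "(p ! i, v) \<in> (dir G)\<^sup>*" using de_iff[OF PDAG_G] by auto
      moreover obtain D u where "D \<in> DAG_class G" "u \<in> cn X Y D" "(u, p ! i) \<in> (dir D)\<^sup>*"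
        using a unfolding F_iff by blast
      ultimately show "v \<in> F" unfolding F_iff using dir_rtrancl_D rtrancl_trans by metis
    qed
    then show False using open_p that O_facts(1) by (fastforce simp: blocked_def)
  qed
  define C where "C = cn X Y G"
  \<comment> \<open>The last run of causal nodes starts at position \<open>m\<close>; it is preceded by a node, as sources are not causal.\<close>
  define m where "m = (LEAST m. \<forall>j. m \<le> j \<and> j < length p \<longrightarrow> p ! j \<in> C)"
  define Q where "Q m \<longleftrightarrow> (\<forall>j. m \<le> j \<and> j < length p \<longrightarrow> p ! j \<in> C)" for m
  have Q_last: "Q (length p - 1)"
    unfolding Q_def
  proof (intro allI impI)
    fix j assume "length p - 1 \<le> j \<and> j < length p"
    then have "j = length p - 1" by auto
    then show "p ! j \<in> C" using P(5) Y_cn by (auto simp: C_def)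
  qed
  have m_Q: "Q m" unfolding m_def Q_def[symmetric] by (rule LeastI[of Q, OF Q_last])
  have ml: "m < length p"
    using Least_le[of Q, OF Q_last] P(2) unfolding m_def Q_def[symmetric]
    by (metis Suc_pred' le_imp_less_Suc length_greater_0_conv)
  have m: "p ! j \<in> C" if "m \<le> j" "j < length p" for j using m_Q that by (auto simp: Q_def)
  have "m \<noteq> 0" using m[of 0] P(2,3) by (auto simp: C_def cn_def)
  have wC: "p ! (m - 1) \<notin> C"
  proof
    assume a: "p ! (m - 1) \<in> C"
    have "p ! j \<in> C" if "m - 1 \<le> j" "j < length p" for j
      using a m[of j] that by (cases "j = m - 1") auto
    then have "Q (m - 1)" by (simp add: Q_def)
    then have "m \<le> m - 1" unfolding m_def Q_def[symmetric] by (rule Least_le[of Q])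
    then show False using \<open>m \<noteq> 0\<close> by simp
  qed
  have Sm: "Suc (m - 1) = m" using \<open>m \<noteq> 0\<close> by simp
  have c1: "p ! m \<in> posscn X Y G" using m[of m] ml cn_posscn by (auto simp: C_def)
  show False
  proof (cases "(p ! (m - 1), p ! m) \<in> dir G")
    case True
    show False
    proof (cases "p ! (m - 1) \<in> X")
      case True': True
      then have "\<not> 1 \<le> m - 1" using P(6)[of "m - 1"] less_imp_diff_less[OF ml, of 1] by blast
      then have m1: "m = 1" using \<open>m \<noteq> 0\<close> by simp
      have "(p ! k, p ! Suc k) \<in> dir G" if "Suc k < length p" for k
        using that
      proof (induction k)
        case 0 then show ?case using True m1 by simp
      next
        case (Suc k)
        have "p ! Suc k \<in> F" using m[of "Suc k"] m1 Suc.prems cn_posscn posscn_F by (auto simp: C_def)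
        then have "\<not> collider G p (Suc k)" using coll_F by blast
        then show ?case using noncollider_next[OF p(3), of "Suc k"] Suc by (auto simp: inner_pos_def)
      qed
      then have "causal_path G p" using P(1) by (simp add: causal_path_def)
      obtain D where D: "D \<in> DAG_class G" using class_nonempty by blast
      have "causal_path D p"
        using \<open>causal_path G p\<close> dir_sub[OF D] adj_D[OF D] nodes_D[OF D] by (auto simp: causal_path_def gpath_def)
      then show False using causal_in_class_poss_causal[OF D] p(2) by (simp add: noncausal_path_def)
    next
      case False
      then have "m - 1 \<noteq> 0" using P(3) by metis
      have "p ! (m - 1) \<notin> F"
      proof
        assume "p ! (m - 1) \<in> F"
        then obtain x where x: "x \<in> X" "(x, p ! (m - 1)) \<in> (avoid G)\<^sup>+" using forbidden_reach by blast
        obtain y where y: "y \<in> Y" "(p ! m, y) \<in> (avoid G)\<^sup>*"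
          using m[of m] ml unfolding C_def cn_G_iff by blast
        have "p ! m \<notin> X" using P(6)[of m] ml \<open>m \<noteq> 0\<close> by auto
        then have "(p ! (m - 1), y) \<in> (avoid G)\<^sup>*" using True y(2) by (auto intro: converse_rtrancl_into_rtrancl)
        then show False using wC x y(1) unfolding C_def cn_G_iff by blast
      qed
      then have "p ! (m - 1) \<in> O_set"
        using True False m[of m] ml by (auto simp: opt_set_def forb_eq pa_def C_def)
      moreover have "noncollider G p (m - 1)"
        using True \<open>m - 1 \<noteq> 0\<close> ml Sm by (auto simp: noncollider_def inner_pos_def)
      ultimately show False using open_p by (auto simp: blocked_def)
    qed
  next
    case False
    obtain D where D: "D \<in> DAG_class G" "(p ! m, p ! (m - 1)) \<in> dir D"
    proof (cases "(p ! m, p ! (m - 1)) \<in> dir G")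
      case True
      then show ?thesis using that class_nonempty dir_sub by blast
    next
      case F: False
      then have "(p ! m, p ! (m - 1)) \<in> und G"
        using adjp[of "m - 1"] False ml Sm SG(8) by (auto simp: adj_def)
      then show ?thesis using that orient by blast
    qed
    have "(p ! Suc i, p ! i) \<in> dir D \<and> (p ! m, p ! i) \<in> (dir D)\<^sup>*" if "i \<le> m - 1" for i
      using that
    proof (induction i rule: inc_induct)
      case base then show ?case using D(2) Sm by simp
    next
      case (step i)
      have ip: "inner_pos p (Suc i)" using step ml by (auto simp: inner_pos_def)
      have "p ! Suc i \<in> F" using descendants_F[OF D(1) c1] step.IH by blast
      then have "noncollider G p (Suc i)" using coll_F p(3) ip by (auto simp: definite_status_def)
      from noncollider_into_D[OF D(1) this] step.IH have "(p ! Suc i, p ! i) \<in> dir D" by simp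
      then show ?case using step.IH by (auto intro: rtrancl_into_rtrancl)
    qed
    then have "(p ! m, p ! 0) \<in> (dir D)\<^sup>*" by simp
    then have "p ! 0 \<in> F" using descendants_F[OF D(1) c1] by blast
    then show False using X_F P(3) by blast
  qed
qed

end


section \<open>Open walks\<close>

definition anc :: "'v pgraph \<Rightarrow> 'v set \<Rightarrow> 'v set" where
  "anc D S = {v. \<exists>s\<in>S. (v, s) \<in> (dir D)\<^sup>*}"

text \<open>On a walk a node may occur several times, with different status, so openness is a property of
  consecutive triples.\<close>

definition open_triple :: "'v pgraph \<Rightarrow> 'v set \<Rightarrow> 'v \<Rightarrow> 'v \<Rightarrow> 'v \<Rightarrow> bool" where
  "open_triple D Z u v w \<longleftrightarrow>
     (if (u, v) \<in> dir D \<and> (w, v) \<in> dir D then v \<in> anc D Z else v \<notin> Z)"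

definition open_walk :: "'v pgraph \<Rightarrow> 'v set \<Rightarrow> 'v list \<Rightarrow> bool" where
  "open_walk D Z p \<longleftrightarrow> p \<noteq> [] \<and> set p \<subseteq> nodes D \<and>
     (\<forall>i. Suc i < length p \<longrightarrow> adj D (p ! i) (p ! Suc i)) \<and>
     (\<forall>i. Suc (Suc i) < length p \<longrightarrow> open_triple D Z (p ! i) (p ! Suc i) (p ! Suc (Suc i)))"

lemma anc_step: "(u, v) \<in> dir D \<Longrightarrow> v \<in> anc D Z \<Longrightarrow> u \<in> anc D Z"
  by (auto simp: anc_def intro: converse_rtrancl_into_rtrancl)

lemma anc_superset: "Z \<subseteq> anc D Z"
  by (auto simp: anc_def)

lemma open_walk_Cons:
  assumes "open_walk D Z (v # p)" "w \<in> nodes D" "adj D w v"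
    and "p \<noteq> [] \<Longrightarrow> open_triple D Z w v (hd p)"
  shows "open_walk D Z (w # v # p)"
  unfolding open_walk_def
proof (intro conjI allI impI)
  fix i
  show "adj D ((w # v # p) ! i) ((w # v # p) ! Suc i)" if "Suc i < length (w # v # p)"
    using assms(1,3) that by (cases i) (auto simp: open_walk_def)
  show "open_triple D Z ((w # v # p) ! i) ((w # v # p) ! Suc i) ((w # v # p) ! Suc (Suc i))"
    if "Suc (Suc i) < length (w # v # p)"
  proof (cases i)
    case 0
    then have "p \<noteq> []" using that by auto
    then show ?thesis using assms(4) 0 by (simp add: hd_conv_nth)
  next
    case (Suc j)
    then show ?thesis using assms(1) that by (auto simp: open_walk_def)
  qed
qed (use assms in \<open>auto simp: open_walk_def\<close>)

text \<open>Cutting a segment out of a walk changes the status of its two border nodes only.\<close>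

lemma open_walk_splice:
  assumes p: "open_walk D Z p" and kl: "k \<le> l" "l < length p"
    and 1: "1 \<le> k \<Longrightarrow> adj D (p ! (k - 1)) (p ! l)"
    and 2: "2 \<le> k \<Longrightarrow> open_triple D Z (p ! (k - 2)) (p ! (k - 1)) (p ! l)"
    and 3: "1 \<le> k \<Longrightarrow> Suc l < length p \<Longrightarrow> open_triple D Z (p ! (k - 1)) (p ! l) (p ! Suc l)"
  shows "open_walk D Z (take k p @ drop l p)"
proof -
  let ?q = "take k p @ drop l p"
  have len: "length ?q = k + (length p - l)" using kl by simp
  have lo: "?q ! i = p ! i" if "i < k" for i using that kl by (simp add: nth_append)
  have hi: "?q ! i = p ! (l + (i - k))" if "k \<le> i" for i using that kl by (simp add: nth_append)
  show ?thesis
    unfolding open_walk_def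
  proof (intro conjI allI impI)
    show "?q \<noteq> []" using kl by auto
    show "set ?q \<subseteq> nodes D"
      using p by (auto simp: open_walk_def dest: in_set_takeD in_set_dropD)
  next
    fix i assume i: "Suc i < length ?q"
    consider "Suc i < k" | "Suc i = k" | "k \<le> i" by linarith
    then show "adj D (?q ! i) (?q ! Suc i)"
    proof cases
      case 1 then show ?thesis using p kl by (auto simp: open_walk_def lo)
    next
      case 2 then show ?thesis using 1 by (auto simp: lo hi)
    next
      case 3
      then obtain e where "i = k + e" using le_Suc_ex by blast
      moreover have "?q ! (k + e) = p ! (l + e)" "?q ! Suc (k + e) = p ! Suc (l + e)" for e
        using hi[of "k + e"] hi[of "Suc (k + e)"] by auto
      moreover have "Suc (l + e) < length p" using i len calculation(1) by linarith
      ultimately show ?thesis using p by (simp add: open_walk_def)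
    qed
  next
    fix i assume i: "Suc (Suc i) < length ?q"
    consider "Suc (Suc i) < k" | "Suc (Suc i) = k" | "Suc i = k" | "k \<le> i" by linarith
    then show "open_triple D Z (?q ! i) (?q ! Suc i) (?q ! Suc (Suc i))"
    proof cases
      case 1 then show ?thesis using p kl by (auto simp: open_walk_def lo)
    next
      case c: 2 then show ?thesis using 2 by (auto simp: lo hi)
    next
      case c: 3 then show ?thesis using 3 i len by (auto simp: lo hi)
    next
      case 4
      then obtain e where "i = k + e" using le_Suc_ex by blast
      moreover have "?q ! (k + e) = p ! (l + e)" "?q ! Suc (k + e) = p ! Suc (l + e)"
        "?q ! Suc (Suc (k + e)) = p ! Suc (Suc (l + e))" for e
        using hi[of "k + e"] hi[of "Suc (k + e)"] hi[of "Suc (Suc (k + e))"] by auto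
      moreover have "Suc (Suc (l + e)) < length p" using i len calculation(1) by linarith
      ultimately show ?thesis using p by (simp add: open_walk_def)
    qed
  qed
qed


section \<open>Shortest open walks are open definite status paths\<close>

context max_pdag
begin

context
  fixes D Z p
  assumes D: "D \<in> DAG_class G"
    and p: "open_walk D Z p"
    and shortest: "\<And>q. open_walk D Z q \<Longrightarrow> hd q = hd p \<Longrightarrow> last q = last p \<Longrightarrow> length p \<le> length q"
begin

lemma walk_ne: "p \<noteq> []" using p by (simp add: open_walk_def)

lemma walk_adj: "Suc i < length p \<Longrightarrow> adj G (p ! i) (p ! Suc i)"
  using p adj_D[OF D] by (auto simp: open_walk_def)

lemma walk_dir: "Suc i < length p \<Longrightarrow> (p ! i, p ! Suc i) \<in> dir D \<or> (p ! Suc i, p ! i) \<in> dir D"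
  using walk_adj adj_iff_dir[OF D] by blast

lemma walk_triple:
  "Suc (Suc i) < length p \<Longrightarrow> open_triple D Z (p ! i) (p ! Suc i) (p ! Suc (Suc i))"
  using p by (auto simp: open_walk_def)

lemma no_splice:
  assumes "k < l" "l < length p" "k = 0 \<Longrightarrow> p ! l = p ! 0"
    and "1 \<le> k \<Longrightarrow> adj D (p ! (k - 1)) (p ! l)"
    and "2 \<le> k \<Longrightarrow> open_triple D Z (p ! (k - 2)) (p ! (k - 1)) (p ! l)"
    and "1 \<le> k \<Longrightarrow> Suc l < length p \<Longrightarrow> open_triple D Z (p ! (k - 1)) (p ! l) (p ! Suc l)"
  shows False
proof -
  let ?q = "take k p @ drop l p"
  have "open_walk D Z ?q" using open_walk_splice[OF p _ assms(2,4,5,6)] assms(1) by auto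
  moreover have "hd ?q = hd p"
    using assms(1-3) walk_ne by (cases "k = 0") (auto simp: hd_append hd_drop_conv_nth hd_conv_nth)
  moreover have "last ?q = last p" using assms by simp
  ultimately have "length p \<le> length ?q" by (rule shortest)
  then show False using assms(1,2) by simp
qed

text \<open>Followed forwards from the first node, the arrows must turn around before the last one. The first turn is
  a collider, and openness makes it an ancestor of \<open>Z\<close>.\<close>

lemma descend_to_collider:
  assumes "i < j" "j < length p" "(p ! i, p ! Suc i) \<in> dir D" "(p ! j, p ! (j - 1)) \<in> dir D"
  shows "p ! i \<in> anc D Z"
  using assms
proof (induction "j - i" arbitrary: i)
  case (Suc k)
  show ?case
  proof (cases "Suc i = j")
    case True
    then show ?thesis using Suc.prems SD(9)[OF D] by auto
  next
    case False
    then have l: "Suc i < j" "Suc (Suc i) < length p" using Suc.prems by auto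
    have "p ! Suc i \<in> anc D Z"
    proof (cases "(p ! Suc i, p ! Suc (Suc i)) \<in> dir D")
      case True
      then show ?thesis using Suc.hyps(1)[of "Suc i"] Suc.hyps(2) Suc.prems l by auto
    next
      case False
      then have "(p ! Suc (Suc i), p ! Suc i) \<in> dir D" using walk_dir l by blast
      then show ?thesis using walk_triple[OF l(2)] Suc.prems by (auto simp: open_triple_def)
    qed
    then show ?thesis using anc_step Suc.prems by metis
  qed
qed simp

text \<open>A loop at a node could be cut out. This might block the walk only by making the node a
  new collider; but then the loop leaves the node by outgoing edges on both sides, and contains a
  collider below it.\<close>

lemma walk_distinct: "distinct p"
proof (rule ccontr)
  assume "\<not> distinct p"
  then obtain i j where ij: "i < j" "j < length p" "p ! i = p ! j"
    unfolding distinct_conv_nth by (metis linorder_neqE_nat)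
  show False
  proof (rule no_splice[OF ij(1,2)])
    show "p ! j = p ! 0" if "i = 0" using ij that by simp
    assume "1 \<le> i"
    then obtain k where i: "i = Suc k" by (cases i) auto
    have b: "Suc (Suc k) < length p" using ij i by auto
    show "adj D (p ! (i - 1)) (p ! j)" using walk_adj[of k] adj_D[OF D] i ij by auto
    assume j: "Suc j < length p"
    obtain j' where j': "j = Suc j'" using ij by (cases j) auto
    have ti: "open_triple D Z (p ! k) (p ! j) (p ! Suc i)" using walk_triple[OF b] i ij by simp
    have tj: "open_triple D Z (p ! j') (p ! j) (p ! Suc j)" using walk_triple[of j'] j j' by simp
    have di: "(p ! j, p ! Suc i) \<in> dir D \<or> (p ! Suc i, p ! j) \<in> dir D" using walk_dir[of i] ij by auto
    have dj: "(p ! j', p ! j) \<in> dir D \<or> (p ! j, p ! j') \<in> dir D" using walk_dir[of j'] ij j' by auto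
    show "open_triple D Z (p ! (i - 1)) (p ! j) (p ! Suc j)"
    proof (cases "(p ! k, p ! j) \<in> dir D \<and> (p ! Suc j, p ! j) \<in> dir D")
      case True
      have "p ! j \<in> anc D Z"
      proof (rule ccontr)
        assume n: "p ! j \<notin> anc D Z"
        then have "(p ! j, p ! Suc i) \<in> dir D" "(p ! j, p ! j') \<in> dir D"
          using True ti tj di dj by (auto simp: open_triple_def)
        then show False using descend_to_collider[of i j] ij j' n by auto
      qed
      then show ?thesis using True i by (simp add: open_triple_def)
    next
      case False
      have "p ! j \<notin> Z"
        using False ti tj anc_superset[of Z D] by (auto simp: open_triple_def split: if_splits)
      then show ?thesis using False i by (auto simp: open_triple_def)
    qed
  next
    assume "2 \<le> i"
    then obtain k where i: "i = Suc (Suc k)" by (metis Suc_le_D numeral_2_eq_2 Suc_le_mono)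
    show "open_triple D Z (p ! (i - 2)) (p ! (i - 1)) (p ! j)"
      using walk_triple[of k] i ij by auto
  qed
qed

text \<open>Skipping the middle node of a shielded triple gives a shorter walk. It stays open unless the triple
  is a fork and a neighbouring collider in \<open>Z\<close> becomes a non-collider.\<close>

lemma shielded_triple:
  assumes i: "Suc (Suc i) < length p" and adj: "adj G (p ! i) (p ! Suc (Suc i))"
  shows "(p ! Suc i, p ! i) \<in> dir D \<and> (p ! Suc i, p ! Suc (Suc i)) \<in> dir D \<and>
    (1 \<le> i \<and> (p ! (i - 1), p ! i) \<in> dir D \<or>
     Suc (Suc (Suc i)) < length p \<and> (p ! Suc (Suc (Suc i)), p ! Suc (Suc i)) \<in> dir D)"
proof (rule ccontr)
  assume n: "\<not> ?thesis"
  define u b c where "u = p ! i" and "b = p ! Suc i" and "c = p ! Suc (Suc i)"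
  note defs = u_def b_def c_def
  have asym: "(v, w) \<in> dir D \<Longrightarrow> (w, v) \<notin> dir D" for v w using SD(9)[OF D] .
  have ub: "(u, b) \<in> dir D \<or> (b, u) \<in> dir D" using walk_dir[of i] i by (auto simp: defs)
  have bc: "(b, c) \<in> dir D \<or> (c, b) \<in> dir D" using walk_dir[of "Suc i"] i by (auto simp: defs)
  have uc: "(u, c) \<in> dir D \<or> (c, u) \<in> dir D" using adj adj_iff_dir[OF D] by (auto simp: defs)
  have acyc: "\<not> ((v, w) \<in> dir D \<and> (w, z) \<in> dir D \<and> (z, v) \<in> dir D)" for v w z
    using no_cycle[OF D, of v z] by (meson r_into_rtrancl trancl.simps)
  have b: "open_triple D Z u b c" using walk_triple[OF i] by (simp add: defs)
  have t: "open_triple D Z (p ! (i - 1)) u b" if "1 \<le> i"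
    using walk_triple[of "i - 1"] that i by (simp add: defs)
  have d: "open_triple D Z b c (p ! Suc (Suc (Suc i)))" if "Suc (Suc (Suc i)) < length p"
    using walk_triple[of "Suc i"] that by (simp add: defs)
  \<comment> \<open>Skipping \<open>b\<close> can only affect \<open>u\<close> and \<open>c\<close>. Where their new status differs from the old one, a new collider
    lies above the collider \<open>b\<close>, and a new non-collider in \<open>Z\<close> is excluded by this assumption.\<close>
  have n': "1 \<le> i \<Longrightarrow> (p ! (i - 1), u) \<notin> dir D" "Suc (Suc (Suc i)) < length p \<Longrightarrow> (p ! Suc (Suc (Suc i)), c) \<notin> dir D"
    if "(b, u) \<in> dir D" "(b, c) \<in> dir D" using n that by (auto simp: defs)
  have bA: "b \<in> anc D Z" if "(u, b) \<in> dir D" "(c, b) \<in> dir D" using b that by (auto simp: open_triple_def)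
  show False
  proof (rule no_splice[of "Suc i" "Suc (Suc i)"])
    show "adj D (p ! (Suc i - 1)) (p ! Suc (Suc i))" using adj adj_D[OF D] by simp
    show "open_triple D Z (p ! (Suc i - 2)) (p ! (Suc i - 1)) (p ! Suc (Suc i))" if "2 \<le> Suc i"
    proof -
      have i1: "1 \<le> i" "Suc i - 2 = i - 1" using that by auto
      have "open_triple D Z (p ! (i - 1)) u c"
        using t[OF i1(1)] n'(1)[OF _ _ i1(1)] ub bc uc acyc[of u b c] acyc[of c b u] asym
          anc_step[of u b D Z] bA
        unfolding open_triple_def by (metis (full_types))
      then show ?thesis by (simp add: i1(2) defs)
    qed
    show "open_triple D Z (p ! (Suc i - 1)) (p ! Suc (Suc i)) (p ! Suc (Suc (Suc i)))"
      if l: "Suc (Suc (Suc i)) < length p"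
    proof -
      have "open_triple D Z u c (p ! Suc (Suc (Suc i)))"
        using d[OF l] n'(2)[OF _ _ l] ub bc uc acyc[of u b c] acyc[of c b u] asym
          anc_step[of c b D Z] bA
        unfolding open_triple_def by (metis (full_types))
      then show ?thesis by (simp add: defs)
    qed
  qed (use i in auto)
qed

lemma collider_unshielded:
  assumes i: "Suc (Suc i) < length p"
    and c: "(p ! i, p ! Suc i) \<in> dir D" "(p ! Suc (Suc i), p ! Suc i) \<in> dir D"
  shows "(p ! i, p ! Suc i) \<in> dir G" "(p ! Suc (Suc i), p ! Suc i) \<in> dir G"
proof -
  have "\<not> adj G (p ! i) (p ! Suc (Suc i))" using shielded_triple[OF i] c SD(9)[OF D] by blast
  moreover have "p ! i \<noteq> p ! Suc (Suc i)" using walk_distinct i by (simp add: nth_eq_iff_index_eq)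
  ultimately show "(p ! i, p ! Suc i) \<in> dir G" "(p ! Suc (Suc i), p ! Suc i) \<in> dir G"
    using v_structure_G[OF D c] by auto
qed

lemma walk_gpath: "gpath G p"
  using p walk_adj walk_distinct nodes_D[OF D] by (auto simp: gpath_def open_walk_def)

lemma walk_definite_status: "definite_status G p"
  unfolding definite_status_def
proof (intro conjI allI impI walk_gpath)
  fix j assume "inner_pos p j"
  then obtain i where j: "j = Suc i" and i: "Suc (Suc i) < length p"
    by (cases j) (auto simp: inner_pos_def)
  have ip: "inner_pos p (Suc i)" using i by (simp add: inner_pos_def)
  show "collider G p j \<or> noncollider G p j"
  proof (cases "(p ! i, p ! Suc i) \<in> dir D \<and> (p ! Suc (Suc i), p ! Suc i) \<in> dir D")
    case True
    then have "collider G p j" using collider_unshielded[OF i] ip j by (auto simp: collider_def)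
    then show ?thesis ..
  next
    case False
    then have out: "(p ! Suc i, p ! i) \<in> dir D \<or> (p ! Suc i, p ! Suc (Suc i)) \<in> dir D"
      using walk_dir[of i] walk_dir[of "Suc i"] i by auto
    have "(p ! Suc i, p ! i) \<in> dir G \<or> (p ! Suc i, p ! Suc (Suc i)) \<in> dir G \<or>
      (p ! i, p ! Suc i) \<in> und G \<and> (p ! Suc i, p ! Suc (Suc i)) \<in> und G \<and> nonadj G (p ! i) (p ! Suc (Suc i))"
    proof (cases "adj G (p ! i) (p ! Suc (Suc i))")
      case True
      from shielded_triple[OF i this] consider
        "1 \<le> i" "(p ! (i - 1), p ! i) \<in> dir D" "(p ! Suc i, p ! i) \<in> dir D"
        | "Suc (Suc (Suc i)) < length p" "(p ! Suc (Suc (Suc i)), p ! Suc (Suc i)) \<in> dir D"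
          "(p ! Suc i, p ! Suc (Suc i)) \<in> dir D" by blast
      then show ?thesis
      proof cases
        case 1
        then show ?thesis using collider_unshielded(2)[of "i - 1"] i by auto
      next
        case 2
        then show ?thesis using collider_unshielded(1)[of "Suc i"] by auto
      qed
    next
      case False
      then have "nonadj G (p ! i) (p ! Suc (Suc i))"
        using walk_distinct i by (simp add: nonadj_def nth_eq_iff_index_eq)
      then show ?thesis using noncollider_cases[OF D out] walk_adj i by auto
    qed
    then have "noncollider G p j" using ip unfolding noncollider_def j by simp
    then show ?thesis ..
  qed
qed

lemma walk_noncollider_notin:
  assumes "noncollider G p j" shows "p ! j \<notin> Z"
proof -
  from assms obtain i where j: "j = Suc i" and i: "Suc (Suc i) < length p"
    by (cases j) (auto simp: noncollider_def inner_pos_def)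
  have "\<not> ((p ! i, p ! Suc i) \<in> dir D \<and> (p ! Suc (Suc i), p ! Suc i) \<in> dir D)"
    using noncollider_into_D[OF D assms] SD(9)[OF D] by (auto simp: j)
  then show ?thesis using walk_triple[OF i] by (auto simp: j open_triple_def split: if_splits)
qed

lemma open_triple_cong:
  assumes "open_triple D Z t u b" "(u, b) \<in> dir D" "(u, d) \<in> dir D"
  shows "open_triple D Z t u d"
  using assms SD(9)[OF D] by (auto simp: open_triple_def)

text \<open>If the graph does not show that a collider of a shortest open walk has a descendant in \<open>Z\<close>, then
  a shortest directed path from it to \<open>Z\<close> in the DAG starts with an undirected edge, and the
  second node of this path can take the place of the collider.\<close>

lemma lower_collider:
  assumes j: "collider G p j" and none: "de G {p ! j} \<inter> Z = {}"
  obtains d where "(p ! j, d) \<in> dir D" "open_walk D Z (p[j := d])"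
proof -
  from j obtain i where j': "j = Suc i" and i: "Suc (Suc i) < length p"
    and c: "(p ! i, p ! Suc i) \<in> dir G" "(p ! Suc (Suc i), p ! Suc i) \<in> dir G"
    by (cases j) (auto simp: collider_def inner_pos_def)
  define b where "b = p ! Suc i"
  have cD: "(p ! i, b) \<in> dir D" "(p ! Suc (Suc i), b) \<in> dir D" using c dir_sub[OF D] by (auto simp: b_def)
  have "b \<in> anc D Z" using walk_triple[OF i] cD by (auto simp: open_triple_def b_def)
  then obtain z where z: "z \<in> Z" "(b, z) \<in> (dir D)\<^sup>*" by (auto simp: anc_def)
  from z(2) obtain n f where f: "f 0 = b" "f n = z" "\<And>i. i < n \<Longrightarrow> (f i, f (Suc i)) \<in> dir D"
    "\<And>i j. Suc i < j \<Longrightarrow> j \<le> n \<Longrightarrow> (f i, f j) \<notin> dir D" by (rule induced_sequence) blast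
  have bN: "b \<in> nodes G" using SG(3)[OF c(1)] by (simp add: b_def)
  have zb: "(b, z) \<notin> (dir G)\<^sup>*"
    using none z(1) de_iff[OF PDAG_G, of z "{b}"] bN by (auto simp: j' b_def)
  then have n: "0 < n" using f(1,2) by (cases n) auto
  have first: "(b, f 1) \<notin> dir G"
  proof
    assume a: "(b, f 1) \<in> dir G"
    have "(f k, f (Suc k)) \<in> dir G" if "k < n" for k
      using that
    proof (induction k)
      case 0 then show ?case using a f(1) by simp
    next
      case (Suc k)
      then show ?case using shortcut[OF D, of "f k" "f (Suc k)" "f (Suc (Suc k))"] f(3)[of "Suc k"]
        f(4)[of k "Suc (Suc k)"] by auto
    qed
    then have "(f 0, f n) \<in> (dir G)\<^sup>*" using seq_rtrancl[of 0 n f "dir G"] by auto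
    then show False using zb f by simp
  qed
  define d where "d = f 1"
  have bd: "(b, d) \<in> dir D" using f(1) f(3)[of 0] n by (simp add: d_def)
  have ud: "(p ! i, d) \<in> dir D" "(p ! Suc (Suc i), d) \<in> dir D"
    using shortcut[OF D _ bd] first c by (auto simp: b_def d_def)
  have "(d, z) \<in> (dir D)\<^sup>*" using seq_rtrancl[of 1 n f "dir D"] f n by (auto simp: d_def)
  then have dA: "d \<in> anc D Z" using z(1) by (auto simp: anc_def)
  let ?q = "p[j := d]"
  have nth: "?q ! k = (if k = Suc i then d else p ! k)" if "k < length p" for k
    using that by (simp add: j' nth_list_update)
  have "open_walk D Z ?q"
    unfolding open_walk_def
  proof (intro conjI allI impI)
    show "?q \<noteq> []" using walk_ne by simp
    show "set ?q \<subseteq> nodes D"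
      using p SD(3)[OF D bd] set_update_subset_insert[of p j d] by (auto simp: open_walk_def)
  next
    fix k assume k: "Suc k < length ?q"
    have "adj D (p ! i) d" "adj D d (p ! Suc (Suc i))" using ud by (auto simp: adj_def)
    then show "adj D (?q ! k) (?q ! Suc k)"
      using k p nth[of k] nth[of "Suc k"] by (auto simp: open_walk_def)
  next
    fix k assume "Suc (Suc k) < length ?q"
    then have k: "Suc (Suc k) < length p" by simp
    note nths = nth[of k] nth[of "Suc k"] nth[of "Suc (Suc k)"]
    note T = walk_triple[OF k]
    consider "k = i" | "Suc k = i" | "k = Suc i" | "k \<noteq> i \<and> Suc k \<noteq> i \<and> k \<noteq> Suc i" by blast
    then show "open_triple D Z (?q ! k) (?q ! Suc k) (?q ! Suc (Suc k))"
    proof cases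
      case 1
      then show ?thesis using nths k ud dA by (simp add: open_triple_def)
    next
      case 2
      then have "open_triple D Z (p ! k) (p ! Suc k) d"
        using open_triple_cong[OF T] cD ud by (auto simp: b_def)
      then show ?thesis using nths k 2 by auto
    next
      case 3
      have "open_triple D Z (p ! Suc (Suc k)) (p ! Suc k) b"
        using T 3 unfolding open_triple_def b_def by (auto split: if_splits)
      then have "open_triple D Z (p ! Suc (Suc k)) (p ! Suc k) d"
        using open_triple_cong cD ud 3 by blast
      then have "open_triple D Z d (p ! Suc k) (p ! Suc (Suc k))"
        unfolding open_triple_def by (auto split: if_splits)
      then show ?thesis using nths k 3 by auto
    next
      case 4
      then show ?thesis using nths k T by auto
    qed
  qed
  with that[of d] bd show ?thesis by (simp add: j' b_def)
qed

end

text \<open>Replacing a collider by a child of it lowers the total number of descendants, so a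
  shortest open walk for which this number is least is an open path of definite status in the
  graph.\<close>

lemma open_walk_transfer:
  assumes D: "D \<in> DAG_class G" and p0: "open_walk D Z p0"
  obtains p where "definite_status G p" "hd p = hd p0" "last p = last p0" "\<not> blocked G Z p"
proof -
  define W where "W p \<longleftrightarrow> open_walk D Z p \<and> hd p = hd p0 \<and> last p = last p0" for p
  define ds where "ds v = card {w. (v, w) \<in> (dir D)\<^sup>*}" for v
  define n where "n = (LEAST n. \<exists>p. W p \<and> length p = n)"
  have n_le: "n \<le> length p" if "W p" for p unfolding n_def using that by (intro Least_le) blast
  have "\<exists>p. W p \<and> length p = n" unfolding n_def by (rule LeastI[of _ "length p0"]) (use p0 in \<open>auto simp: W_def\<close>)
  then obtain p where p: "W p \<and> length p = n"
    "\<And>q. W q \<and> length q = n \<Longrightarrow> sum_list (map ds p) \<le> sum_list (map ds q)"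
    using ex_has_least_nat[of "\<lambda>p. W p \<and> length p = n" _ "\<lambda>p. sum_list (map ds p)"] by blast
  have pw: "open_walk D Z p" using p by (simp add: W_def)
  have sh: "length p \<le> length q" if "open_walk D Z q" "hd q = hd p" "last q = last p" for q
    using n_le[of q] that p by (auto simp: W_def)
  note L = walk_definite_status[OF D pw sh] walk_noncollider_notin[OF D pw sh]
  have ds: "ds d < ds b" if bd: "(b, d) \<in> dir D" for b d
    unfolding ds_def
  proof (rule psubset_card_mono)
    have "{w. (b, w) \<in> (dir D)\<^sup>*} \<subseteq> insert b (nodes D)"
      using SD(3)[OF D] by (auto elim: rtranclE)
    then show "finite {w. (b, w) \<in> (dir D)\<^sup>*}" using SD(1)[OF D] finite_subset by auto
    have "(d, b) \<notin> (dir D)\<^sup>*" using no_cycle[OF D, of b d] bd by blast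
    then show "{w. (d, w) \<in> (dir D)\<^sup>*} \<subset> {w. (b, w) \<in> (dir D)\<^sup>*}"
      using bd by (auto intro: converse_rtrancl_into_rtrancl)
  qed
  have coll: "de G {p ! j} \<inter> Z \<noteq> {}" if j: "collider G p j" for j
  proof
    assume "de G {p ! j} \<inter> Z = {}"
    then obtain d where d: "(p ! j, d) \<in> dir D" "open_walk D Z (p[j := d])"
      using lower_collider[OF D pw sh j] by blast
    have jl: "0 < j" "Suc j < length p" using j by (auto simp: collider_def inner_pos_def)
    have "hd (p[j := d]) = hd p" "last (p[j := d]) = last p"
      using jl by (cases p; cases j; auto simp: last_list_update)+
    then have "W (p[j := d])" using d(2) p by (simp add: W_def)
    then have "sum_list (map ds p) \<le> sum_list (map ds (p[j := d]))" using p(2)[of "p[j := d]"] p(1) by simp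
    moreover have "sum_list (map ds (p[j := d])) + ds (p ! j) = sum_list (map ds p) + ds d"
      using jl sum_list_update[of j "map ds p" "ds d"] elem_le_sum_list[of j "map ds p"]
      by (simp add: map_update)
    ultimately show False using ds[OF d(1)] by simp
  qed
  have "\<not> blocked G Z p" unfolding blocked_def using coll L(2) by blast
  moreover have "hd p = hd p0" "last p = last p0" using p(1) by (auto simp: W_def)
  ultimately show ?thesis using that[OF L(1)] by blast
qed

end


section \<open>Reachability along open walks\<close>

text \<open>The second argument records whether the walk to the node may be continued as if it had been
  left by an outgoing edge, that is, whether it ends in an arrow out of the node, or has
  only just started there.\<close>

inductive reach :: "'v pgraph \<Rightarrow> 'v set \<Rightarrow> 'v \<Rightarrow> 'v \<Rightarrow> bool \<Rightarrow> bool" for D Z s where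
  start: "reach D Z s s True"
| up: "reach D Z s v True \<Longrightarrow> v \<notin> Z \<Longrightarrow> (w, v) \<in> dir D \<Longrightarrow> reach D Z s w True"
| down: "reach D Z s v b \<Longrightarrow> v \<notin> Z \<Longrightarrow> (v, w) \<in> dir D \<Longrightarrow> reach D Z s w False"
| turn: "reach D Z s v False \<Longrightarrow> v \<in> anc D Z \<Longrightarrow> (w, v) \<in> dir D \<Longrightarrow> reach D Z s w True"

lemma reach_open_walk:
  assumes "reach D Z s v b" "PDAG D" "s \<in> nodes D"
  shows "\<exists>p. open_walk D Z (v # p) \<and> last (v # p) = s \<and>
    (if p = [] then b else if b then (v, hd p) \<in> dir D else (hd p, v) \<in> dir D)"
  using assms(1)
proof induction
  case start
  show ?case by (rule exI[of _ "[]"]) (use assms(3) in \<open>auto simp: open_walk_def\<close>)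
next
  note S = simple_graphD[OF PDAGD(1)[OF assms(2)]]
  case (up v w)
  then obtain p where p: "open_walk D Z (v # p)" "last (v # p) = s" "p \<noteq> [] \<Longrightarrow> (v, hd p) \<in> dir D"
    by (auto split: if_splits)
  have "open_walk D Z (w # v # p)"
    using open_walk_Cons[OF p(1) S(2)[OF up(3)]] up p(3) S(9) by (auto simp: adj_def open_triple_def)
  then show ?case using p(2) up by (intro exI[of _ "v # p"]) auto
next
  note S = simple_graphD[OF PDAGD(1)[OF assms(2)]]
  case (down v b w)
  then obtain p where p: "open_walk D Z (v # p)" "last (v # p) = s"
    by (auto split: if_splits)
  have "open_walk D Z (w # v # p)"
    using open_walk_Cons[OF p(1) S(3)[OF down(3)]] down S(9) by (auto simp: adj_def open_triple_def)
  then show ?case using p(2) down by (intro exI[of _ "v # p"]) auto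
next
  note S = simple_graphD[OF PDAGD(1)[OF assms(2)]]
  case (turn v w)
  then obtain p where p: "open_walk D Z (v # p)" "last (v # p) = s" "p \<noteq> [] \<Longrightarrow> (hd p, v) \<in> dir D"
    by (auto split: if_splits)
  have "open_walk D Z (w # v # p)"
    using open_walk_Cons[OF p(1) S(2)[OF turn(3)]] turn p(3) by (auto simp: adj_def open_triple_def)
  then show ?case using p(2) turn by (intro exI[of _ "v # p"]) auto
qed

text \<open>Among the ancestors of \<open>X\<close>, \<open>Z\<close> and the starting node, reachability cannot separate a node
  from its parents outside \<open>Z\<close>: as no source is reached, a walk that has come down to a node has a
  collider available there, or could have come up from the starting node.\<close>

lemma reach_family:
  assumes none: "\<And>x b. x \<in> X \<Longrightarrow> \<not> reach D Z s x b"
    and i: "i \<in> anc D (X \<union> Z \<union> {s})"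
    and m: "m = i \<or> (m, i) \<in> dir D" "m \<notin> Z" "reach D Z s m b"
    and k: "k = i \<or> (k, i) \<in> dir D" "k \<notin> Z"
  shows "\<exists>b. reach D Z s k b"
proof -
  obtain b' where ib: "reach D Z s i b'" "i \<in> Z \<Longrightarrow> \<not> b'"
    using m reach.down[OF m(3,2)] by blast
  have parents: "reach D Z s w True" if w: "(w, i) \<in> dir D" for w
  proof (cases "i \<in> anc D Z")
    case True
    show ?thesis
    proof (cases b')
      case True': True
      then have "i \<notin> Z" using ib by blast
      have "reach D Z s i True" using ib(1) True' by simp
      then show ?thesis using \<open>i \<notin> Z\<close> w by (rule reach.up)
    next
      case False
      then have "reach D Z s i False" using ib(1) by simp
      then show ?thesis using True w by (rule reach.turn)
    qed
  next
    case False
    have notZ: "v \<notin> Z" if "(i, v) \<in> (dir D)\<^sup>*" for v using that False by (auto simp: anc_def)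
    from i False consider x where "x \<in> X" "(i, x) \<in> (dir D)\<^sup>*" | "(i, s) \<in> (dir D)\<^sup>*"
      by (auto simp: anc_def)
    then have "reach D Z s i True"
    proof cases
      case 1
      have "\<exists>b. reach D Z s v b" if "(i, v) \<in> (dir D)\<^sup>*" for v
        using that
      proof induction
        case (step u v)
        then obtain b where "reach D Z s u b" by blast
        then have "reach D Z s v False" using notZ[OF step(1)] step(2) by (rule reach.down)
        then show ?case by blast
      qed (use ib in blast)
      then show ?thesis using none 1 by blast
    next
      case 2
      have "(i, u) \<in> (dir D)\<^sup>* \<Longrightarrow> reach D Z s u True" if "(u, s) \<in> (dir D)\<^sup>*" for u
        using that
      proof (induction rule: converse_rtrancl_induct)
        case base show ?case by (rule reach.start)
      next
        case (step u v)
        then have "(i, v) \<in> (dir D)\<^sup>*" by (meson rtrancl_into_rtrancl)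
        with step have "reach D Z s v True" by blast
        then show ?case using notZ[OF \<open>(i, v) \<in> (dir D)\<^sup>*\<close>] step(1) by (rule reach.up)
      qed
      then show ?thesis using 2 by blast
    qed
    then show ?thesis using notZ[of i] w by (auto intro: reach.up)
  qed
  then show ?thesis using k ib by blast
qed


context adjustable
begin

lemma status_drop:
  "collider G (drop k p) i \<longleftrightarrow> 0 < i \<and> collider G p (k + i)"
  "noncollider G (drop k p) i \<longleftrightarrow> 0 < i \<and> noncollider G p (k + i)"
  by (cases i; auto simp: collider_def noncollider_def inner_pos_def)+

lemma definite_status_drop:
  assumes "definite_status G p" "k < length p"
  shows "definite_status G (drop k p)"
proof -
  have "gpath G (drop k p)"
    using assms by (auto simp: definite_status_def gpath_def dest: in_set_dropD)
  moreover have "collider G (drop k p) i \<or> noncollider G (drop k p) i" if "inner_pos (drop k p) i" for i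
  proof -
    have "inner_pos p (k + i)" "0 < i" using that assms(2) by (auto simp: inner_pos_def)
    then show ?thesis using assms(1) unfolding status_drop by (auto simp: definite_status_def)
  qed
  ultimately show ?thesis by (simp add: definite_status_def)
qed

lemma blocked_drop: "blocked G Z (drop k p) \<Longrightarrow> blocked G Z p"
  unfolding blocked_def status_drop
  by (metis add.commute linorder_not_le noncollider_def collider_def inner_pos_def nth_drop
      drop_all less_imp_le_nat list.size(3) not_less_zero add_lessD1 Suc_lessD)

text \<open>An open path from a source to a node of the optimal set outside \<open>Z\<close> continues along a causal path
  to the targets. The result is a proper path that \<open>Z\<close> fails to block, and it is non-causal because
  the optimal set contains no forbidden node.\<close>

lemma optimal_set_separated_proper:
  assumes q: "definite_status G q" "hd q \<in> X" "set (tl q) \<inter> X = {}" "last q \<in> O_set - Z"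
  shows "blocked G Z q"
proof (rule ccontr)
  assume open_q: "\<not> blocked G Z q"
  define n where "n = length q - 1"
  have gq: "gpath G q" using q by (simp add: definite_status_def)
  have lq: "length q = Suc n" using gq by (cases q) (auto simp: n_def gpath_def)
  have q0: "q ! 0 \<in> X" using q(2) gq by (simp add: hd_conv_nth gpath_def)
  define ov where "ov = q ! n"
  have ov: "ov \<in> O_set" "ov \<notin> Z" using q(4) gq lq by (auto simp: ov_def last_conv_nth gpath_def)
  have ovX: "ov \<notin> X" and ovF: "ov \<notin> F" using ov(1) O_facts by auto
  obtain m' s where s: "s 0 = ov" "s (Suc m') \<in> Y" "\<And>j. j < Suc m' \<Longrightarrow> (s j, s (Suc j)) \<in> avoid G"
    "\<And>j. 1 \<le> j \<Longrightarrow> j \<le> Suc m' \<Longrightarrow> s j \<in> cn X Y G"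
    using ov(1) by (rule optimal_node_causal_path) blast
  define m where "m = Suc m'"
  note s_step = s(3)[folded m_def] and s_cn = s(4)[folded m_def]
  have s_neq: "s j \<noteq> s k" if "j < k" "k \<le> m" for j k
    using acyclic_seq_neq[of "dir G" m s j k] acyclic_G s_step that by blast
  have s_F: "s j \<in> F" if "1 \<le> j" "j \<le> m" for j using s_cn[OF that] cn_posscn posscn_F by blast
  have s_X: "s j \<notin> X" if "j \<le> m" for j
    using that ovX s(1) s_F[of j] X_F by (cases j) auto
  have s_Z: "s j \<notin> Z" if "j \<le> m" for j
    using that ov(2) s(1) s_F[of j] Z_facts(4) by (cases j) auto
  have s_N: "s j \<in> nodes G" if "j \<le> m" for j
    using that ov(1) O_facts(3) s(1) s_F[of j] F_nodes by (cases j) auto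
  \<comment> \<open>Leave \<open>q\<close> at its first node on the causal path, so that the result is a path.\<close>
  define A where "A k \<longleftrightarrow> k \<le> n \<and> (\<exists>j\<le>m. q ! k = s j)" for k
  define i where "i = (LEAST k. A k)"
  have "A n" using s(1) by (auto simp: A_def ov_def)
  then have "A i" unfolding i_def by (rule LeastI)
  then obtain j where j: "i \<le> n" "j \<le> m" "q ! i = s j" by (auto simp: A_def)
  have i_least: "q ! k \<noteq> s l" if "k < i" "l \<le> m" for k l
    using not_less_Least[of k A] that j(1) by (auto simp: A_def i_def)
  have i1: "1 \<le> i" using j(3) q0 s_X[OF j(2)] by (cases i) auto
  have qX: "q ! k \<notin> X" if "1 \<le> k" "k \<le> n" for k
  proof -
    have "tl q ! (k - 1) = q ! k" "k - 1 < length (tl q)" using that lq by (auto simp: nth_tl)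
    then have "q ! k \<in> set (tl q)" by (metis nth_mem)
    then show ?thesis using q(3) by blast
  qed
  define r where "r = take i q @ map s [j..<Suc m]"
  have len: "length r = i + (Suc m - j)" using j(1) lq by (simp add: r_def del: upt_Suc)
  have r_lo: "r ! k = q ! k" if "k < i" for k using that j(1) lq by (simp add: r_def nth_append)
  have r_hi: "r ! k = s (j + (k - i))" if "i \<le> k" "k < length r" for k
  proof -
    have "length (take i q) = i" using j(1) lq by simp
    moreover have "k - i < Suc m - j" using that len by linarith
    ultimately show ?thesis using that by (simp add: r_def nth_append del: upt_Suc)
  qed
  have r_le: "r ! k = q ! k" if "k \<le> i" for k
    using that r_lo[of k] r_hi[of i] j(2,3) len by (cases "k = i") auto
  have r_out: "(r ! k, r ! Suc k) \<in> dir G" if k: "i \<le> k" "Suc k < length r" for k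
  proof -
    obtain e where e: "k = i + e" using k(1) le_Suc_ex by blast
    have "r ! k = s (j + e)" "r ! Suc k = s (Suc (j + e))"
      using r_hi[of k] r_hi[of "Suc k"] k e by auto
    moreover have "j + e < m" using k(2) len e by linarith
    ultimately show ?thesis using s_step by auto
  qed
  have gr: "gpath G r"
    unfolding gpath_def
  proof (intro conjI allI impI)
    show "r \<noteq> []" using len j(2) by auto
    have "inj_on s {j..<Suc m}" by (rule linorder_inj_onI) (use s_neq in auto)
    moreover have "set (take i q) \<inter> s ` {j..<Suc m} = {}"
    proof (rule ccontr)
      assume "\<not> ?thesis"
      then obtain l where v: "s l \<in> set (take i q)" "l \<le> m" by (auto simp: less_Suc_eq_le)
      then obtain k where "k < i" "q ! k = s l" using j(1) lq by (auto simp: in_set_conv_nth)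
      then show False using i_least v by blast
    qed
    ultimately show "distinct r" using gq by (auto simp: r_def distinct_map gpath_def simp del: upt_Suc)
    show "set r \<subseteq> nodes G"
      using gq s_N by (auto simp: r_def gpath_def dest: in_set_takeD simp del: upt_Suc)
    show "adj G (r ! k) (r ! Suc k)" if "Suc k < length r" for k
    proof (cases "k < i")
      case True
      then show ?thesis using r_le[of k] r_le[of "Suc k"] gq j(1) lq by (auto simp: gpath_def)
    next
      case False
      then show ?thesis using r_out[of k] that by (auto simp: adj_def)
    qed
  qed
  have inner_q: "inner_pos q k" if "inner_pos r k" "k < i" for k
    using that j(1) lq by (auto simp: inner_pos_def)
  have coll_iff: "collider G r k \<longleftrightarrow> collider G q k" "noncollider G r k \<longleftrightarrow> noncollider G q k"
    if "inner_pos r k" "k < i" for k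
    using that inner_q[OF that] r_le[of "k - 1"] r_le[of k] r_le[of "Suc k"]
    by (auto simp: collider_def noncollider_def)
  have out_nc: "noncollider G r k" "\<not> collider G r k" if "inner_pos r k" "i \<le> k" for k
    using that r_out[of k] SG(9) by (auto simp: noncollider_def collider_def inner_pos_def)
  have ds: "definite_status G r"
    unfolding definite_status_def
  proof (intro conjI allI impI gr)
    fix k assume k: "inner_pos r k"
    show "collider G r k \<or> noncollider G r k"
    proof (cases "k < i")
      case True
      then show ?thesis using coll_iff[OF k True] q(1) inner_q[OF k True] by (auto simp: definite_status_def)
    next
      case False then show ?thesis using out_nc k by auto
    qed
  qed
  have open_r: "\<not> blocked G Z r"
  proof
    assume "blocked G Z r"
    then consider k where "noncollider G r k" "r ! k \<in> Z"
      | k where "collider G r k" "de G {r ! k} \<inter> Z = {}" by (auto simp: blocked_def)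
    then show False
    proof cases
      case 1
      then have ip: "inner_pos r k" by (simp add: noncollider_def)
      show False
      proof (cases "k < i")
        case True
        then show False using 1 coll_iff[OF ip True] r_lo open_q by (auto simp: blocked_def)
      next
        case False
        then have "r ! k = s (j + (k - i))" "j + (k - i) \<le> m"
          using r_hi[of k] ip len by (auto simp: inner_pos_def)
        then show False using 1(2) s_Z by metis
      qed
    next
      case 2
      then have ip: "inner_pos r k" by (simp add: collider_def)
      then have "k < i" using out_nc 2(1) not_less by blast
      then show False using 2 coll_iff[OF ip] r_lo open_q by (auto simp: blocked_def)
    qed
  qed
  have r_last: "last r \<in> Y" using j(2) s(2) by (simp add: r_def m_def)
  have r0: "hd r \<in> X" using r_lo[of 0] q0 i1 gr by (simp add: hd_conv_nth gpath_def)
  have tl_r: "set (tl r) \<inter> X = {}"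
  proof (rule ccontr)
    assume "\<not> ?thesis"
    then obtain v where v: "v \<in> set (tl r)" "v \<in> X" by blast
    then obtain k where "k < length (tl r)" "tl r ! k = v" by (metis in_set_conv_nth)
    then have k: "Suc k < length r" "v = r ! Suc k" by (auto simp: nth_tl)
    show False
    proof (cases "Suc k < i")
      case True
      then show False using r_lo qX[of "Suc k"] j(1) k v by auto
    next
      case False
      then have "r ! Suc k = s (j + (Suc k - i))" "j + (Suc k - i) \<le> m"
        using r_hi[of "Suc k"] k len by auto
      then show False using s_X v k by metis
    qed
  qed
  have proper: "proper_path G X Y r"
    using gr r0 r_last tl_r by (simp add: proper_path_def path_from_to_def)
  \<comment> \<open>By validity of \<open>Z\<close> the new path must be possibly causal. If \<open>q\<close> was followed to its end, this makes
    that node possibly causal. Otherwise \<open>q\<close> starts as a directed path up to the causal node where it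
    was left, and from there it either stays directed, so that its end is forbidden, or meets a
    collider with forbidden descendants only, which \<open>Z\<close> blocks.\<close>
  have pc: "poss_causal_path G r"
    using blocked_Z[OF proper _ ds] open_r gr by (auto simp: noncausal_path_def)
  have i_len: "i < length r" using len j(2) by simp
  show False
  proof (cases "j = 0")
    case True
    then have "r ! i = ov" using r_le[of i] j(3) s(1) by simp
    then have "ov \<in> set r" using i_len by (metis nth_mem)
    then have "ov \<in> posscn X Y G" using proper pc ovX unfolding posscn_def by blast
    then show False using ovF posscn_F by blast
  next
    case False
    then have qi: "q ! i \<in> posscn X Y G" using s_cn[of j] j cn_posscn by auto
    obtain D where D: "D \<in> DAG_class G" using class_nonempty by blast
    have qiF: "v \<in> F" if "(q ! i, v) \<in> (dir G)\<^sup>*" for v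
      using descendants_F[OF D qi] dir_rtrancl_D[OF D that] by blast
    have steps: "(q ! k, q ! Suc k) \<in> dir G \<and> (i \<le> k \<longrightarrow> (q ! i, q ! k) \<in> (dir G)\<^sup>*)" if "k < n" for k
      using that
    proof (induction k)
      case 0
      have "(r ! 0, r ! 1) \<in> dir G"
        using source_edge[OF proper pc, of 1] gr i1 i_len by (auto simp: gpath_def)
      then show ?case using r_le[of 0] r_le[of 1] i1 by auto
    next
      case (Suc k)
      have ip: "inner_pos q (Suc k)" using Suc.prems lq by (simp add: inner_pos_def)
      have IH: "(q ! k, q ! Suc k) \<in> dir G" "i \<le> k \<longrightarrow> (q ! i, q ! k) \<in> (dir G)\<^sup>*" using Suc by auto
      have reach: "(q ! i, q ! Suc k) \<in> (dir G)\<^sup>*" if "i \<le> Suc k"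
      proof (cases "i = Suc k")
        case False
        then have "i \<le> k" using that by simp
        then show ?thesis using IH by (auto intro: rtrancl_into_rtrancl)
      qed simp
      have "\<not> collider G q (Suc k)"
      proof
        assume col: "collider G q (Suc k)"
        show False
        proof (cases "Suc k < i")
          case True
          then have "(r ! Suc (Suc k), r ! Suc k) \<in> dir G"
            using col r_le[of "Suc (Suc k)"] r_le[of "Suc k"] by (auto simp: collider_def)
          then show False using pc i_len True by (auto simp: poss_causal_path_def)
        next
          case False
          have "de G {q ! Suc k} \<inter> Z \<noteq> {}" using col open_q by (auto simp: blocked_def)
          then obtain z where z: "z \<in> Z" "(q ! Suc k, z) \<in> (dir G)\<^sup>*"
            unfolding de_iff[OF PDAG_G, abs_def] using de_iff[OF PDAG_G] by blast
          then have "z \<in> F" using qiF reach False by (meson not_less rtrancl_trans)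
          then show False using z(1) Z_facts(4) by blast
        qed
      qed
      then show ?case using noncollider_next[OF q(1) ip] IH(1) reach by simp
    qed
    have "i \<noteq> n" using s_neq[of 0 j] j s(1) False by (auto simp: ov_def)
    then have "(q ! i, q ! n) \<in> (dir G)\<^sup>*" using seq_rtrancl[of i n "\<lambda>k. q ! k" "dir G"] steps j(1) by auto
    then show False using qiF ovF by (auto simp: ov_def)
  qed
qed

lemma optimal_set_separated:
  assumes q: "definite_status G q" "hd q \<in> X" "last q \<in> O_set - Z"
  shows "blocked G Z q"
proof -
  have gq: "gpath G q" using q by (simp add: definite_status_def)
  then obtain ys x zs where q': "q = ys @ x # zs" "x \<in> X" "set zs \<inter> X = {}"
    using q(2) by (rule proper_path_last_source)
  have d: "drop (length ys) q = x # zs" by (simp add: q')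
  have "definite_status G (x # zs)"
    using definite_status_drop[OF q(1), of "length ys"] unfolding d by (simp add: q')
  moreover have "last (x # zs) \<in> O_set - Z" using q(3) by (simp add: q')
  ultimately have "blocked G Z (drop (length ys) q)"
    using optimal_set_separated_proper[of "x # zs"] q'(2,3) unfolding d by simp
  then show ?thesis by (rule blocked_drop)
qed

lemma sources_not_reached:
  assumes D: "D \<in> DAG_class G" and s: "s \<in> O_set - Z" and x: "x \<in> X"
  shows "\<not> reach D Z s x b"
proof
  assume "reach D Z s x b"
  moreover have "s \<in> nodes D" using s O_facts(3) nodes_D[OF D] by auto
  ultimately obtain p where "open_walk D Z (x # p)" "last (x # p) = s"
    using reach_open_walk PDAG_D[OF D] by metis
  then obtain q where "definite_status G q" "hd q = x" "last q = s" "\<not> blocked G Z q"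
    using open_walk_transfer[OF D] by (metis list.sel(1))
  then show False using optimal_set_separated x s by blast
qed

end


section \<open>Covariance as a bilinear form on coefficient vectors\<close>

definition supported :: "'v set \<Rightarrow> ('v \<Rightarrow> real) \<Rightarrow> bool" where
  "supported T c \<longleftrightarrow> (\<forall>i. i \<notin> T \<longrightarrow> c i = 0)"

definition unit :: "'v \<Rightarrow> 'v \<Rightarrow> real" where
  "unit i j = (if i = j then 1 else 0)"

text \<open>If \<open>S\<close> is the covariance matrix of variables indexed by \<open>N\<close>, this is the covariance of the linear
  combinations with coefficients \<open>c\<close> and \<open>d\<close>.\<close>

definition form :: "'v set \<Rightarrow> ('v \<Rightarrow> 'v \<Rightarrow> real) \<Rightarrow> ('v \<Rightarrow> real) \<Rightarrow> ('v \<Rightarrow> real) \<Rightarrow> real" where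
  "form N S c d = (\<Sum>i\<in>N. \<Sum>j\<in>N. c i * S i j * d j)"

lemma supported_mono: "supported T c \<Longrightarrow> T \<subseteq> U \<Longrightarrow> supported U c"
  by (auto simp: supported_def)

lemma supported_simps [intro]:
  "supported T c \<Longrightarrow> supported T d \<Longrightarrow> supported T (\<lambda>i. c i + d i)"
  "supported T c \<Longrightarrow> supported T d \<Longrightarrow> supported T (\<lambda>i. c i - d i)"
  "supported T c \<Longrightarrow> supported T (\<lambda>i. a * c i)"
  "t \<in> T \<Longrightarrow> supported T (unit t)"
  by (auto simp: supported_def unit_def)

lemma supported_sum: "(\<And>k. k \<in> K \<Longrightarrow> supported T (f k)) \<Longrightarrow> supported T (\<lambda>i. \<Sum>k\<in>K. a k * f k i)"
  by (auto simp: supported_def)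

lemma supported_expand:
  assumes "supported T c" "finite T"
  shows "c = (\<lambda>i. \<Sum>t\<in>T. c t * unit t i)"
proof
  fix i
  have "(\<Sum>t\<in>T. c t * unit t i) = (\<Sum>t\<in>T. if t = i then c i else 0)"
    by (rule sum.cong) (auto simp: unit_def)
  then show "c i = (\<Sum>t\<in>T. c t * unit t i)"
    using assms by (auto simp: supported_def)
qed

lemma form_add_left: "form N S (\<lambda>i. c i + d i) x = form N S c x + form N S d x"
  by (simp add: form_def algebra_simps sum.distrib)

lemma form_diff_left: "form N S (\<lambda>i. c i - d i) x = form N S c x - form N S d x"
  by (simp add: form_def algebra_simps sum_subtractf)

lemma form_scale_left: "form N S (\<lambda>i. a * c i) x = a * form N S c x"
  by (simp add: form_def sum_distrib_left mult_ac)

lemma form_sum_left: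
  "finite K \<Longrightarrow> form N S (\<lambda>i. \<Sum>k\<in>K. a k * f k i) x = (\<Sum>k\<in>K. a k * form N S (f k) x)"
proof (induction K rule: finite_induct)
  case empty then show ?case by (simp add: form_def)
next
  case (insert k K)
  then show ?case by (simp add: form_add_left form_scale_left)
qed

locale semidefinite =
  fixes N :: "'v set" and S :: "'v \<Rightarrow> 'v \<Rightarrow> real"
  assumes N: "finite N" and sym: "\<And>i j. S i j = S j i"
    and psd: "\<And>c. 0 \<le> form N S c c"
begin

abbreviation Q where "Q \<equiv> form N S"

lemma Q_sym: "Q c d = Q d c"
  unfolding form_def by (subst sum.swap) (simp add: sym mult_ac)

lemmas Q_left = form_add_left[of N S] form_diff_left[of N S] form_scale_left[of N S]

lemma Q_right:
  "Q x (\<lambda>i. c i + d i) = Q x c + Q x d" "Q x (\<lambda>i. c i - d i) = Q x c - Q x d"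
  "Q x (\<lambda>i. a * c i) = a * Q x c"
  by (simp_all add: Q_sym[of x] Q_left)

lemma Q_unit: "i \<in> N \<Longrightarrow> j \<in> N \<Longrightarrow> Q (unit i) (unit j) = S i j"
proof -
  assume i: "i \<in> N" and j: "j \<in> N"
  have "Q (unit i) (unit j) = (\<Sum>k\<in>N. if k = i then (\<Sum>l\<in>N. if l = j then S i j else 0) else 0)"
    unfolding form_def unit_def by (intro sum.cong refl) (auto intro!: sum.cong)
  then show ?thesis using i j N by simp
qed

lemma Q_expand:
  assumes "supported T c" "T \<subseteq> N"
  shows "Q c r = (\<Sum>t\<in>T. c t * Q (unit t) r)"
proof -
  have f: "finite T" using assms(2) N finite_subset by blast
  show ?thesis
    by (subst supported_expand[OF assms(1) f]) (rule form_sum_left[OF f])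
qed

lemma Q_orthogonal:
  assumes "supported T c" "T \<subseteq> N" "\<And>t. t \<in> T \<Longrightarrow> Q r (unit t) = 0"
  shows "Q r c = 0"
  using Q_expand[OF assms(1,2), of r] assms(3) Q_sym by simp

end

locale covariance = semidefinite +
  assumes definite: "\<And>c i. form N S c c = 0 \<Longrightarrow> i \<in> N \<Longrightarrow> c i = 0"

text \<open>A vector of length zero is orthogonal to everything, as moving it along another vector must not make
  the form negative. It is therefore annihilated by the matrix.\<close>

lemma (in semidefinite) nonsingular_imp_covariance:
  assumes "nonsingular_on N S" shows "covariance N S"
proof
  fix c i assume 0: "Q c c = 0" and i: "i \<in> N"
  obtain B where B: "is_inverse_on N S B" using assms by (auto simp: nonsingular_on_def)
  have row: "(\<Sum>m\<in>N. c m * S m k) = 0" if k: "k \<in> N" for k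
  proof -
    define a b where "a = Q (unit k) (unit k)" and "b = Q c (unit k)"
    have a: "0 \<le> a" unfolding a_def by (rule psd)
    \<comment> \<open>A step size that makes the quadratic \<open>2 t b + t\<^sup>2 a\<close> negative unless \<open>b = 0\<close>, even if \<open>a = 0\<close>.\<close>
    define t where "t = - b / (a + 1)"
    have "(a + 1) * t = - b" using a by (simp add: t_def)
    then have t: "b = - ((a + 1) * t)" by simp
    have "Q (\<lambda>j. c j + t * unit k j) (\<lambda>j. c j + t * unit k j) = 2 * t * b + t\<^sup>2 * a"
      unfolding Q_left(1) Q_right(1) unfolding Q_left(3) Q_right(3)
      using 0 Q_sym[of "unit k" c]
      by (simp add: a_def[symmetric] b_def[symmetric] power2_eq_square)
    then have "0 \<le> 2 * t * b + t\<^sup>2 * a" using psd[of "\<lambda>j. c j + t * unit k j"] by simp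
    also have "\<dots> = - (t\<^sup>2 * (a + 2))" unfolding t by (simp add: power2_eq_square algebra_simps)
    finally have "t\<^sup>2 * (a + 2) \<le> 0" by simp
    then have "t = 0" using a by (simp add: mult_le_0_iff)
    then have "b = 0" using t by simp
    moreover have "b = (\<Sum>m\<in>N. \<Sum>j\<in>N. if j = k then c m * S m k else 0)"
      unfolding b_def form_def unit_def by (intro sum.cong refl) auto
    ultimately show ?thesis using k N by simp
  qed
  have "c i = (\<Sum>m\<in>N. if m = i then c m else 0)" using i N by simp
  also have "\<dots> = (\<Sum>m\<in>N. c m * (\<Sum>k\<in>N. S m k * B k i))"
    by (rule sum.cong) (use B i in \<open>auto simp: is_inverse_on_def\<close>)
  also have "\<dots> = (\<Sum>k\<in>N. (\<Sum>m\<in>N. c m * S m k) * B k i)"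
    unfolding sum_distrib_left sum_distrib_right by (subst sum.swap) (simp add: mult.assoc)
  also have "\<dots> = 0" using row by simp
  finally show "c i = 0" .
qed

context covariance
begin

lemma Q_pos: "c i \<noteq> 0 \<Longrightarrow> i \<in> N \<Longrightarrow> 0 < Q c c"
  using psd[of c] definite[of c i] by linarith

text \<open>Gram-Schmidt: a new vector \<open>unit t\<close> enters through its residual \<open>r\<close> on the previous ones.\<close>

lemma projection:
  assumes "T \<subseteq> N"
  shows "\<exists>c. supported T c \<and> (\<forall>t\<in>T. Q (\<lambda>i. v i - c i) (unit t) = 0)"
proof -
  have "finite T" using assms N finite_subset by blast
  then show ?thesis using assms
  proof (induction T arbitrary: v rule: finite_induct)
    case empty
    show ?case by (rule exI[of _ "\<lambda>_. 0"]) (simp add: supported_def)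
  next
    case (insert t T)
    then have tN: "t \<in> N" "T \<subseteq> N" by auto
    obtain u where u: "supported T u" "\<And>s. s \<in> T \<Longrightarrow> Q (\<lambda>i. unit t i - u i) (unit s) = 0"
      using insert.IH[OF tN(2)] by metis
    obtain w where w: "supported T w" "\<And>s. s \<in> T \<Longrightarrow> Q (\<lambda>i. v i - w i) (unit s) = 0"
      using insert.IH[OF tN(2)] by metis
    define r where "r i = unit t i - u i" for i
    have "r t = 1" using u(1) insert.hyps(2) by (simp add: r_def supported_def unit_def)
    then have rr: "0 < Q r r" using Q_pos[of r t] tN by simp
    define a where "a = Q (\<lambda>i. v i - w i) r / Q r r"
    define c where "c i = w i + a * r i" for i
    have a: "a * Q r r = Q (\<lambda>i. v i - w i) r" using rr by (simp add: a_def)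
    have sr: "supported (insert t T) r"
      unfolding r_def using u(1) by (auto intro: supported_mono)
    have "supported (insert t T) c"
      unfolding c_def using w(1) sr by (auto intro: supported_mono)
    moreover have "Q (\<lambda>i. v i - c i) (unit s) = 0" if s: "s \<in> insert t T" for s
    proof -
      have e: "(\<lambda>i. v i - c i) = (\<lambda>i. (v i - w i) - a * r i)" by (auto simp: c_def)
      have T0: "Q (\<lambda>i. v i - c i) (unit s) = 0" if "s \<in> T" for s
        unfolding e using u(2)[OF that] w(2)[OF that]
        by (simp add: form_diff_left[of N S "\<lambda>i. v i - w i"] form_scale_left r_def)
      show ?thesis
      proof (cases "s = t")
        case True
        have "Q (\<lambda>i. v i - c i) u = 0" using Q_orthogonal[OF u(1) tN(2)] T0 by blast
        moreover have "Q (\<lambda>i. v i - c i) r = 0"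
          unfolding e by (simp add: form_diff_left[of N S "\<lambda>i. v i - w i"] form_scale_left a)
        moreover have "unit t = (\<lambda>i. r i + u i)" by (auto simp: r_def)
        ultimately show ?thesis using True by (simp add: Q_right)
      qed (use T0 s in auto)
    qed
    ultimately show ?case by blast
  qed
qed

lemma residual:
  assumes "T \<subseteq> N"
  obtains c where "supported T c" "\<And>t. t \<in> T \<Longrightarrow> Q (\<lambda>i. v i - c i) (unit t) = 0"
  using projection[OF assms, of v] by blast

text \<open>The columns of the inverse are the dual basis, obtained by scaling the residual of each unit vector on
  the others. The Gram matrix of a dual basis is the matrix of its coordinates, so it is symmetric.\<close>

lemma inverse_on_block:
  assumes T: "T \<subseteq> N"
  shows "is_inverse_on T S (inverse_on T S)"
proof -
  have "\<exists>b. supported T b \<and> (\<forall>i\<in>T. Q (unit i) b = (if i = j then 1 else 0))" if j: "j \<in> T" for j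
  proof -
    obtain u where u: "supported (T - {j}) u" "\<And>s. s \<in> T - {j} \<Longrightarrow> Q (\<lambda>i. unit j i - u i) (unit s) = 0"
      using residual[of "T - {j}" "unit j"] T by blast
    define r where "r i = unit j i - u i" for i
    have "r j = 1" using u(1) by (simp add: r_def supported_def unit_def)
    then have rr: "0 < Q r r" using Q_pos[of r j] j T by auto
    have ru: "Q r u = 0" using Q_orthogonal[OF u(1)] u(2) T unfolding r_def by blast
    have "unit j = (\<lambda>i. r i + u i)" by (auto simp: r_def)
    then have rj: "Q r (unit j) = Q r r" using ru by (simp add: Q_right)
    have "supported T r" unfolding r_def using u(1) j by (auto intro: supported_mono)
    then have "supported T (\<lambda>i. 1 / Q r r * r i)" by (rule supported_simps(3))
    moreover have "Q (unit i) (\<lambda>i. 1 / Q r r * r i) = (if i = j then 1 else 0)" if "i \<in> T" for i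
    proof -
      have "Q (unit i) (\<lambda>i. 1 / Q r r * r i) = 1 / Q r r * Q r (unit i)"
        by (simp only: Q_right Q_sym[of "unit i"])
      then show ?thesis using rj rr u(2)[of i] that by (auto simp: r_def[abs_def])
    qed
    ultimately show ?thesis by blast
  qed
  then obtain b where b: "\<And>j. j \<in> T \<Longrightarrow> supported T (b j)"
    "\<And>i j. i \<in> T \<Longrightarrow> j \<in> T \<Longrightarrow> Q (unit i) (b j) = (if i = j then 1 else 0)" by metis
  have Tf: "finite T" using T N finite_subset by blast
  have b_Q: "Q (b i) (b j) = b i j" if "i \<in> T" "j \<in> T" for i j
  proof -
    have "Q (b i) (b j) = (\<Sum>t\<in>T. b i t * Q (unit t) (b j))"
      by (rule Q_expand[OF b(1)[OF that(1)] T])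
    also have "\<dots> = (\<Sum>t\<in>T. if t = j then b i j else 0)"
      by (rule sum.cong) (use b(2)[OF _ that(2)] in auto)
    finally show ?thesis using that Tf by simp
  qed
  have b_sym: "b i j = b j i" if "i \<in> T" "j \<in> T" for i j
    using b_Q that Q_sym by metis
  have right: "(\<Sum>k\<in>T. S i k * b j k) = (if i = j then 1 else 0)" if "i \<in> T" "j \<in> T" for i j
  proof -
    have "Q (b j) (unit i) = (\<Sum>k\<in>T. b j k * S k i)"
      using Q_expand[OF b(1)[OF that(2)] T, of "unit i"] Q_unit that T by (simp add: subset_iff)
    then show ?thesis using b(2)[OF that] Q_sym[of "b j"] by (simp add: sym mult.commute)
  qed
  have "is_inverse_on T S (\<lambda>k j. b j k)"
    unfolding is_inverse_on_def
  proof (intro ballI conjI)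
    fix i j assume ij: "i \<in> T" "j \<in> T"
    show "(\<Sum>k\<in>T. S i k * b j k) = (if i = j then 1 else 0)" by (rule right[OF ij])
    have "(\<Sum>k\<in>T. b k i * S k j) = (\<Sum>k\<in>T. S j k * b i k)"
      by (rule sum.cong) (use b_sym ij sym in \<open>auto simp: mult.commute\<close>)
    then show "(\<Sum>k\<in>T. b k i * S k j) = (if i = j then 1 else 0)" using right[OF ij(2,1)] by auto
  qed
  then show ?thesis unfolding inverse_on_def by (rule someI[of "is_inverse_on T S"])
qed

text \<open>By the normal equations, multiplying the row of \<open>i\<close> by the inverse gives the regression coefficients, so
  the conditional covariance is the variance that regression on \<open>T\<close> leaves.\<close>

lemma cond_cov_residual:
  assumes T: "T \<subseteq> N" and i: "i \<in> N" and c: "supported T c"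
    and orth: "\<And>t. t \<in> T \<Longrightarrow> Q (\<lambda>j. unit i j - c j) (unit t) = 0"
  shows "cond_cov S T i i = Q (\<lambda>j. unit i j - c j) (\<lambda>j. unit i j - c j)"
proof -
  let ?B = "inverse_on T S"
  have Tf: "finite T" using T N finite_subset by blast
  have inv: "(\<Sum>k\<in>T. S m k * ?B k l) = (if m = l then 1 else 0)" if "m \<in> T" "l \<in> T" for m l
    using inverse_on_block[OF T] that by (auto simp: is_inverse_on_def)
  have S_c: "S i t = (\<Sum>m\<in>T. c m * S m t)" if t: "t \<in> T" for t
  proof -
    have "Q c (unit t) = (\<Sum>m\<in>T. c m * S m t)"
      using Q_expand[OF c T, of "unit t"] Q_unit t T by (simp add: subset_iff)
    then show ?thesis using orth[OF t] Q_unit[OF i, of t] t T by (auto simp: Q_left)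
  qed
  have l: "(\<Sum>k\<in>T. S i k * ?B k l) = c l" if l: "l \<in> T" for l
  proof -
    have "(\<Sum>k\<in>T. S i k * ?B k l) = (\<Sum>k\<in>T. \<Sum>m\<in>T. c m * (S m k * ?B k l))"
      by (rule sum.cong) (simp_all add: S_c sum_distrib_right mult.assoc)
    also have "\<dots> = (\<Sum>m\<in>T. c m * (\<Sum>k\<in>T. S m k * ?B k l))"
      by (subst sum.swap) (simp add: sum_distrib_left)
    also have "\<dots> = (\<Sum>m\<in>T. if m = l then c m else 0)"
      by (rule sum.cong) (use inv l in auto)
    also have "\<dots> = c l" using l Tf by simp
    finally show ?thesis .
  qed
  have "(\<Sum>k\<in>T. \<Sum>l\<in>T. S i k * ?B k l * S l i) = (\<Sum>l\<in>T. (\<Sum>k\<in>T. S i k * ?B k l) * S l i)"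
    by (subst sum.swap) (simp add: sum_distrib_right)
  also have "\<dots> = (\<Sum>l\<in>T. c l * S l i)" using l by simp
  also have "\<dots> = Q c (unit i)"
    using Q_expand[OF c T, of "unit i"] Q_unit[OF _ i] T by (simp add: subset_iff)
  finally have "cond_cov S T i i = Q (\<lambda>j. unit i j - c j) (unit i)"
    using Q_unit[OF i i] by (simp add: cond_cov_def Q_left)
  moreover have "Q (\<lambda>j. unit i j - c j) c = 0" using Q_orthogonal[OF c T] orth by blast
  ultimately show ?thesis by (simp only: Q_right)
qed

lemma cond_cov_nonneg:
  assumes "T \<subseteq> N" "i \<in> N" shows "0 \<le> cond_cov S T i i"
  using residual[OF assms(1), of "unit i"] cond_cov_residual[OF assms] psd by metis

lemma cond_cov_pos:
  assumes "T \<subseteq> N" "i \<in> N" "i \<notin> T" shows "0 < cond_cov S T i i"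
proof -
  obtain c where c: "supported T c" "\<And>t. t \<in> T \<Longrightarrow> Q (\<lambda>j. unit i j - c j) (unit t) = 0"
    using residual[OF assms(1), of "unit i"] by blast
  have "unit i i - c i = 1" using c(1) assms(3) by (simp add: supported_def unit_def)
  then show ?thesis
    using cond_cov_residual[OF assms(1,2) c] Q_pos[of "\<lambda>j. unit i j - c j" i] assms(2) by simp
qed

text \<open>The residual of \<open>y\<close> on \<open>T\<close> is the error plus a combination of variables in \<open>B\<close> and \<open>T\<close>. The two parts are
  uncorrelated, so their variances add, and the second one vanishes only if regression on \<open>T\<close>
  reproduces the combination \<open>g\<close>.\<close>

lemma regression_with_error:
  assumes N': "B \<subseteq> N" "T \<subseteq> N" "y \<in> N" and g: "supported B g"
    and y: "unit y = (\<lambda>i. g i + e i)" and e: "\<And>v. v \<in> B \<union> T \<Longrightarrow> Q e (unit v) = 0"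
  shows "cond_cov S B y y \<le> cond_cov S T y y"
    and "cond_cov S B y y = cond_cov S T y y \<Longrightarrow> supported T g"
proof -
  obtain c where c: "supported T c" "\<And>t. t \<in> T \<Longrightarrow> Q (\<lambda>j. unit y j - c j) (unit t) = 0"
    using residual[OF N'(2), of "unit y"] by blast
  have eB: "e = (\<lambda>j. unit y j - g j)" using y by auto
  have B: "cond_cov S B y y = Q e e"
    using cond_cov_residual[OF N'(1,3) g] e unfolding eB by auto
  define d where "d i = g i - c i" for i
  have sd: "supported (B \<union> T) d"
    unfolding d_def using g c(1) by (auto intro: supported_mono)
  have ed: "Q e d = 0" using Q_orthogonal[OF sd] N' e by auto
  have "(\<lambda>j. unit y j - c j) = (\<lambda>j. e j + d j)" by (auto simp: eB d_def)
  then have T: "cond_cov S T y y = Q e e + Q d d"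
    using cond_cov_residual[OF N'(2,3) c] ed Q_sym[of d e] by (simp add: Q_left Q_right)
  show "cond_cov S B y y \<le> cond_cov S T y y" using B T psd[of d] by simp
  show "supported T g" if "cond_cov S B y y = cond_cov S T y y"
  proof -
    have "Q d d = 0" using that B T by simp
    then have "d i = 0" if "i \<in> N" for i using definite that by blast
    then have "g i = c i" for i using sd N' by (cases "i \<in> N") (auto simp: d_def supported_def)
    then show ?thesis using c(1) by (simp add: supported_def)
  qed
qed

text \<open>The residual of \<open>x\<close> on \<open>Z\<close> and the rest of \<open>X\<close> is formed from \<open>X\<close> and \<open>Z\<close>, so it is orthogonal to each
  variable of \<open>W\<close> minus its regression on \<open>Z\<close>, and hence to \<open>W\<close>. It is thus an orthogonal component of
  the residual of \<open>x\<close> on \<open>W\<close> and the rest of \<open>X\<close>.\<close>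

lemma regression_without_gain:
  assumes N': "X \<subseteq> N" "Z \<subseteq> N" "W \<subseteq> N" "x \<in> X"
    and sep: "\<And>w. w \<in> W - Z \<Longrightarrow> \<exists>b. supported Z b \<and> (\<forall>v\<in>X \<union> Z. Q (\<lambda>i. unit w i - b i) (unit v) = 0)"
  shows "cond_cov S (X - {x} \<union> Z) x x \<le> cond_cov S (X - {x} \<union> W) x x"
proof -
  let ?T = "X - {x} \<union> Z" and ?U = "X - {x} \<union> W"
  have sub: "?T \<subseteq> N" "?U \<subseteq> N" "x \<in> N" using N' by auto
  obtain c where c: "supported ?T c" "\<And>t. t \<in> ?T \<Longrightarrow> Q (\<lambda>j. unit x j - c j) (unit t) = 0"
    using residual[OF sub(1), of "unit x"] by blast
  obtain d where d: "supported ?U d" "\<And>t. t \<in> ?U \<Longrightarrow> Q (\<lambda>j. unit x j - d j) (unit t) = 0"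
    using residual[OF sub(2), of "unit x"] by blast
  define r where "r j = unit x j - c j" for j
  have rT: "Q r (unit t) = 0" if "t \<in> ?T" for t using c(2)[OF that] by (simp add: r_def[abs_def])
  have rs: "supported (X \<union> Z) r"
    unfolding r_def using c(1) N'(4) by (auto intro: supported_mono)
  have rW: "Q r (unit w) = 0" if w: "w \<in> W" for w
  proof (cases "w \<in> Z")
    case True then show ?thesis using rT by simp
  next
    case False
    then obtain b where b: "supported Z b" "\<And>v. v \<in> X \<union> Z \<Longrightarrow> Q (\<lambda>i. unit w i - b i) (unit v) = 0"
      using sep w by blast
    have "Q r b = 0" using Q_orthogonal[OF b(1) N'(2)] rT by simp
    moreover have "Q (\<lambda>i. unit w i - b i) r = 0" using Q_orthogonal[OF rs] b(2) N' by blast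
    ultimately show ?thesis by (simp add: Q_left Q_sym[of r])
  qed
  define k where "k j = c j - d j" for j
  have ks: "supported (X - {x} \<union> Z \<union> W) k"
    unfolding k_def using c(1) d(1) by (auto intro: supported_mono)
  have rk: "Q r k = 0" using Q_orthogonal[OF ks] sub rT rW by auto
  have "(\<lambda>j. unit x j - d j) = (\<lambda>j. r j + k j)" by (auto simp: r_def k_def)
  then have "cond_cov S ?U x x = Q r r + Q k k"
    using cond_cov_residual[OF sub(2,3) d] rk Q_sym[of k r] by (simp add: Q_left Q_right)
  moreover have "cond_cov S ?T x x = Q r r"
    using cond_cov_residual[OF sub(1,3) c] by (simp add: r_def[abs_def])
  ultimately show ?thesis using psd[of k] by simp
qed

end


section \<open>Linear structural equations\<close>

locale structural_equations = covariance N S for N :: "'v set" and S +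
  fixes E :: "('v \<times> 'v) set" and \<alpha> :: "'v \<Rightarrow> 'v \<Rightarrow> real"
  assumes E: "E \<subseteq> N \<times> N" "acyclic E"
begin

text \<open>The coefficient vector of the error in the structural equation of a node.\<close>

definition err :: "'v \<Rightarrow> 'v \<Rightarrow> real" where
  "err i j = unit i j - (\<Sum>k\<in>{k. (k, i) \<in> E}. \<alpha> i k * unit k j)"

lemma wf_E: "wf E"
  using E N by (auto intro: finite_acyclic_wf finite_subset)

lemma err_self: "err i i = 1"
proof -
  have "(i, i) \<notin> E" using E(2) by (auto simp: acyclic_def)
  then have "(\<Sum>k\<in>{k. (k, i) \<in> E}. \<alpha> i k * unit k i) = 0"
    by (intro sum.neutral) (auto simp: unit_def)
  then show ?thesis by (simp add: err_def unit_def)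
qed

lemma supported_err: "insert i {k. (k, i) \<in> E} \<subseteq> T \<Longrightarrow> supported T (err i)"
  unfolding err_def[abs_def] by (intro supported_simps supported_sum) auto

lemma unit_eq: "unit i = (\<lambda>j. err i j + (\<Sum>k\<in>{k. (k, i) \<in> E}. \<alpha> i k * unit k j))"
  by (auto simp: err_def)

text \<open>Substituting structural equations into each other, all the way up.\<close>

lemma ancestral_expansion:
  assumes "v \<in> N"
  shows "\<exists>b. unit v = (\<lambda>i. \<Sum>j\<in>N. b j * err j i) \<and> (\<forall>j. b j \<noteq> 0 \<longrightarrow> (j, v) \<in> E\<^sup>*)"
  using assms
proof (induction v rule: wf_induct_rule[OF wf_E])
  case (1 v)
  let ?P = "{k. (k, v) \<in> E}"
  have "\<exists>b. unit k = (\<lambda>i. \<Sum>j\<in>N. b j * err j i) \<and> (\<forall>j. b j \<noteq> 0 \<longrightarrow> (j, k) \<in> E\<^sup>*)" if "k \<in> ?P" for k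
    using that E(1) 1 by blast
  then have "\<exists>b. \<forall>k\<in>?P. unit k = (\<lambda>i. \<Sum>j\<in>N. b k j * err j i) \<and> (\<forall>j. b k j \<noteq> 0 \<longrightarrow> (j, k) \<in> E\<^sup>*)"
    by (intro bchoice ballI)
  then obtain b where b: "\<And>k. k \<in> ?P \<Longrightarrow> unit k = (\<lambda>i. \<Sum>j\<in>N. b k j * err j i)"
    "\<And>k j. k \<in> ?P \<Longrightarrow> b k j \<noteq> 0 \<Longrightarrow> (j, k) \<in> E\<^sup>*" by auto
  define c where "c j = unit v j + (\<Sum>k\<in>?P. \<alpha> v k * b k j)" for j
  have "unit v i = (\<Sum>j\<in>N. c j * err j i)" for i
  proof -
    have "(\<Sum>k\<in>?P. \<alpha> v k * unit k i) = (\<Sum>k\<in>?P. \<Sum>j\<in>N. \<alpha> v k * b k j * err j i)"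
    proof (rule sum.cong[OF refl])
      fix k assume "k \<in> ?P"
      from fun_cong[OF b(1)[OF this], of i]
      show "\<alpha> v k * unit k i = (\<Sum>j\<in>N. \<alpha> v k * b k j * err j i)"
        by (simp add: sum_distrib_left mult.assoc)
    qed
    also have "\<dots> = (\<Sum>j\<in>N. (\<Sum>k\<in>?P. \<alpha> v k * b k j) * err j i)"
      by (subst sum.swap) (simp add: sum_distrib_right)
    finally have 1: "(\<Sum>k\<in>?P. \<alpha> v k * unit k i) = (\<Sum>j\<in>N. (\<Sum>k\<in>?P. \<alpha> v k * b k j) * err j i)" .
    have "(\<Sum>j\<in>N. unit v j * err j i) = (\<Sum>j\<in>N. if j = v then err v i else 0)"
      by (rule sum.cong) (auto simp: unit_def)
    then have "(\<Sum>j\<in>N. unit v j * err j i) = err v i" using N \<open>v \<in> N\<close> by simp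
    then show ?thesis
      using 1 fun_cong[OF unit_eq[of v], of i] by (simp add: c_def algebra_simps sum.distrib)
  qed
  moreover have "(j, v) \<in> E\<^sup>*" if "c j \<noteq> 0" for j
  proof (cases "j = v")
    case False
    then have "(\<Sum>k\<in>?P. \<alpha> v k * b k j) \<noteq> 0" using that by (auto simp: c_def unit_def)
    then obtain k where "k \<in> ?P" "\<alpha> v k * b k j \<noteq> 0"
      by (rule sum.not_neutral_contains_not_neutral)
    then show ?thesis using b(2) by (auto intro: rtrancl_into_rtrancl)
  qed simp
  ultimately show ?case by blast
qed

text \<open>The same substitution, stopped at \<open>B\<close>.\<close>

lemma closed_expansion:
  assumes "C \<subseteq> N" "B \<inter> C = {}" and pa: "\<And>c k. c \<in> C \<Longrightarrow> (k, c) \<in> E \<Longrightarrow> k \<in> C \<union> B"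
    and "v \<in> C"
  shows "\<exists>g d. supported B g \<and> unit v = (\<lambda>i. g i + (\<Sum>c\<in>C. d c * err c i))"
  using assms(4)
proof (induction v rule: wf_induct_rule[OF wf_E])
  case (1 v)
  let ?P = "{k. (k, v) \<in> E}"
  have Cf: "finite C" using assms(1) N finite_subset by blast
  have "\<exists>g d. supported B g \<and> unit k = (\<lambda>i. g i + (\<Sum>c\<in>C. d c * err c i))" if k: "k \<in> ?P" for k
  proof (cases "k \<in> C")
    case True then show ?thesis using 1 k by blast
  next
    case False
    then have "k \<in> B" using pa 1(2) k by blast
    then show ?thesis by (intro exI[of _ "unit k"] exI[of _ "\<lambda>_. 0"]) auto
  qed
  then have "\<exists>g. \<forall>k\<in>?P. \<exists>d. supported B (g k) \<and> unit k = (\<lambda>i. g k i + (\<Sum>c\<in>C. d c * err c i))"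
    by (intro bchoice ballI)
  then obtain g where g: "\<forall>k\<in>?P. \<exists>d. supported B (g k) \<and> unit k = (\<lambda>i. g k i + (\<Sum>c\<in>C. d c * err c i))"
    by blast
  then have "\<exists>d. \<forall>k\<in>?P. supported B (g k) \<and> unit k = (\<lambda>i. g k i + (\<Sum>c\<in>C. d k c * err c i))"
    by (rule bchoice)
  then obtain d where gd: "\<And>k. k \<in> ?P \<Longrightarrow> supported B (g k)"
    "\<And>k. k \<in> ?P \<Longrightarrow> unit k = (\<lambda>i. g k i + (\<Sum>c\<in>C. d k c * err c i))" by auto
  define g' where "g' i = (\<Sum>k\<in>?P. \<alpha> v k * g k i)" for i
  define d' where "d' c = unit v c + (\<Sum>k\<in>?P. \<alpha> v k * d k c)" for c
  have "supported B g'" unfolding g'_def by (rule supported_sum) (use gd in auto)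
  moreover have "unit v i = g' i + (\<Sum>c\<in>C. d' c * err c i)" for i
  proof -
    have "(\<Sum>k\<in>?P. \<alpha> v k * unit k i) = (\<Sum>k\<in>?P. \<alpha> v k * g k i + (\<Sum>c\<in>C. \<alpha> v k * d k c * err c i))"
    proof (rule sum.cong[OF refl])
      fix k assume "k \<in> ?P"
      from fun_cong[OF gd(2)[OF this], of i]
      show "\<alpha> v k * unit k i = \<alpha> v k * g k i + (\<Sum>c\<in>C. \<alpha> v k * d k c * err c i)"
        by (simp add: sum_distrib_left mult.assoc distrib_left)
    qed
    also have "\<dots> = g' i + (\<Sum>k\<in>?P. \<Sum>c\<in>C. \<alpha> v k * d k c * err c i)"
      unfolding sum.distrib g'_def ..
    also have "(\<Sum>k\<in>?P. \<Sum>c\<in>C. \<alpha> v k * d k c * err c i) = (\<Sum>c\<in>C. (\<Sum>k\<in>?P. \<alpha> v k * d k c) * err c i)"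
      by (subst sum.swap) (simp add: sum_distrib_right)
    finally have 1: "(\<Sum>k\<in>?P. \<alpha> v k * unit k i) = g' i + (\<Sum>c\<in>C. (\<Sum>k\<in>?P. \<alpha> v k * d k c) * err c i)" .
    have "(\<Sum>c\<in>C. unit v c * err c i) = (\<Sum>c\<in>C. if c = v then err v i else 0)"
      by (rule sum.cong) (auto simp: unit_def)
    then have "(\<Sum>c\<in>C. unit v c * err c i) = err v i" using Cf \<open>v \<in> C\<close> by simp
    then show ?thesis
      using 1 fun_cong[OF unit_eq[of v], of i] by (simp add: d'_def algebra_simps sum.distrib)
  qed
  ultimately show ?case by blast
qed

end

locale uncorrelated_errors = structural_equations +
  assumes uncorrelated: "\<And>i j. i \<in> N \<Longrightarrow> j \<in> N \<Longrightarrow> i \<noteq> j \<Longrightarrow> Q (err i) (err j) = 0"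
begin

lemma err_uncorrelated_nondescendant:
  assumes "j \<in> N" "v \<in> N" "(j, v) \<notin> E\<^sup>*"
  shows "Q (err j) (unit v) = 0"
proof -
  obtain b where b: "unit v = (\<lambda>i. \<Sum>k\<in>N. b k * err k i)" "\<And>k. b k \<noteq> 0 \<Longrightarrow> (k, v) \<in> E\<^sup>*"
    using ancestral_expansion[OF assms(2)] by blast
  have "b k * Q (err k) (err j) = 0" if "k \<in> N" for k
    using b(2)[of k] uncorrelated[OF that assms(1)] assms(3) by (cases "k = j") auto
  then have "Q (unit v) (err j) = 0"
    unfolding b(1) form_sum_left[OF N] by (intro sum.neutral ballI)
  then show ?thesis using Q_sym by simp
qed

lemma error_combination_uncorrelated:
  assumes "C \<subseteq> N" "v \<in> N" "\<And>c. c \<in> C \<Longrightarrow> (c, v) \<notin> E\<^sup>*"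
  shows "Q (\<lambda>i. \<Sum>c\<in>C. d c * err c i) (unit v) = 0"
proof -
  have "finite C" using assms(1) N finite_subset by blast
  then show ?thesis
    using err_uncorrelated_nondescendant assms by (auto simp: form_sum_left intro!: sum.neutral)
qed

text \<open>The linear Markov property in the form needed here. A member of \<open>A\<close> together with
  its parents either stays in \<open>M\<close> outside \<open>Z\<close>, or avoids \<open>M\<close>. The residual of a node of \<open>M\<close> on \<open>Z\<close> and \<open>A - M\<close> is
  orthogonal to the errors of the second kind, hence a combination of errors of the first kind, and
  therefore does not use \<open>A - M\<close> outside \<open>Z\<close>.\<close>

lemma separation:
  assumes A: "A \<subseteq> N" "\<And>i k. i \<in> A \<Longrightarrow> (k, i) \<in> E \<Longrightarrow> k \<in> A" "Z \<subseteq> A"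
    and M: "w \<in> M" "w \<in> A" "w \<notin> Z"
    and fam: "\<And>i. i \<in> A \<Longrightarrow> insert i {k. (k, i) \<in> E} - Z \<subseteq> M \<or> insert i {k. (k, i) \<in> E} \<inter> M = {}"
  shows "\<exists>b. supported Z b \<and> (\<forall>v\<in>(A - M) \<union> Z. Q (\<lambda>i. unit w i - b i) (unit v) = 0)"
proof -
  let ?T = "(A - M) \<union> Z"
  have TN: "?T \<subseteq> N" using A by auto
  obtain c where c: "supported ?T c" "\<And>t. t \<in> ?T \<Longrightarrow> Q (\<lambda>i. unit w i - c i) (unit t) = 0"
    using residual[OF TN, of "unit w"] by blast
  define r where "r i = unit w i - c i" for i
  have rA: "supported A r"
    unfolding r_def using c(1) M(2) A(3) by (auto intro: supported_mono)
  have Af: "finite A" using A(1) N finite_subset by blast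
  have anc: "j \<in> A" if "(j, v) \<in> E\<^sup>*" "v \<in> A" for j v
    using that A(2) by (induction rule: converse_rtrancl_induct) auto
  have "\<exists>b. unit v = (\<lambda>i. \<Sum>j\<in>N. b j * err j i) \<and> (\<forall>j. b j \<noteq> 0 \<longrightarrow> j \<in> A)" if vA: "v \<in> A" for v
  proof -
    obtain b where "unit v = (\<lambda>i. \<Sum>j\<in>N. b j * err j i)" "\<And>j. b j \<noteq> 0 \<Longrightarrow> (j, v) \<in> E\<^sup>*"
      using ancestral_expansion[of v] vA A(1) by blast
    then show ?thesis using anc vA by blast
  qed
  then have "\<exists>b. \<forall>v\<in>A. unit v = (\<lambda>i. \<Sum>j\<in>N. b v j * err j i) \<and> (\<forall>j. b v j \<noteq> 0 \<longrightarrow> j \<in> A)"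
    by (intro bchoice ballI)
  then obtain b where b: "\<And>v. v \<in> A \<Longrightarrow> unit v = (\<lambda>i. \<Sum>j\<in>N. b v j * err j i)"
    "\<And>v j. v \<in> A \<Longrightarrow> b v j \<noteq> 0 \<Longrightarrow> j \<in> A" by auto
  define \<beta> where "\<beta> j = (\<Sum>v\<in>A. r v * b v j)" for j
  have r: "r = (\<lambda>i. \<Sum>j\<in>N. \<beta> j * err j i)"
  proof
    fix i
    have "r i = (\<Sum>v\<in>A. r v * unit v i)" using fun_cong[OF supported_expand[OF rA Af]] .
    also have "\<dots> = (\<Sum>v\<in>A. \<Sum>j\<in>N. r v * b v j * err j i)"
    proof (rule sum.cong[OF refl])
      fix v assume "v \<in> A"
      from fun_cong[OF b(1)[OF this], of i]
      show "r v * unit v i = (\<Sum>j\<in>N. r v * b v j * err j i)"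
        by (simp add: sum_distrib_left mult.assoc)
    qed
    also have "\<dots> = (\<Sum>j\<in>N. \<beta> j * err j i)"
      by (subst sum.swap) (simp add: \<beta>_def sum_distrib_right)
    finally show "r i = (\<Sum>j\<in>N. \<beta> j * err j i)" .
  qed
  have \<beta>A: "j \<in> A" if "\<beta> j \<noteq> 0" for j
  proof -
    have "(\<Sum>v\<in>A. r v * b v j) \<noteq> 0" using that by (simp add: \<beta>_def)
    then obtain v where "v \<in> A" "r v * b v j \<noteq> 0"
      by (rule sum.not_neutral_contains_not_neutral)
    then show ?thesis using b(2)[of v j] by simp
  qed
  have \<beta>0: "\<beta> j = 0" if j: "j \<in> A" "insert j {k. (k, j) \<in> E} \<inter> M = {}" for j
  proof -
    have jN: "j \<in> N" using j A by auto
    have "supported ?T (err j)" by (rule supported_err) (use j A(2) in auto)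
    then have 0: "Q r (err j) = 0" using Q_orthogonal[OF _ TN] c(2) by (simp add: r_def[abs_def])
    have "Q r (err j) = (\<Sum>k\<in>N. \<beta> k * Q (err k) (err j))"
      by (subst r) (rule form_sum_left[OF N])
    also have "\<dots> = (\<Sum>k\<in>N. if k = j then \<beta> j * Q (err j) (err j) else 0)"
      by (rule sum.cong) (use uncorrelated[OF _ jN] in auto)
    also have "\<dots> = \<beta> j * Q (err j) (err j)" using N jN by simp
    finally have "Q r (err j) = \<beta> j * Q (err j) (err j)" .
    moreover have "0 < Q (err j) (err j)" using Q_pos[of "err j" j] err_self jN by simp
    ultimately show ?thesis using 0 by simp
  qed
  have cM: "c v = 0" if v: "v \<in> A" "v \<notin> M" "v \<notin> Z" for v
  proof -
    have "\<beta> j * err j v = 0" if "j \<in> N" for j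
    proof (cases "\<beta> j = 0")
      case False
      then have "j \<in> A" "insert j {k. (k, j) \<in> E} - Z \<subseteq> M" using \<beta>A \<beta>0 fam by blast+
      then have "v \<notin> insert j {k. (k, j) \<in> E}" using v by blast
      then have "err j v = 0"
        using supported_err[of j "insert j {k. (k, j) \<in> E}"] by (simp add: supported_def)
      then show ?thesis by simp
    qed simp
    then have "r v = 0" unfolding r by (simp add: sum.neutral)
    moreover have "v \<noteq> w" using v M by blast
    ultimately show ?thesis by (simp add: r_def unit_def)
  qed
  have "c v = 0" if "v \<notin> Z" for v
    using cM[of v] c(1) that by (cases "v \<in> A - M") (simp_all add: supported_def)
  then have "supported Z c" by (simp add: supported_def)
  then show ?thesis using c(2) by blast
qed

end


section \<open>Marginal densities and conditional independence\<close>

locale density_model = prob_space P + product_sigma_finite \<mu>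
  for P :: "'w measure" and \<mu> :: "'v \<Rightarrow> real measure" +
  fixes N :: "'v set" and V :: "'v \<Rightarrow> 'w \<Rightarrow> real" and f :: "('v \<Rightarrow> real) \<Rightarrow> real"
  assumes finite_N: "finite N" and sets_\<mu>[measurable_cong]: "\<And>i. sets (\<mu> i) = sets borel"
    and f_nonneg: "\<And>v. 0 \<le> f v"
    and dist: "distributed P (Pi\<^sub>M N \<mu>) (\<lambda>\<omega>. \<lambda>i\<in>N. V i \<omega>) (\<lambda>v. ennreal (f v))"
begin

definition vec :: "'v set \<Rightarrow> 'w \<Rightarrow> 'v \<Rightarrow> real" where
  "vec J \<omega> = (\<lambda>i\<in>J. V i \<omega>)"

definition mg :: "'v set \<Rightarrow> ('v \<Rightarrow> real) \<Rightarrow> ennreal" where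
  "mg J v = (\<integral>\<^sup>+ w. ennreal (f (merge J (N - J) (v, w))) \<partial>Pi\<^sub>M (N - J) \<mu>)"

lemma V_measurable: "i \<in> N \<Longrightarrow> V i \<in> borel_measurable P"
proof -
  assume i: "i \<in> N"
  have "(\<lambda>\<omega>. \<lambda>i\<in>N. V i \<omega>) \<in> measurable P (Pi\<^sub>M N \<mu>)" using dist by (simp add: distributed_def)
  from measurable_compose[OF this measurable_component_singleton[OF i]]
  have "(\<lambda>\<omega>. V i \<omega>) \<in> measurable P (\<mu> i)" using i by simp
  then show ?thesis by (simp cong: measurable_cong_sets add: sets_\<mu>)
qed

lemma vec_measurable: "J \<subseteq> N \<Longrightarrow> vec J \<in> measurable P (Pi\<^sub>M J \<mu>)"
proof -
  assume "J \<subseteq> N"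
  then have "V i \<in> measurable P (\<mu> i)" if "i \<in> J" for i
    using V_measurable[of i] that measurable_cong_sets[OF refl sets_\<mu>[of i], of P] by auto
  then show ?thesis unfolding vec_def[abs_def] by (rule measurable_restrict)
qed

lemma restrict_vec: "J \<subseteq> K \<Longrightarrow> restrict (vec K \<omega>) J = vec J \<omega>"
  by (auto simp: vec_def fun_eq_iff)

lemma f_measurable: "f \<in> borel_measurable (Pi\<^sub>M N \<mu>)"
proof -
  have "(\<lambda>v. enn2real (ennreal (f v))) \<in> borel_measurable (Pi\<^sub>M N \<mu>)"
    using dist by (auto simp: distributed_def intro: borel_measurable_enn2real)
  then show ?thesis by (simp add: f_nonneg)
qed

lemma f_merge_measurable:
  assumes "J \<subseteq> N"
  shows "(\<lambda>p. f (merge J (N - J) p)) \<in> borel_measurable (Pi\<^sub>M J \<mu> \<Otimes>\<^sub>M Pi\<^sub>M (N - J) \<mu>)"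
proof -
  have "J \<union> (N - J) = N" using assms by auto
  then show ?thesis
    using measurable_compose[OF measurable_merge[of J "N - J" \<mu>], of f borel] f_measurable by simp
qed

lemma finite_sub: "J \<subseteq> N \<Longrightarrow> finite J"
  using finite_N finite_subset by blast

lemma mg_measurable:
  assumes "J \<subseteq> N" shows "mg J \<in> borel_measurable (Pi\<^sub>M J \<mu>)"
proof -
  interpret S: sigma_finite_measure "Pi\<^sub>M (N - J) \<mu>" by (rule sigma_finite) (use finite_N in auto)
  have "(\<lambda>p. ennreal (f (merge J (N - J) p))) \<in> borel_measurable (Pi\<^sub>M J \<mu> \<Otimes>\<^sub>M Pi\<^sub>M (N - J) \<mu>)"
    using f_merge_measurable[OF assms] by measurable
  from S.borel_measurable_nn_integral_fst[OF this] show ?thesis by (simp add: mg_def[abs_def])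
qed

lemma restrict_space_PiM: "x \<in> space (Pi\<^sub>M J \<mu>) \<Longrightarrow> restrict x J = x"
  by (auto simp: space_PiM PiE_iff extensional_restrict)

lemma marginal_law:
  assumes J: "J \<subseteq> N" and g: "g \<in> borel_measurable (Pi\<^sub>M J \<mu>)"
  shows "(\<integral>\<^sup>+ \<omega>. g (vec J \<omega>) \<partial>P) = (\<integral>\<^sup>+ v. mg J v * g v \<partial>Pi\<^sub>M J \<mu>)"
proof -
  have gr: "(\<lambda>v. g (restrict v J)) \<in> borel_measurable (Pi\<^sub>M N \<mu>)"
    by (rule measurable_compose[OF measurable_restrict_subset[OF J] g])
  have un: "J \<union> (N - J) = N" using J by auto
  have fm: "(\<lambda>v. ennreal (f v) * g (restrict v J)) \<in> borel_measurable (Pi\<^sub>M (J \<union> (N - J)) \<mu>)"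
    unfolding un using f_measurable gr by measurable
  have "(\<integral>\<^sup>+ \<omega>. g (vec J \<omega>) \<partial>P) = (\<integral>\<^sup>+ \<omega>. g (restrict (\<lambda>i\<in>N. V i \<omega>) J) \<partial>P)"
    using restrict_vec[OF J] by (simp add: vec_def)
  also have "\<dots> = (\<integral>\<^sup>+ v. ennreal (f v) * g (restrict v J) \<partial>Pi\<^sub>M N \<mu>)"
    by (rule distributed_nn_integral[OF dist gr, symmetric])
  also have "\<dots> = (\<integral>\<^sup>+ x. \<integral>\<^sup>+ y. ennreal (f (merge J (N - J) (x, y))) *
      g (restrict (merge J (N - J) (x, y)) J) \<partial>Pi\<^sub>M (N - J) \<mu> \<partial>Pi\<^sub>M J \<mu>)"
    using product_nn_integral_fold[OF _ _ _ fm] J finite_N finite_sub by (simp add: Un_absorb1)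
  also have "\<dots> = (\<integral>\<^sup>+ x. mg J x * g x \<partial>Pi\<^sub>M J \<mu>)"
  proof (rule nn_integral_cong)
    fix x assume x: "x \<in> space (Pi\<^sub>M J \<mu>)"
    have "(\<lambda>y. ennreal (f (merge J (N - J) (x, y)))) \<in> borel_measurable (Pi\<^sub>M (N - J) \<mu>)"
      using measurable_compose[OF measurable_Pair1'[OF x] f_merge_measurable[OF J]] by simp
    then show "(\<integral>\<^sup>+ y. ennreal (f (merge J (N - J) (x, y))) *
        g (restrict (merge J (N - J) (x, y)) J) \<partial>Pi\<^sub>M (N - J) \<mu>) = mg J x * g x"
      using restrict_space_PiM[OF x] by (simp add: mg_def nn_integral_multc)
  qed
  finally show ?thesis .
qed

text \<open>The preimage of a null set under restriction is null by Fubini, although the image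
  of a product measure of infinite mass need not be sigma-finite.\<close>

lemma AE_restrict:
  assumes J: "J \<subseteq> K" "finite K" and R: "AE v in Pi\<^sub>M J \<mu>. R v"
  shows "AE v in Pi\<^sub>M K \<mu>. R (restrict v J)"
proof -
  obtain A where A: "A \<in> null_sets (Pi\<^sub>M J \<mu>)" "{v \<in> space (Pi\<^sub>M J \<mu>). \<not> R v} \<subseteq> A"
    using R unfolding eventually_ae_filter by blast
  have fin: "finite J" using J finite_subset by blast
  have As: "A \<in> sets (Pi\<^sub>M J \<mu>)" using A by auto
  define B where "B = (\<lambda>v. restrict v J) -` A \<inter> space (Pi\<^sub>M K \<mu>)"
  have rm: "(\<lambda>v. restrict v J) \<in> measurable (Pi\<^sub>M K \<mu>) (Pi\<^sub>M J \<mu>)"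
    by (rule measurable_restrict_subset[OF J(1)])
  have B: "B \<in> sets (Pi\<^sub>M K \<mu>)" unfolding B_def by (rule measurable_sets[OF rm As])
  have un: "J \<union> (K - J) = K" using J by auto
  have fm: "(\<lambda>v. indicator A (restrict v J) :: ennreal) \<in> borel_measurable (Pi\<^sub>M (J \<union> (K - J)) \<mu>)"
    unfolding un by (rule measurable_compose[OF rm]) (use As in simp)
  have "emeasure (Pi\<^sub>M K \<mu>) B = (\<integral>\<^sup>+ v. indicator A (restrict v J) \<partial>Pi\<^sub>M K \<mu>)"
    unfolding nn_integral_indicator[OF B, symmetric]
    by (rule nn_integral_cong) (auto simp: B_def indicator_def)
  also have "\<dots> = (\<integral>\<^sup>+ x. \<integral>\<^sup>+ y. indicator A (restrict (merge J (K - J) (x, y)) J)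
      \<partial>Pi\<^sub>M (K - J) \<mu> \<partial>Pi\<^sub>M J \<mu>)"
    using product_nn_integral_fold[OF _ _ _ fm] J fin by (simp add: Un_absorb1)
  also have "\<dots> = (\<integral>\<^sup>+ x. 0 \<partial>Pi\<^sub>M J \<mu>)"
    using AE_not_in[OF A(1)] by (intro nn_integral_cong_AE) (auto simp: restrict_space_PiM)
  finally have "B \<in> null_sets (Pi\<^sub>M K \<mu>)" using B by auto
  moreover have "{v \<in> space (Pi\<^sub>M K \<mu>). \<not> R (restrict v J)} \<subseteq> B"
    using A(2) measurable_space[OF rm] by (auto simp: B_def)
  ultimately show ?thesis unfolding eventually_ae_filter by blast
qed

lemma mg_finite:
  assumes "J \<subseteq> N" shows "AE v in Pi\<^sub>M J \<mu>. mg J v \<noteq> \<infinity>"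
proof (rule nn_integral_PInf_AE[OF mg_measurable[OF assms]])
  have "(\<integral>\<^sup>+ v. mg J v \<partial>Pi\<^sub>M J \<mu>) = 1"
    using marginal_law[OF assms, of "\<lambda>_. 1"] emeasure_space_1 by simp
  then show "integral\<^sup>N (Pi\<^sub>M J \<mu>) (mg J) \<noteq> \<infinity>" by simp
qed

lemma marginal_eq:
  assumes J: "J \<subseteq> N" and v: "v \<in> space (Pi\<^sub>M N \<mu>)"
  shows "marginal N \<mu> f J v = enn2real (mg J (restrict v J))"
proof -
  have r: "restrict v J \<in> space (Pi\<^sub>M J \<mu>)"
    using measurable_space[OF measurable_restrict_subset[OF J] v] .
  have "(\<lambda>w. f (merge J (N - J) (restrict v J, w))) \<in> borel_measurable (Pi\<^sub>M (N - J) \<mu>)"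
    using measurable_compose[OF measurable_Pair1'[OF r] f_merge_measurable[OF J]] by simp
  then show ?thesis
    unfolding marginal_def mg_def using f_nonneg by (simp add: integral_eq_nn_integral)
qed

text \<open>The reference measures are arbitrary, so the law of the noise gives no density formula. It enters only
  as the common kernel that turns the marginal densities of \<open>T\<close> and of \<open>U \<union> T\<close> into the joint laws with
  \<open>V y\<close>; comparing the two sides of the factorization on product sets then suffices.
  The weight \<open>q\<close> keeps the compared measures finite where the density of \<open>T\<close> degenerates.\<close>

lemma cond_indep_additive_noise:
  assumes y: "y \<in> N" "y \<notin> U \<union> T" and UT: "U \<subseteq> N" "T \<subseteq> N"
    and h: "h \<in> borel_measurable (Pi\<^sub>M T \<mu>)" and noise: "noise \<in> borel_measurable P"
    and Vy: "AE \<omega> in P. V y \<omega> = h (vec T \<omega>) + noise \<omega>"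
    and joint: "\<And>g. g \<in> borel_measurable (borel \<Otimes>\<^sub>M Pi\<^sub>M (U \<union> T) \<mu>) \<Longrightarrow>
      (\<integral>\<^sup>+ \<omega>. g (noise \<omega>, vec (U \<union> T) \<omega>) \<partial>P) =
      (\<integral>\<^sup>+ \<omega>. (\<integral>\<^sup>+ u. g (u, vec (U \<union> T) \<omega>) \<partial>distr P borel noise) \<partial>P)"
  shows "cond_indep N \<mu> f {y} U T"
proof -
  define K where "K = U \<union> T"
  define J where "J = insert y K"
  define J' where "J' = insert y T"
  have sub: "T \<subseteq> K" "K \<subseteq> N" "J \<subseteq> N" "J' \<subseteq> N" "T \<subseteq> J" "K \<subseteq> J" "J' \<subseteq> J" "T \<subseteq> J'" "T \<subseteq> N"
    using y UT by (auto simp: K_def J_def J'_def)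
  have yK: "y \<notin> K" "y \<notin> T" using y by (auto simp: K_def)
  note fins = finite_sub[OF sub(2)] finite_sub[OF sub(3)] finite_sub[OF sub(4)] finite_sub[OF UT(2)]
  note Vm[measurable] = V_measurable[OF y(1)]
  note [measurable] = h noise vec_measurable[OF sub(2)] vec_measurable[OF UT(2)] vec_measurable[OF sub(3)]
    vec_measurable[OF sub(4)] mg_measurable[OF sub(2)] mg_measurable[OF sub(3)] mg_measurable[OF sub(4)]
    mg_measurable[OF UT(2)] measurable_restrict_subset[OF sub(1), of \<mu>] measurable_restrict_subset[OF sub(5), of \<mu>]
    measurable_restrict_subset[OF sub(6), of \<mu>] measurable_restrict_subset[OF sub(7), of \<mu>]
    measurable_restrict_subset[OF sub(8), of \<mu>]
  let ?D = "distr P borel noise"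
  interpret D: prob_space ?D by (rule prob_space_distr) measurable
  define \<kappa> where "\<kappa> B x = (\<integral>\<^sup>+ u. indicator B (h x + u) \<partial>?D)" for B :: "real set" and x
  have \<kappa>m: "\<kappa> B \<in> borel_measurable (Pi\<^sub>M T \<mu>)" if B[measurable]: "B \<in> sets borel" for B
    unfolding \<kappa>_def[abs_def] by measurable
  have kernel: "(\<integral>\<^sup>+ \<omega>. g (vec K \<omega>) * indicator B (V y \<omega>) \<partial>P) = (\<integral>\<^sup>+ \<omega>. g (vec K \<omega>) * \<kappa> B (vec T \<omega>) \<partial>P)"
    if g[measurable]: "g \<in> borel_measurable (Pi\<^sub>M K \<mu>)" and B[measurable]: "B \<in> sets borel" for g and B :: "real set"
  proof -
    let ?G = "\<lambda>(u, x). g x * indicator B (h (restrict x T) + u)"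
    have G: "?G \<in> borel_measurable (borel \<Otimes>\<^sub>M Pi\<^sub>M (U \<union> T) \<mu>)"
      unfolding K_def[symmetric] by measurable
    have "(\<integral>\<^sup>+ \<omega>. g (vec K \<omega>) * indicator B (V y \<omega>) \<partial>P) = (\<integral>\<^sup>+ \<omega>. ?G (noise \<omega>, vec K \<omega>) \<partial>P)"
      using Vy by (intro nn_integral_cong_AE) (auto simp: restrict_vec[OF sub(1)])
    also have "\<dots> = (\<integral>\<^sup>+ \<omega>. (\<integral>\<^sup>+ u. ?G (u, vec K \<omega>) \<partial>?D) \<partial>P)"
      using joint[OF G] by (simp add: K_def)
    also have "\<dots> = (\<integral>\<^sup>+ \<omega>. g (vec K \<omega>) * \<kappa> B (vec T \<omega>) \<partial>P)"
      by (intro nn_integral_cong) (simp add: restrict_vec[OF sub(1)] \<kappa>_def nn_integral_cmult)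
    finally show ?thesis .
  qed
  have upd_restrict: "restrict (x(y := t)) T = restrict x T" "restrict (x(y := t)) K = restrict x K"
    "restrict (x(y := t)) J' = (restrict x T)(y := t)" for x :: "'v \<Rightarrow> real" and t
    using yK by (auto simp: J'_def fun_eq_iff)
  have upd: "(\<lambda>p. (fst p)(y := snd p)) \<in> measurable (Pi\<^sub>M T \<mu> \<Otimes>\<^sub>M \<mu> y) (Pi\<^sub>M J' \<mu>)"
    by (rule measurable_fun_upd[of _ T]) (auto simp: J'_def)
  have upd_m: "(\<lambda>t. mg J' (x(y := t)) * indicator B t) \<in> borel_measurable (\<mu> y)"
    if x: "x \<in> space (Pi\<^sub>M T \<mu>)" and B: "B \<in> sets borel" for x and B :: "real set"
  proof (rule borel_measurable_times_ennreal)
    have "(\<lambda>t. x(y := t)) \<in> measurable (\<mu> y) (Pi\<^sub>M J' \<mu>)"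
      using measurable_compose[OF measurable_Pair1'[OF x] upd] by simp
    then show "(\<lambda>t. mg J' (x(y := t))) \<in> borel_measurable (\<mu> y)"
      by (rule measurable_compose[OF _ mg_measurable[OF sub(4)]])
    show "indicator B \<in> borel_measurable (\<mu> y)" using B sets_\<mu> by simp
  qed
  have slice: "AE x in Pi\<^sub>M T \<mu>. mg T x * \<kappa> B x = (\<integral>\<^sup>+ t. mg J' (x(y := t)) * indicator B t \<partial>\<mu> y)"
    if B[measurable]: "B \<in> sets borel" for B :: "real set"
  proof -
    interpret T: sigma_finite_measure "Pi\<^sub>M T \<mu>" by (rule sigma_finite[OF fins(4)])
    note [measurable] = \<kappa>m[OF B]
    note [measurable] = upd
    show ?thesis
    proof (rule T.density_unique2)
      show "(\<lambda>x. mg T x * \<kappa> B x) \<in> borel_measurable (Pi\<^sub>M T \<mu>)" by measurable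
      have "(\<lambda>p. mg J' ((fst p)(y := snd p)) * indicator B (snd p)) \<in> borel_measurable (Pi\<^sub>M T \<mu> \<Otimes>\<^sub>M \<mu> y)"
        by measurable
      from sigma_finite_measure.borel_measurable_nn_integral_fst[OF sigma_finite_measures this]
      show "(\<lambda>x. \<integral>\<^sup>+ t. mg J' (x(y := t)) * indicator B t \<partial>\<mu> y) \<in> borel_measurable (Pi\<^sub>M T \<mu>)" by simp
      fix A assume A[measurable]: "A \<in> sets (Pi\<^sub>M T \<mu>)"
      have g: "(\<lambda>v. indicator A (restrict v T) * indicator B (v y) :: ennreal) \<in> borel_measurable (Pi\<^sub>M J' \<mu>)"
      proof -
        have [measurable]: "y \<in> J'" by (simp add: J'_def)
        show ?thesis by measurable
      qed
      have "(\<integral>\<^sup>+ x\<in>A. mg T x * \<kappa> B x \<partial>Pi\<^sub>M T \<mu>) = (\<integral>\<^sup>+ x. mg T x * (indicator A x * \<kappa> B x) \<partial>Pi\<^sub>M T \<mu>)"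
        by (simp add: mult_ac)
      also have "\<dots> = (\<integral>\<^sup>+ \<omega>. indicator A (vec T \<omega>) * \<kappa> B (vec T \<omega>) \<partial>P)"
        by (rule marginal_law[OF UT(2), symmetric]) measurable
      also have "\<dots> = (\<integral>\<^sup>+ \<omega>. indicator A (vec T \<omega>) * indicator B (V y \<omega>) \<partial>P)"
        using kernel[of "\<lambda>x. indicator A (restrict x T)" B] by (simp add: restrict_vec[OF sub(1)])
      also have "\<dots> = (\<integral>\<^sup>+ \<omega>. indicator A (restrict (vec J' \<omega>) T) * indicator B (vec J' \<omega> y) \<partial>P)"
        by (simp add: restrict_vec[OF sub(8)]) (simp add: vec_def J'_def)
      also have "\<dots> = (\<integral>\<^sup>+ v. mg J' v * (indicator A (restrict v T) * indicator B (v y)) \<partial>Pi\<^sub>M J' \<mu>)"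
        by (rule marginal_law[OF sub(4) g])
      also have "\<dots> = (\<integral>\<^sup>+ x. \<integral>\<^sup>+ t. mg J' (x(y := t)) *
          (indicator A (restrict (x(y := t)) T) * indicator B ((x(y := t)) y)) \<partial>\<mu> y \<partial>Pi\<^sub>M T \<mu>)"
        using product_nn_integral_insert[OF fins(4) yK(2),
            OF borel_measurable_times_ennreal[OF mg_measurable[OF sub(4)] g, unfolded J'_def]]
        by (simp only: J'_def)
      also have "\<dots> = (\<integral>\<^sup>+ x\<in>A. (\<integral>\<^sup>+ t. mg J' (x(y := t)) * indicator B t \<partial>\<mu> y) \<partial>Pi\<^sub>M T \<mu>)"
      proof (rule nn_integral_cong)
        fix x assume x: "x \<in> space (Pi\<^sub>M T \<mu>)"
        show "(\<integral>\<^sup>+ t. mg J' (x(y := t)) * (indicator A (restrict (x(y := t)) T) * indicator B ((x(y := t)) y)) \<partial>\<mu> y)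
          = (\<integral>\<^sup>+ t. mg J' (x(y := t)) * indicator B t \<partial>\<mu> y) * indicator A x"
          unfolding upd_restrict restrict_space_PiM[OF x]
          using upd_m[OF x B] by (subst nn_integral_multc[symmetric]) (auto simp: mult_ac)
      qed
      finally show "(\<integral>\<^sup>+ x\<in>A. mg T x * \<kappa> B x \<partial>Pi\<^sub>M T \<mu>) =
        (\<integral>\<^sup>+ x\<in>A. (\<integral>\<^sup>+ t. mg J' (x(y := t)) * indicator B t \<partial>\<mu> y) \<partial>Pi\<^sub>M T \<mu>)" .
    qed
  qed
  define q where "q x = (if mg T x = 0 \<or> mg T x = \<infinity> then 0 else inverse (mg T x))" for x
  have q_1: "q x * mg T x = (if mg T x = 0 \<or> mg T x = \<infinity> then 0 else 1)" for x
    using ennreal_divide_self[of "mg T x"] by (auto simp: q_def divide_ennreal_def mult.commute less_top)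
  have qm[measurable]: "q \<in> borel_measurable (Pi\<^sub>M T \<mu>)" unfolding q_def[abs_def] by measurable
  define F1 where "F1 v = mg J v * (q (restrict v T) * mg T (restrict v T))" for v
  define F2 where "F2 v = q (restrict v T) * (mg K (restrict v K) * mg J' (restrict v J'))" for v
  have F1m[measurable]: "F1 \<in> borel_measurable (Pi\<^sub>M J \<mu>)" unfolding F1_def[abs_def] by measurable
  have F2m[measurable]: "F2 \<in> borel_measurable (Pi\<^sub>M J \<mu>)" unfolding F2_def[abs_def] by measurable
  have "density (Pi\<^sub>M J \<mu>) F1 = density (Pi\<^sub>M J \<mu>) F2"
  proof (rule measure_eqI_PiM_finite[OF fins(2)])
    show "range (\<lambda>n::nat. Pi\<^sub>E J (\<lambda>i. space (\<mu> i))) \<subseteq> prod_algebra J \<mu>"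
      using prod_algebraI_finite[OF fins(2), of "\<lambda>i. space (\<mu> i)" \<mu>] by auto
    show "(\<Union>n::nat. Pi\<^sub>E J (\<lambda>i. space (\<mu> i))) = space (Pi\<^sub>M J \<mu>)" by (simp add: space_PiM)
    have "emeasure (density (Pi\<^sub>M J \<mu>) F1) (space (Pi\<^sub>M J \<mu>)) = (\<integral>\<^sup>+ v. F1 v \<partial>Pi\<^sub>M J \<mu>)"
      by (subst emeasure_density) (auto intro!: nn_integral_cong)
    also have "\<dots> \<le> (\<integral>\<^sup>+ v. mg J v * 1 \<partial>Pi\<^sub>M J \<mu>)"
      by (intro nn_integral_mono) (simp add: F1_def q_1)
    also have "\<dots> = 1" using marginal_law[OF sub(3), of "\<lambda>_. 1"] emeasure_space_1 by simp
    finally show "emeasure (density (Pi\<^sub>M J \<mu>) F1) (Pi\<^sub>E J (\<lambda>i. space (\<mu> i))) \<noteq> \<infinity>" for n :: nat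
      by (auto simp: space_PiM top_unique)
  next
    fix A assume A: "\<And>i. i \<in> J \<Longrightarrow> A i \<in> sets (\<mu> i)"
    define B where "B = A y"
    define R where "R = Pi\<^sub>E K A"
    have B[measurable]: "B \<in> sets borel" using A[of y] sets_\<mu> by (simp add: B_def J_def)
    have R[measurable]: "R \<in> sets (Pi\<^sub>M K \<mu>)"
      unfolding R_def by (rule sets_PiM_I_finite[OF fins(1)]) (use A in \<open>auto simp: J_def\<close>)
    have rect: "Pi\<^sub>E J A \<in> sets (Pi\<^sub>M J \<mu>)" by (rule sets_PiM_I_finite[OF fins(2) A])
    have ind: "indicator (Pi\<^sub>E J A) v = indicator R (restrict v K) * (indicator B (v y) :: ennreal)"
      if v: "v \<in> space (Pi\<^sub>M J \<mu>)" for v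
    proof -
      have "v \<in> extensional J" using v by (auto simp: space_PiM PiE_def)
      then have "v \<in> Pi\<^sub>E J A \<longleftrightarrow> restrict v K \<in> R \<and> v y \<in> B"
        by (auto simp: R_def B_def J_def PiE_iff)
      then show ?thesis by (auto simp: indicator_def)
    qed
    have yJ[measurable]: "y \<in> J" by (simp add: J_def)
    define g where "g x = q (restrict x T) * mg T (restrict x T) * indicator R x" for x
    have gm[measurable]: "g \<in> borel_measurable (Pi\<^sub>M K \<mu>)" unfolding g_def[abs_def] by measurable
    have rr: "K \<inter> T = T" using sub(1) by blast
    have "emeasure (density (Pi\<^sub>M J \<mu>) F1) (Pi\<^sub>E J A) =
      (\<integral>\<^sup>+ v. mg J v * (g (restrict v K) * indicator B (v y)) \<partial>Pi\<^sub>M J \<mu>)"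
      by (subst emeasure_density[OF F1m rect], rule nn_integral_cong)
         (simp add: ind F1_def g_def rr mult_ac)
    also have "\<dots> = (\<integral>\<^sup>+ \<omega>. g (restrict (vec J \<omega>) K) * indicator B (vec J \<omega> y) \<partial>P)"
      by (rule marginal_law[OF sub(3), symmetric]) measurable
    also have "\<dots> = (\<integral>\<^sup>+ \<omega>. g (vec K \<omega>) * indicator B (V y \<omega>) \<partial>P)"
      by (simp add: restrict_vec[OF sub(6)]) (simp add: vec_def J_def)
    also have "\<dots> = (\<integral>\<^sup>+ \<omega>. g (vec K \<omega>) * \<kappa> B (restrict (vec K \<omega>) T) \<partial>P)"
      unfolding kernel[OF gm B] restrict_vec[OF sub(1)] ..
    also have "\<dots> = (\<integral>\<^sup>+ x. mg K x * (g x * \<kappa> B (restrict x T)) \<partial>Pi\<^sub>M K \<mu>)"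
      by (intro marginal_law[OF sub(2)] borel_measurable_times_ennreal gm
          measurable_compose[OF measurable_restrict_subset[OF sub(1)] \<kappa>m[OF B]])
    finally have lhs: "emeasure (density (Pi\<^sub>M J \<mu>) F1) (Pi\<^sub>E J A) =
      (\<integral>\<^sup>+ x. mg K x * (g x * \<kappa> B (restrict x T)) \<partial>Pi\<^sub>M K \<mu>)" .
    have "emeasure (density (Pi\<^sub>M J \<mu>) F2) (Pi\<^sub>E J A) =
      (\<integral>\<^sup>+ v. F2 v * (indicator R (restrict v K) * indicator B (v y)) \<partial>Pi\<^sub>M (insert y K) \<mu>)"
      unfolding J_def[symmetric] by (subst emeasure_density[OF F2m rect], rule nn_integral_cong) (simp add: ind)
    also have "\<dots> = (\<integral>\<^sup>+ x. \<integral>\<^sup>+ t. F2 (x(y := t)) *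
        (indicator R (restrict (x(y := t)) K) * indicator B ((x(y := t)) y)) \<partial>\<mu> y \<partial>Pi\<^sub>M K \<mu>)"
    proof (rule product_nn_integral_insert[OF fins(1) yK(1)])
      have "(\<lambda>v. F2 v * (indicator R (restrict v K) * indicator B (v y))) \<in> borel_measurable (Pi\<^sub>M J \<mu>)"
        by measurable
      then show "(\<lambda>v. F2 v * (indicator R (restrict v K) * indicator B (v y))) \<in> borel_measurable (Pi\<^sub>M (insert y K) \<mu>)"
        by (simp only: J_def)
    qed
    also have "\<dots> = (\<integral>\<^sup>+ x. q (restrict x T) * mg K x * indicator R x *
        (\<integral>\<^sup>+ t. mg J' ((restrict x T)(y := t)) * indicator B t \<partial>\<mu> y) \<partial>Pi\<^sub>M K \<mu>)"
    proof (rule nn_integral_cong)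
      fix x assume x: "x \<in> space (Pi\<^sub>M K \<mu>)"
      then have xT: "restrict x T \<in> space (Pi\<^sub>M T \<mu>)"
        using measurable_space[OF measurable_restrict_subset[OF sub(1)]] by blast
      show "(\<integral>\<^sup>+ t. F2 (x(y := t)) * (indicator R (restrict (x(y := t)) K) * indicator B ((x(y := t)) y)) \<partial>\<mu> y) =
        q (restrict x T) * mg K x * indicator R x * (\<integral>\<^sup>+ t. mg J' ((restrict x T)(y := t)) * indicator B t \<partial>\<mu> y)"
        unfolding F2_def upd_restrict restrict_space_PiM[OF x]
        using upd_m[OF xT B] by (subst nn_integral_cmult[symmetric]) (auto simp: mult_ac)
    qed
    also have "\<dots> = (\<integral>\<^sup>+ x. mg K x * (g x * \<kappa> B (restrict x T)) \<partial>Pi\<^sub>M K \<mu>)"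
    proof (rule nn_integral_cong_AE)
      show "AE x in Pi\<^sub>M K \<mu>. q (restrict x T) * mg K x * indicator R x *
          (\<integral>\<^sup>+ t. mg J' ((restrict x T)(y := t)) * indicator B t \<partial>\<mu> y) =
          mg K x * (g x * \<kappa> B (restrict x T))"
        using AE_restrict[OF sub(1) fins(1) slice[OF B]]
      proof eventually_elim
        case (elim x)
        show ?case unfolding elim[symmetric] g_def by (simp only: mult_ac)
      qed
    qed
    finally show "emeasure (density (Pi\<^sub>M J \<mu>) F1) (Pi\<^sub>E J A) = emeasure (density (Pi\<^sub>M J \<mu>) F2) (Pi\<^sub>E J A)"
      using lhs by simp
  qed simp_all
  then have "AE v in Pi\<^sub>M J \<mu>. F1 v = F2 v"
    by (intro sigma_finite_measure.density_unique[OF sigma_finite[OF fins(2)]]) measurable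
  from AE_restrict[OF sub(3) finite_N this]
  have AE_F: "AE v in Pi\<^sub>M N \<mu>. F1 (restrict v J) = F2 (restrict v J)" .
  note fin_mg = AE_restrict[OF _ finite_N mg_finite]
  have sets: "{y} \<union> U \<union> T = J" "{y} \<union> T = J'" "U \<union> T = K" by (auto simp: J_def J'_def K_def)
  show ?thesis
    unfolding cond_indep_def cond_density_def sets
    using AE_F fin_mg[OF sub(2) sub(2)] fin_mg[OF sub(3) sub(3)] fin_mg[OF sub(4) sub(4)] fin_mg[OF sub(9) sub(9)] AE_space
  proof eventually_elim
    case (elim v)
    show ?case
    proof
      assume pos: "0 < marginal N \<mu> f T v"
      note M = marginal_eq[OF sub(2) elim(6)] marginal_eq[OF sub(3) elim(6)] marginal_eq[OF sub(4) elim(6)]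
        marginal_eq[OF sub(9) elim(6)]
      define a b c d where "a = mg J (restrict v J)" and "b = mg K (restrict v K)"
        and "c = mg J' (restrict v J')" and "d = mg T (restrict v T)"
      have r: "J \<inter> T = T" "J \<inter> K = K" "J \<inter> J' = J'" using sub by blast+
      have d: "d \<noteq> 0" "d \<noteq> \<infinity>" using pos M(4) elim(5) by (auto simp: d_def)
      have qd: "q (restrict v T) * d = 1" using q_1[of "restrict v T"] d by (simp add: d_def)
      have "a = q (restrict v T) * (b * c)"
        using elim(1) qd by (simp add: F1_def F2_def r a_def b_def c_def d_def)
      then have "a * d = b * c * (q (restrict v T) * d)" by (simp add: mult_ac)
      then have "a * d = b * c" using qd by simp
      then have "enn2real a * enn2real d = enn2real b * enn2real c" by (metis enn2real_mult)
      moreover have "enn2real d > 0" using pos M(4) by (simp add: d_def)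
      ultimately show "marginal N \<mu> f J v / marginal N \<mu> f T v =
        marginal N \<mu> f J' v / marginal N \<mu> f T v * (marginal N \<mu> f K v / marginal N \<mu> f T v)"
        unfolding M a_def[symmetric] b_def[symmetric] c_def[symmetric] d_def[symmetric]
        by (simp add: field_simps)
    qed
  qed
qed

end


section \<open>Second moments of a linear model\<close>

context prob_space
begin

definition square_integrable :: "('a \<Rightarrow> real) \<Rightarrow> bool" where
  "square_integrable g \<longleftrightarrow> g \<in> borel_measurable M \<and> integrable M (\<lambda>\<omega>. (g \<omega>)\<^sup>2)"

lemma square_integrable_mult:
  assumes "square_integrable g" "square_integrable h"
  shows "integrable M (\<lambda>\<omega>. g \<omega> * h \<omega>)"
proof (rule Bochner_Integration.integrable_bound)
  show "integrable M (\<lambda>\<omega>. (g \<omega>)\<^sup>2 + (h \<omega>)\<^sup>2)" using assms by (auto simp: square_integrable_def)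
  show "(\<lambda>\<omega>. g \<omega> * h \<omega>) \<in> borel_measurable M" using assms by (auto simp: square_integrable_def)
  have "\<bar>a * b\<bar> \<le> a\<^sup>2 + b\<^sup>2" for a b :: real
    using sum_squares_bound[of a b] sum_squares_bound[of a "- b"] by (auto simp: abs_if power2_eq_square) 
  then show "AE \<omega> in M. norm (g \<omega> * h \<omega>) \<le> norm ((g \<omega>)\<^sup>2 + (h \<omega>)\<^sup>2)" by auto
qed

lemma square_integrable_const: "square_integrable (\<lambda>_. a)"
  by (simp add: square_integrable_def)

lemma square_integrable_integrable: "square_integrable g \<Longrightarrow> integrable M g"
  using square_integrable_mult[OF _ square_integrable_const[of 1]] by simp

lemma square_integrable_add:
  assumes "square_integrable g" "square_integrable h"
  shows "square_integrable (\<lambda>\<omega>. g \<omega> + h \<omega>)"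
proof -
  have "integrable M (\<lambda>\<omega>. (g \<omega>)\<^sup>2 + (h \<omega>)\<^sup>2 + 2 * (g \<omega> * h \<omega>))"
    using assms square_integrable_mult[OF assms] by (auto simp: square_integrable_def)
  then show ?thesis
    using assms by (auto simp: square_integrable_def power2_sum mult.assoc)
qed

lemma square_integrable_scale: "square_integrable g \<Longrightarrow> square_integrable (\<lambda>\<omega>. a * g \<omega>)"
  by (auto simp: square_integrable_def power_mult_distrib)

lemma square_integrable_sum:
  "finite K \<Longrightarrow> (\<And>k. k \<in> K \<Longrightarrow> square_integrable (g k)) \<Longrightarrow> square_integrable (\<lambda>\<omega>. \<Sum>k\<in>K. a k * g k \<omega>)"
  by (induction K rule: finite_induct)
     (simp_all add: square_integrable_add square_integrable_scale square_integrable_const)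

lemma square_integrable_AE:
  assumes "square_integrable h" "g \<in> borel_measurable M" "AE \<omega> in M. g \<omega> = h \<omega>"
  shows "square_integrable g"
proof -
  have "integrable M (\<lambda>\<omega>. (g \<omega>)\<^sup>2) \<longleftrightarrow> integrable M (\<lambda>\<omega>. (h \<omega>)\<^sup>2)"
    by (rule integrable_cong_AE) (use assms in \<open>auto simp: square_integrable_def\<close>)
  then show ?thesis using assms by (auto simp: square_integrable_def)
qed

end

locale linear_model = density_model P \<mu> N V f
  for P :: "'w measure" and \<mu> :: "'v \<Rightarrow> real measure" and N :: "'v set" and V f +
  fixes E :: "('v \<times> 'v) set" and \<alpha> :: "'v \<Rightarrow> 'v \<Rightarrow> real" and \<epsilon> :: "'v \<Rightarrow> 'w \<Rightarrow> real"
  assumes edges: "E \<subseteq> N \<times> N" and acyclic: "acyclic E"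
    and indep_\<epsilon>: "indep_vars (\<lambda>_. borel) \<epsilon> N"
    and \<epsilon>: "\<And>i. i \<in> N \<Longrightarrow> integrable P (\<lambda>\<omega>. (\<epsilon> i \<omega>)\<^sup>2)" "\<And>i. i \<in> N \<Longrightarrow> (\<integral>\<omega>. \<epsilon> i \<omega> \<partial>P) = 0"
    and V_eq: "\<And>i. i \<in> N \<Longrightarrow> AE \<omega> in P. V i \<omega> = (\<Sum>j\<in>{k. (k, i) \<in> E}. \<alpha> i j * V j \<omega>) + \<epsilon> i \<omega>"
    and nonsingular: "nonsingular_on N (cov_matrix P V)"
begin

lemma \<epsilon>_measurable: "i \<in> N \<Longrightarrow> \<epsilon> i \<in> borel_measurable P"
  using indep_\<epsilon> by (auto simp: indep_vars_def)

lemma \<epsilon>_square_integrable: "i \<in> N \<Longrightarrow> square_integrable (\<epsilon> i)"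
  using \<epsilon>_measurable \<epsilon> by (simp add: square_integrable_def)

lemma parents_finite: "finite {k. (k, i) \<in> E}"
  using edges finite_N by (auto intro: finite_subset)

lemma V_square_integrable:
  assumes "i \<in> N" shows "square_integrable (V i)"
proof -
  have "wf E" using edges acyclic finite_N by (auto intro: finite_acyclic_wf finite_subset)
  then show ?thesis using assms
  proof (induction i rule: wf_induct_rule)
    case (less i)
    have "square_integrable (\<lambda>\<omega>. (\<Sum>j\<in>{k. (k, i) \<in> E}. \<alpha> i j * V j \<omega>) + \<epsilon> i \<omega>)"
      by (intro square_integrable_add square_integrable_sum parents_finite \<epsilon>_square_integrable)
         (use less edges in auto)
    then show ?case by (rule square_integrable_AE) (use V_measurable V_eq less in auto)
  qed
qed

text \<open>This turns coefficient vectors into random variables; after centring, the bilinear form becomes the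
  expectation of a product.\<close>

definition comb :: "('v \<Rightarrow> real) \<Rightarrow> 'w \<Rightarrow> real" where
  "comb c \<omega> = (\<Sum>i\<in>N. c i * (V i \<omega> - expectation (V i)))"

lemma centred_square_integrable:
  "i \<in> N \<Longrightarrow> square_integrable (\<lambda>\<omega>. V i \<omega> - expectation (V i))"
  using square_integrable_add[OF V_square_integrable square_integrable_const[of "- expectation (V i)"]] by simp

lemma form_eq_expectation: "form N (cov_matrix P V) c d = expectation (\<lambda>\<omega>. comb c \<omega> * comb d \<omega>)"
proof -
  let ?W = "\<lambda>i \<omega>. V i \<omega> - expectation (V i)"
  have int: "integrable P (\<lambda>\<omega>. ?W i \<omega> * ?W j \<omega>)" if "i \<in> N" "j \<in> N" for i j
    using square_integrable_mult centred_square_integrable that by blast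
  have "(\<lambda>\<omega>. comb c \<omega> * comb d \<omega>) = (\<lambda>\<omega>. \<Sum>i\<in>N. \<Sum>j\<in>N. c i * d j * (?W i \<omega> * ?W j \<omega>))"
    by (simp add: comb_def sum_product mult_ac)
  then have "expectation (\<lambda>\<omega>. comb c \<omega> * comb d \<omega>) = (\<Sum>i\<in>N. \<Sum>j\<in>N. c i * d j * expectation (\<lambda>\<omega>. ?W i \<omega> * ?W j \<omega>))"
    using int by (simp add: integrable_mult_right)
  then show ?thesis by (simp add: form_def cov_matrix_def mult_ac)
qed

lemma covariance_cov_matrix: "covariance N (cov_matrix P V)"
proof -
  interpret semidefinite N "cov_matrix P V"
  proof
    show "cov_matrix P V i j = cov_matrix P V j i" for i j by (simp add: cov_matrix_def mult.commute)
    show "0 \<le> form N (cov_matrix P V) c c" for c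
      unfolding form_eq_expectation by (rule integral_nonneg_AE) simp
  qed (rule finite_N)
  show ?thesis by (rule nonsingular_imp_covariance[OF nonsingular])
qed

sublocale structural_equations N "cov_matrix P V" E \<alpha>
  by (intro structural_equations.intro structural_equations_axioms.intro covariance_cov_matrix edges acyclic)

lemma comb_add: "comb (\<lambda>i. c i + d i) \<omega> = comb c \<omega> + comb d \<omega>"
  by (simp add: comb_def distrib_right sum.distrib)

lemma comb_diff: "comb (\<lambda>i. c i - d i) \<omega> = comb c \<omega> - comb d \<omega>"
  by (simp add: comb_def left_diff_distrib sum_subtractf)

lemma comb_sum: "comb (\<lambda>i. \<Sum>k\<in>K. a k * g k i) \<omega> = (\<Sum>k\<in>K. a k * comb (g k) \<omega>)"
  unfolding comb_def sum_distrib_right sum_distrib_left by (subst sum.swap) (simp add: mult.assoc)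

lemma comb_supported:
  assumes "supported T c" "T \<subseteq> N"
  shows "comb c \<omega> = (\<Sum>i\<in>T. c i * (V i \<omega> - expectation (V i)))"
  unfolding comb_def using assms finite_N by (intro sum.mono_neutral_right) (auto simp: supported_def)

lemma comb_unit: "i \<in> N \<Longrightarrow> comb (unit i) \<omega> = V i \<omega> - expectation (V i)"
  using comb_supported[of "{i}" "unit i"] by (simp add: supported_def unit_def)

lemma comb_err:
  assumes i: "i \<in> N" shows "AE \<omega> in P. comb (err i) \<omega> = \<epsilon> i \<omega>"
proof -
  let ?P = "{k. (k, i) \<in> E}"
  have PN: "?P \<subseteq> N" using edges by auto
  have int: "integrable P (V k)" if "k \<in> N" for k
    using V_square_integrable[OF that] by (rule square_integrable_integrable)
  have int\<epsilon>: "integrable P (\<epsilon> i)" using \<epsilon>_square_integrable[OF i] by (rule square_integrable_integrable)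
  have "expectation (V i) = expectation (\<lambda>\<omega>. (\<Sum>j\<in>?P. \<alpha> i j * V j \<omega>) + \<epsilon> i \<omega>)"
  proof (rule integral_cong_AE)
    show "(\<lambda>\<omega>. (\<Sum>j\<in>?P. \<alpha> i j * V j \<omega>) + \<epsilon> i \<omega>) \<in> borel_measurable P"
      using V_measurable PN \<epsilon>_measurable[OF i] by (intro borel_measurable_add borel_measurable_sum borel_measurable_times) auto
  qed (use V_measurable[OF i] V_eq[OF i] in auto)
  also have "\<dots> = (\<Sum>j\<in>?P. \<alpha> i j * expectation (V j))"
    using int int\<epsilon> PN \<epsilon>(2)[OF i] by (subst Bochner_Integration.integral_add) (auto simp: subset_iff)
  finally have m: "expectation (V i) = (\<Sum>j\<in>?P. \<alpha> i j * expectation (V j))" .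
  have "comb (err i) \<omega> = V i \<omega> - expectation (V i) - (\<Sum>k\<in>?P. \<alpha> i k * (V k \<omega> - expectation (V k)))" for \<omega>
    unfolding err_def[abs_def] comb_diff comb_sum
    using i PN by (simp add: comb_unit subset_iff)
  then have "comb (err i) \<omega> = V i \<omega> - (\<Sum>k\<in>?P. \<alpha> i k * V k \<omega>)" for \<omega>
    using m by (simp add: right_diff_distrib sum_subtractf)
  then show ?thesis using V_eq[OF i] by auto
qed

lemma err_uncorrelated:
  assumes ij: "i \<in> N" "j \<in> N" "i \<noteq> j"
  shows "form N (cov_matrix P V) (err i) (err j) = 0"
proof -
  have cm: "comb c \<in> borel_measurable P" for c
    unfolding comb_def[abs_def] using V_measurable by (intro borel_measurable_sum) auto
  have "indep_var borel (\<epsilon> i) borel (\<epsilon> j)"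
  proof -
    have "indep_var (Pi\<^sub>M {i} (\<lambda>_. borel)) (\<lambda>\<omega>. restrict (\<lambda>i. \<epsilon> i \<omega>) {i})
        (Pi\<^sub>M {j} (\<lambda>_. borel)) (\<lambda>\<omega>. restrict (\<lambda>i. \<epsilon> i \<omega>) {j})"
      using indep_var_restrict[OF indep_\<epsilon>, of "{i}" "{j}"] ij by auto
    from indep_var_compose[OF this, of "\<lambda>x. x i" borel "\<lambda>x. x j" borel]
    show ?thesis by (simp add: comp_def)
  qed
  then have "expectation (\<lambda>\<omega>. \<epsilon> i \<omega> * \<epsilon> j \<omega>) = 0"
    using indep_var_lebesgue_integral[of "\<epsilon> i" "\<epsilon> j"] square_integrable_integrable[OF \<epsilon>_square_integrable] \<epsilon>(2) ij by simp
  moreover have "expectation (\<lambda>\<omega>. comb (err i) \<omega> * comb (err j) \<omega>) = expectation (\<lambda>\<omega>. \<epsilon> i \<omega> * \<epsilon> j \<omega>)"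
    by (rule integral_cong_AE) (use comb_err[OF ij(1)] comb_err[OF ij(2)] cm \<epsilon>_measurable ij in auto)
  ultimately show ?thesis by (simp add: form_eq_expectation)
qed

sublocale uncorrelated_errors N "cov_matrix P V" E \<alpha>
  by unfold_locales (rule err_uncorrelated)

text \<open>Coefficients determine conditional independence, also without normality: what remains of \<open>V y\<close> is a
  combination of errors, hence independent of all variables that do not descend from these errors.\<close>

lemma cond_indep_of_coefficients:
  assumes y: "y \<in> N" "y \<notin> U \<union> T" and UT: "U \<subseteq> N" "T \<subseteq> N" and C: "C \<subseteq> N"
    and g: "supported T g" and e: "unit y = (\<lambda>i. g i + (\<Sum>c\<in>C. d c * err c i))"
    and nd: "\<And>c v. c \<in> C \<Longrightarrow> v \<in> U \<union> T \<Longrightarrow> (c, v) \<notin> E\<^sup>*"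
  shows "cond_indep N \<mu> f {y} U T"
proof -
  let ?K = "U \<union> T"
  have K: "?K \<subseteq> N" using UT by auto
  define noise where "noise \<omega> = (\<Sum>c\<in>C. d c * \<epsilon> c \<omega>)" for \<omega>
  define h where "h x = expectation (V y) + (\<Sum>t\<in>T. g t * (x t - expectation (V t)))" for x :: "'v \<Rightarrow> real"
  have Cf: "finite C" "finite T" "finite ?K" using C K UT finite_sub by auto
  have "\<exists>b. unit v = (\<lambda>i. \<Sum>j\<in>N. b j * err j i) \<and> (\<forall>j\<in>C. b j = 0)" if v: "v \<in> ?K" for v
  proof -
    obtain b where "unit v = (\<lambda>i. \<Sum>j\<in>N. b j * err j i)" "\<And>j. b j \<noteq> 0 \<Longrightarrow> (j, v) \<in> E\<^sup>*"
      using ancestral_expansion[of v] v K by blast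
    then show ?thesis using nd v by blast
  qed
  then have "\<exists>b. \<forall>v\<in>?K. unit v = (\<lambda>i. \<Sum>j\<in>N. b v j * err j i) \<and> (\<forall>j\<in>C. b v j = 0)"
    by (intro bchoice ballI)
  then obtain b where b: "\<And>v. v \<in> ?K \<Longrightarrow> unit v = (\<lambda>i. \<Sum>j\<in>N. b v j * err j i)"
    "\<And>v j. v \<in> ?K \<Longrightarrow> j \<in> C \<Longrightarrow> b v j = 0" by auto
  define \<phi> where "\<phi> x = (\<lambda>v\<in>?K. expectation (V v) + (\<Sum>j\<in>N - C. b v j * x j))" for x :: "'v \<Rightarrow> real"
  define W where "W \<omega> = \<phi> (restrict (\<lambda>i. \<epsilon> i \<omega>) (N - C))" for \<omega>
  have all_err: "AE \<omega> in P. \<forall>i\<in>N. comb (err i) \<omega> = \<epsilon> i \<omega>"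
    using comb_err finite_N by (subst AE_finite_all) auto
  have VW: "AE \<omega> in P. vec ?K \<omega> = W \<omega>"
    using all_err
  proof eventually_elim
    case (elim \<omega>)
    have "V v \<omega> = expectation (V v) + (\<Sum>j\<in>N - C. b v j * \<epsilon> j \<omega>)" if v: "v \<in> ?K" for v
    proof -
      have "V v \<omega> - expectation (V v) = comb (unit v) \<omega>" using comb_unit v K by auto
      also have "\<dots> = (\<Sum>j\<in>N. b v j * comb (err j) \<omega>)"
        by (subst b(1)[OF v]) (rule comb_sum)
      also have "\<dots> = (\<Sum>j\<in>N. b v j * \<epsilon> j \<omega>)" using elim by simp
      also have "\<dots> = (\<Sum>j\<in>N - C. b v j * \<epsilon> j \<omega>)"
        using b(2)[OF v] finite_N by (intro sum.mono_neutral_right) auto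
      finally show ?thesis by simp
    qed
    then show ?case by (auto simp: vec_def W_def \<phi>_def fun_eq_iff)
  qed
  have Vy: "AE \<omega> in P. V y \<omega> = h (vec T \<omega>) + noise \<omega>"
    using all_err
  proof eventually_elim
    case (elim \<omega>)
    have "V y \<omega> - expectation (V y) = comb (\<lambda>i. g i + (\<Sum>c\<in>C. d c * err c i)) \<omega>"
      using comb_unit[OF y(1)] e by simp
    also have "\<dots> = (\<Sum>t\<in>T. g t * (V t \<omega> - expectation (V t))) + (\<Sum>c\<in>C. d c * comb (err c) \<omega>)"
      unfolding comb_add comb_sum comb_supported[OF g UT(2)] ..
    also have "(\<Sum>c\<in>C. d c * comb (err c) \<omega>) = noise \<omega>"
      unfolding noise_def using elim C by (intro sum.cong) auto
    finally show ?case by (simp add: h_def vec_def)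
  qed
  have \<phi>m: "\<phi> \<in> measurable (Pi\<^sub>M (N - C) (\<lambda>_. borel)) (Pi\<^sub>M ?K \<mu>)"
    unfolding \<phi>_def[abs_def]
  proof (rule measurable_restrict)
    fix v
    have "(\<lambda>x. expectation (V v) + (\<Sum>j\<in>N - C. b v j * x j)) \<in> borel_measurable (Pi\<^sub>M (N - C) (\<lambda>_. borel))"
      by measurable
    then show "(\<lambda>x. expectation (V v) + (\<Sum>j\<in>N - C. b v j * x j)) \<in> measurable (Pi\<^sub>M (N - C) (\<lambda>_. borel)) (\<mu> v)"
      using measurable_cong_sets[OF refl sets_\<mu>[of v], of "Pi\<^sub>M (N - C) (\<lambda>_. borel :: real measure)"] by simp
  qed
  have nm: "(\<lambda>x. \<Sum>c\<in>C. d c * x c) \<in> borel_measurable (Pi\<^sub>M C (\<lambda>_. borel))" by measurable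
  let ?MC = "Pi\<^sub>M C (\<lambda>_. borel :: real measure)" and ?MN = "Pi\<^sub>M (N - C) (\<lambda>_. borel :: real measure)"
  define a1 a2 where "a1 \<omega> = restrict (\<lambda>i. \<epsilon> i \<omega>) C" and "a2 \<omega> = restrict (\<lambda>i. \<epsilon> i \<omega>) (N - C)" for \<omega>
  have "indep_var ?MC a1 ?MN a2"
    unfolding a1_def[abs_def] a2_def[abs_def] using indep_var_restrict[OF indep_\<epsilon>, of C "N - C"] C by auto
  then have ind: "a1 \<in> measurable P ?MC" "a2 \<in> measurable P ?MN"
    "distr P ?MC a1 \<Otimes>\<^sub>M distr P ?MN a2 = distr P (?MC \<Otimes>\<^sub>M ?MN) (\<lambda>\<omega>. (a1 \<omega>, a2 \<omega>))"
    unfolding indep_var_distribution_eq by auto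
  define n where "n x = (\<Sum>c\<in>C. d c * x c)" for x :: "'v \<Rightarrow> real"
  have nm: "n \<in> borel_measurable ?MC" unfolding n_def[abs_def] by measurable
  have noise_n: "noise \<omega> = n (a1 \<omega>)" and W_\<phi>: "W \<omega> = \<phi> (a2 \<omega>)" for \<omega>
    by (simp_all add: noise_def n_def a1_def W_def a2_def)
  have noise_m: "noise \<in> borel_measurable P"
    using measurable_compose[OF ind(1) nm] by (simp add: noise_n[abs_def])
  show ?thesis
  proof (rule cond_indep_additive_noise[OF y UT _ noise_m Vy])
    have "h \<in> borel_measurable (Pi\<^sub>M T (\<lambda>_. borel))" unfolding h_def[abs_def] by measurable
    moreover have "sets (Pi\<^sub>M T \<mu>) = sets (Pi\<^sub>M T (\<lambda>_. borel))" by (rule sets_PiM_cong) (simp_all add: sets_\<mu>)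
    ultimately show "h \<in> borel_measurable (Pi\<^sub>M T \<mu>)" using measurable_cong_sets by blast
  next
    fix G :: "real \<times> ('v \<Rightarrow> real) \<Rightarrow> ennreal"
    assume G[measurable]: "G \<in> borel_measurable (borel \<Otimes>\<^sub>M Pi\<^sub>M ?K \<mu>)"
    let ?D = "distr P ?MC a1" and ?L = "distr P ?MN a2"
    interpret D: prob_space ?D by (rule prob_space_distr[OF ind(1)])
    interpret L: prob_space ?L by (rule prob_space_distr[OF ind(2)])
    interpret DL: pair_sigma_finite ?D ?L ..
    note [measurable] = nm \<phi>m
    define G' where "G' = (\<lambda>(a, b). G (n a, \<phi> b))"
    have Gm: "G' \<in> borel_measurable (?MC \<Otimes>\<^sub>M ?MN)" unfolding G'_def by measurable
    have G': "G' \<in> borel_measurable (?D \<Otimes>\<^sub>M ?L)"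
      using Gm by (simp add: measurable_cong_sets[OF sets_pair_measure_cong[OF sets_distr sets_distr]])
    have "G' \<in> borel_measurable (?D \<Otimes>\<^sub>M ?MN)"
      using Gm by (simp add: measurable_cong_sets[OF sets_pair_measure_cong[OF sets_distr refl]])
    from D.borel_measurable_nn_integral_fst[OF measurable_pair_swap[OF this]]
    have inner: "(\<lambda>b. \<integral>\<^sup>+ a. G' (a, b) \<partial>?D) \<in> borel_measurable ?MN" by simp
    have slice: "(\<lambda>u. G (u, x)) \<in> borel_measurable borel" if "x \<in> space (Pi\<^sub>M ?K \<mu>)" for x
      using that by measurable
    have W_space: "W \<omega> \<in> space (Pi\<^sub>M ?K \<mu>)" if "\<omega> \<in> space P" for \<omega>
      using measurable_space[OF \<phi>m measurable_space[OF ind(2) that]] by (simp add: W_\<phi>)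
    have "(\<integral>\<^sup>+ \<omega>. G (noise \<omega>, vec ?K \<omega>) \<partial>P) = (\<integral>\<^sup>+ \<omega>. G' (a1 \<omega>, a2 \<omega>) \<partial>P)"
      using VW by (intro nn_integral_cong_AE) (auto simp: G'_def noise_n W_\<phi>)
    also have "\<dots> = (\<integral>\<^sup>+ z. G' z \<partial>(?D \<Otimes>\<^sub>M ?L))"
      unfolding ind(3) using ind(1,2) Gm by (subst nn_integral_distr) auto
    also have "\<dots> = (\<integral>\<^sup>+ b. (\<integral>\<^sup>+ a. G' (a, b) \<partial>?D) \<partial>?L)"
      by (rule DL.nn_integral_snd[OF G', symmetric])
    also have "\<dots> = (\<integral>\<^sup>+ \<omega>. (\<integral>\<^sup>+ a. G' (a, a2 \<omega>) \<partial>?D) \<partial>P)"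
      by (rule nn_integral_distr[OF ind(2)]) (simp add: inner)
    also have "\<dots> = (\<integral>\<^sup>+ \<omega>. (\<integral>\<^sup>+ u. G (u, W \<omega>) \<partial>distr P borel noise) \<partial>P)"
    proof (rule nn_integral_cong)
      fix \<omega> assume \<omega>: "\<omega> \<in> space P"
      have m: "(\<lambda>a. G' (a, a2 \<omega>)) \<in> borel_measurable ?MC"
        using measurable_compose[OF nm slice[OF W_space[OF \<omega>]]] by (simp add: G'_def W_\<phi>)
      have "(\<integral>\<^sup>+ a. G' (a, a2 \<omega>) \<partial>?D) = (\<integral>\<^sup>+ \<omega>'. G (noise \<omega>', W \<omega>) \<partial>P)"
        using m by (subst nn_integral_distr[OF ind(1)]) (simp_all add: G'_def noise_n W_\<phi>)
      also have "\<dots> = (\<integral>\<^sup>+ u. G (u, W \<omega>) \<partial>distr P borel noise)"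
        using slice[OF W_space[OF \<omega>]] by (intro nn_integral_distr[OF noise_m, symmetric]) simp
      finally show "(\<integral>\<^sup>+ a. G' (a, a2 \<omega>) \<partial>?D) = (\<integral>\<^sup>+ u. G (u, W \<omega>) \<partial>distr P borel noise)" .
    qed
    also have "\<dots> = (\<integral>\<^sup>+ \<omega>. (\<integral>\<^sup>+ u. G (u, vec ?K \<omega>) \<partial>distr P borel noise) \<partial>P)"
      using VW by (intro nn_integral_cong_AE) auto
    finally show "(\<integral>\<^sup>+ \<omega>. G (noise \<omega>, vec ?K \<omega>) \<partial>P) =
      (\<integral>\<^sup>+ \<omega>. (\<integral>\<^sup>+ u. G (u, vec ?K \<omega>) \<partial>distr P borel noise) \<partial>P)" .
  qed
qed

end


section \<open>Combining the graph and the linear model\<close>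

context adjustable
begin

text \<open>A node of the optimal set is a parent of a causal node, and the causal path from there to
  the targets stays inside the causal nodes, so \<open>T\<close> does not block it.\<close>

lemma optimal_node_connected:
  assumes so: "s \<in> O_set" and U: "s \<in> U" and T: "T \<inter> cn X Y G = {}"
  shows "\<exists>y\<in>Y. \<not> d_separated G {y} U T"
proof -
  obtain m h where h: "h 0 = s" "h (Suc m) \<in> Y" "\<And>j. j < Suc m \<Longrightarrow> (h j, h (Suc j)) \<in> avoid G"
    and h_cn: "\<And>j. 1 \<le> j \<Longrightarrow> j \<le> Suc m \<Longrightarrow> h j \<in> cn X Y G"
    using so by (rule optimal_node_causal_path) blast
  have step: "(h j, h (Suc j)) \<in> dir G" if "j < Suc m" for j using h(3)[OF that] by blast
  define p where "p = rev (map h [0..<Suc (Suc m)])"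
  have cp: "causal_path G (map h [0..<Suc (Suc m)])"
    by (rule causal_path_of_sequence[OF PDAG_G]) (use so O_facts(3) h step in auto)
  have len: "length p = Suc (Suc m)" by (simp add: p_def)
  have nth: "p ! k = h (Suc m - k)" if "k \<le> Suc m" for k
    using that by (simp add: p_def rev_nth del: upt_Suc)
  have out: "(p ! k, p ! (k - 1)) \<in> dir G" if "1 \<le> k" "k \<le> Suc m" for k
    using step[of "Suc m - k"] nth[of k] nth[of "k - 1"] that by (auto simp: Suc_diff_le)
  have gp: "gpath G p"
    unfolding gpath_def
  proof (intro conjI allI impI)
    show "p \<noteq> []" by (simp add: p_def)
    show "distinct p" "set p \<subseteq> nodes G"
      using cp unfolding p_def distinct_rev set_rev causal_path_def gpath_def by blast+
    show "adj G (p ! k) (p ! Suc k)" if "Suc k < length p" for k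
      using out[of "Suc k"] that len by (auto simp: adj_def)
  qed
  have nc: "noncollider G p k" "\<not> collider G p k" if "inner_pos p k" for k
    using that out[of k] len SG(9) by (auto simp: noncollider_def collider_def inner_pos_def)
  have "definite_status G p" using gp nc by (auto simp: definite_status_def)
  moreover have "path_from_to G {h (Suc m)} U p"
  proof -
    have "hd p = h (Suc m)" unfolding p_def hd_rev map_upt_ends ..
    moreover have "last p = s" unfolding p_def last_rev map_upt_ends using h by simp
    ultimately show ?thesis using gp U by (simp add: path_from_to_def)
  qed
  moreover have "\<not> blocked G T p"
  proof
    assume "blocked G T p"
    then obtain k where k: "noncollider G p k" "p ! k \<in> T" using nc(2) by (auto simp: blocked_def collider_def)
    then have "1 \<le> k" "k < Suc m" using len by (auto simp: noncollider_def inner_pos_def)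
    then have "p ! k \<in> cn X Y G" using h_cn[of "Suc m - k"] nth[of k] by auto
    then show False using k(2) T by blast
  qed
  ultimately show ?thesis using h(2) by (auto simp: d_separated_def)
qed

end

locale adjustable_linear_model =
  adjustable G X Y Z + linear_model P \<mu> "nodes G" V f "dir D" \<alpha> \<epsilon>
  for G :: "'v pgraph" and X Y Z :: "'v set" and P :: "'w measure" and \<mu> V f and D :: "'v pgraph" and \<alpha> \<epsilon> +
  assumes D: "D \<in> DAG_class G"
begin

abbreviation \<Sigma> :: "'v \<Rightarrow> 'v \<Rightarrow> real" where "\<Sigma> \<equiv> cov_matrix P V"

text \<open>Outside the causal nodes of the true DAG, their parents are sources or belong to the optimal set of the
  graph, so the structural equations of the causal nodes can be solved for the targets.\<close>

lemma target_decomposition: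
  assumes y: "y \<in> Y"
  obtains g d where "supported (X \<union> O_set) g"
    "unit y = (\<lambda>i. g i + (\<Sum>c\<in>cn X Y D. d c * err c i))"
proof -
  have "cn X Y D \<subseteq> nodes G" using cn_D_posscn[OF D] posscn_nodes by blast
  moreover have "(X \<union> O_set) \<inter> cn X Y D = {}"
    using cn_D_posscn[OF D] posscn_F O_facts(1) posscn_notin_X by blast
  moreover have "y \<in> cn X Y D" using y Y_cn cn_mono[OF D] by blast
  ultimately show ?thesis
    using closed_expansion[of "cn X Y D" "X \<union> O_set" y] parents_of_causal[OF D] that by blast
qed

lemma causal_error_nondescendant:
  "c \<in> cn X Y D \<Longrightarrow> v \<in> X \<union> O_set \<union> Z \<Longrightarrow> (c, v) \<notin> (dir D)\<^sup>*"
  using descendants_F[OF D] cn_D_posscn[OF D] X_F O_facts(1) Z_facts(4) by blast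

lemma subsets: "X \<union> O_set \<subseteq> nodes G" "X \<union> Z \<subseteq> nodes G" "cn X Y D \<subseteq> nodes G"
  using X_nodes O_facts(3) Z_facts(1) cn_D_posscn[OF D] posscn_nodes by blast+

lemma numerator:
  assumes y: "y \<in> Y"
  shows "cond_cov \<Sigma> (X \<union> O_set) y y \<le> cond_cov \<Sigma> (X \<union> Z) y y"
    and "cond_cov \<Sigma> (X \<union> O_set) y y = cond_cov \<Sigma> (X \<union> Z) y y \<Longrightarrow>
      supported (X \<union> O_set) g \<Longrightarrow> unit y = (\<lambda>i. g i + (\<Sum>c\<in>cn X Y D. d c * err c i)) \<Longrightarrow>
      supported (X \<union> Z) g"
proof -
  have e: "form (nodes G) \<Sigma> (\<lambda>i. \<Sum>c\<in>cn X Y D. d c * err c i) (unit v) = 0"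
    if "v \<in> (X \<union> O_set) \<union> (X \<union> Z)" for d v
    by (rule error_combination_uncorrelated) (use subsets that causal_error_nondescendant in auto)
  have yN: "y \<in> nodes G" using y Y_nodes by blast
  obtain g0 d0 where "supported (X \<union> O_set) g0" "unit y = (\<lambda>i. g0 i + (\<Sum>c\<in>cn X Y D. d0 c * err c i))"
    using target_decomposition[OF y] .
  from regression_with_error(1)[OF subsets(1,2) yN this e]
  show "cond_cov \<Sigma> (X \<union> O_set) y y \<le> cond_cov \<Sigma> (X \<union> Z) y y" .
  show "supported (X \<union> Z) g" if "cond_cov \<Sigma> (X \<union> O_set) y y = cond_cov \<Sigma> (X \<union> Z) y y"
    "supported (X \<union> O_set) g" "unit y = (\<lambda>i. g i + (\<Sum>c\<in>cn X Y D. d c * err c i))"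
    using regression_with_error(2)[OF subsets(1,2) yN that(2,3) e that(1)] .
qed

text \<open>As no source is reached from \<open>w\<close> along an open walk, the linear Markov property applies with the reached
  nodes on one side and the sources on the other.\<close>

lemma optimal_node_uncorrelated:
  assumes w: "w \<in> O_set - Z"
  shows "\<exists>b. supported Z b \<and> (\<forall>v\<in>X \<union> Z. form (nodes G) \<Sigma> (\<lambda>i. unit w i - b i) (unit v) = 0)"
proof -
  define A where "A = anc D (X \<union> Z \<union> {w})"
  define M where "M = {v. v \<notin> Z \<and> (\<exists>b. reach D Z w v b)}"
  have wN: "w \<in> nodes G" using w O_facts(3) by auto
  have S: "X \<union> Z \<union> {w} \<subseteq> nodes G" using X_nodes Z_facts(1) wN by auto
  have AN: "A \<subseteq> nodes G"
  proof
    fix v assume "v \<in> A"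
    then obtain s where s: "s \<in> X \<union> Z \<union> {w}" "(v, s) \<in> (dir D)\<^sup>*" unfolding A_def anc_def by blast
    show "v \<in> nodes G"
    proof (cases "v = s")
      case True then show ?thesis using S s(1) by blast
    next
      case False
      then obtain u where "(v, u) \<in> dir D" using s(2) by (metis converse_rtranclE)
      then show ?thesis using SD(2)[OF D] nodes_D[OF D] by blast
    qed
  qed
  have SA: "X \<union> Z \<union> {w} \<subseteq> A" unfolding A_def by (rule anc_superset)
  have none: "\<not> reach D Z w x b" if "x \<in> X" for x b using sources_not_reached[OF D w that] .
  have "\<exists>b. supported Z b \<and> (\<forall>v\<in>(A - M) \<union> Z. form (nodes G) \<Sigma> (\<lambda>i. unit w i - b i) (unit v) = 0)"
  proof (rule separation[OF AN])
    show "k \<in> A" if "i \<in> A" "(k, i) \<in> dir D" for i k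
      using that unfolding A_def by (metis anc_step)
    show "Z \<subseteq> A" "w \<in> A" using SA by auto
    show "w \<in> M" "w \<notin> Z" using w reach.start[of D Z w] by (auto simp: M_def)
    fix i assume i: "i \<in> A"
    show "insert i {k. (k, i) \<in> dir D} - Z \<subseteq> M \<or> insert i {k. (k, i) \<in> dir D} \<inter> M = {}"
    proof (cases "insert i {k. (k, i) \<in> dir D} \<inter> M = {}")
      case False
      then obtain m b where m: "m = i \<or> (m, i) \<in> dir D" "m \<notin> Z" "reach D Z w m b" by (auto simp: M_def)
      have "k \<in> M" if k: "k \<in> insert i {k. (k, i) \<in> dir D} - Z" for k
        using reach_family[OF none i[unfolded A_def] m, of k] k by (auto simp: M_def)
      then show ?thesis by blast
    qed simp
  qed
  moreover have "X \<union> Z \<subseteq> (A - M) \<union> Z" using SA none by (auto simp: M_def)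
  ultimately show ?thesis by blast
qed

lemma denominator:
  assumes x: "x \<in> X"
  shows "cond_cov \<Sigma> (X - {x} \<union> Z) x x \<le> cond_cov \<Sigma> (X - {x} \<union> O_set) x x"
    and "0 < cond_cov \<Sigma> (X - {x} \<union> Z) x x"
proof -
  show "cond_cov \<Sigma> (X - {x} \<union> Z) x x \<le> cond_cov \<Sigma> (X - {x} \<union> O_set) x x"
    using optimal_node_uncorrelated
    by (intro regression_without_gain[OF X_nodes Z_facts(1) O_facts(3) x])
  show "0 < cond_cov \<Sigma> (X - {x} \<union> Z) x x"
    by (rule cond_cov_pos) (use x subsets X_nodes Z_facts in auto)
qed

lemma optimal_set_efficient:
  assumes "y \<in> Y" "x \<in> X"
  shows "avar \<Sigma> X O_set y x \<le> avar \<Sigma> X Z y x"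
proof -
  have "0 \<le> cond_cov \<Sigma> (X \<union> Z) y y"
    by (rule cond_cov_nonneg) (use assms subsets Y_nodes in auto)
  then show ?thesis
    unfolding avar_def using numerator(1)[OF assms(1)] denominator[OF assms(2)] by (intro frac_le) auto
qed

text \<open>Equal asymptotic variances force equal numerators, so the regression of the targets on the sources and the
  optimal set does not use the part of the optimal set outside \<open>Z\<close>. Conditional independence follows, and
  faithfulness turns it into a separation that the graph contradicts.\<close>

lemma equally_efficient_superset:
  assumes eq: "\<And>y x. y \<in> Y \<Longrightarrow> x \<in> X \<Longrightarrow> avar \<Sigma> X O_set y x = avar \<Sigma> X Z y x"
    and faithful: "faithful \<mu> f G"
  shows "O_set \<subseteq> Z"
proof (rule ccontr)
  assume "\<not> O_set \<subseteq> Z"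
  then obtain s where s: "s \<in> O_set" "s \<notin> Z" by blast
  let ?U = "O_set - Z" and ?T = "X \<union> (O_set \<inter> Z)"
  have "?T \<inter> cn X Y G = {}"
    using cn_posscn posscn_F posscn_notin_X O_facts(1) by blast
  then obtain y where y: "y \<in> Y" "\<not> d_separated G {y} ?U ?T"
    using optimal_node_connected[of s ?U ?T] s by blast
  obtain p where "poss_causal_path G p" "hd p \<in> X" using y(1) Y_possde by (auto simp: possde_def)
  then obtain x where x: "x \<in> X" by blast
  obtain g d where g: "supported (X \<union> O_set) g" "unit y = (\<lambda>i. g i + (\<Sum>c\<in>cn X Y D. d c * err c i))"
    using target_decomposition[OF y(1)] .
  define n\<^sub>O n\<^sub>Z d\<^sub>O d\<^sub>Z where "n\<^sub>O = cond_cov \<Sigma> (X \<union> O_set) y y" and "n\<^sub>Z = cond_cov \<Sigma> (X \<union> Z) y y"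
    and "d\<^sub>O = cond_cov \<Sigma> (X - {x} \<union> O_set) x x" and "d\<^sub>Z = cond_cov \<Sigma> (X - {x} \<union> Z) x x"
  note defs = n\<^sub>O_def n\<^sub>Z_def d\<^sub>O_def d\<^sub>Z_def
  have le: "n\<^sub>O \<le> n\<^sub>Z" "d\<^sub>Z \<le> d\<^sub>O" "0 < d\<^sub>Z"
    using numerator(1)[OF y(1)] denominator[OF x] by (simp_all add: defs)
  have n0: "0 \<le> n\<^sub>Z" unfolding defs by (rule cond_cov_nonneg) (use y subsets Y_nodes in auto)
  have "n\<^sub>O / d\<^sub>O = n\<^sub>Z / d\<^sub>Z" using eq[OF y(1) x] by (simp add: avar_def defs)
  then have "n\<^sub>O * d\<^sub>Z = n\<^sub>Z * d\<^sub>O" using le by (simp add: field_simps)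
  moreover have "n\<^sub>Z * d\<^sub>Z \<le> n\<^sub>Z * d\<^sub>O" using le n0 by (intro mult_left_mono) auto
  ultimately have "n\<^sub>Z * d\<^sub>Z \<le> n\<^sub>O * d\<^sub>Z" by simp
  then have "n\<^sub>O = n\<^sub>Z" using le by simp
  then have "supported (X \<union> Z) g" using numerator(2)[OF y(1) _ g] by (simp add: defs)
  then have gT: "supported ?T g" using g(1) by (auto simp: supported_def)
  have yT: "y \<notin> ?U \<union> ?T" "y \<in> nodes G" using y(1) Y_nodes XY O_facts(4) by auto
  have "cond_indep (nodes G) \<mu> f {y} ?U ?T"
    by (rule cond_indep_of_coefficients[OF yT(2,1) _ _ subsets(3) gT g(2)])
       (use subsets causal_error_nondescendant in auto)
  moreover have "pairwise_disjoint_nodes (nodes G) {y} ?U ?T"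
    using yT subsets O_facts by (auto simp: pairwise_disjoint_nodes_def)
  ultimately show False using faithful y(2) unfolding faithful_def by blast
qed

end

text \<open>Only the reference measures of the nodes matter, so a sigma-finite measure may be chosen
  for all other indices.\<close>

lemma PiM_cong_nodes: "J \<subseteq> N \<Longrightarrow> Pi\<^sub>M J (\<lambda>i. if i \<in> N then \<mu> i else \<nu>) = Pi\<^sub>M J \<mu>"
  by (rule PiM_cong) auto

lemma cond_indep_cong_nodes:
  "cond_indep N (\<lambda>i. if i \<in> N then \<mu> i else \<nu>) f A B Z \<longleftrightarrow> cond_indep N \<mu> f A B Z"
proof -
  have "marginal N (\<lambda>i. if i \<in> N then \<mu> i else \<nu>) f S v = marginal N \<mu> f S v" for S v
    unfolding marginal_def by (subst PiM_cong_nodes) auto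
  then show ?thesis
    unfolding cond_indep_def cond_density_def by (subst PiM_cong_nodes) simp_all
qed

theorem theorem3p13:
  fixes G :: "'v pgraph"
    and X Y :: "'v set"
    and P :: "'w measure"
    and V :: "'v \<Rightarrow> 'w \<Rightarrow> real"
    and \<mu> :: "'v \<Rightarrow> real measure"
    and f :: "('v \<Rightarrow> real) \<Rightarrow> real"
    and fdo :: "'v set \<Rightarrow> ('v \<Rightarrow> real) \<Rightarrow> ('v \<Rightarrow> real) \<Rightarrow> real"
  assumes "maximal_PDAG G"
    and "X \<subseteq> nodes G" and "Y \<subseteq> nodes G" and "X \<inter> Y = {}"
    and "Y \<subseteq> possde G X"
    and "prob_space P"
    and "reference_measures (nodes G) \<mu>"
    and "has_density P (nodes G) \<mu> V f"
    and "compatible \<mu> f fdo G"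
  shows "(valid_adjustment_set X Y G (opt_set X Y G) \<longleftrightarrow>
           (\<exists>Z. valid_adjustment_set X Y G Z)) \<and>
         (\<forall>Z. valid_adjustment_set X Y G Z \<longrightarrow>
           causal_linear_model P \<mu> V f fdo G \<longrightarrow>
           nonsingular_on (nodes G) (cov_matrix P V) \<longrightarrow>
           (\<forall>y\<in>Y. \<forall>x\<in>X. avar (cov_matrix P V) X (opt_set X Y G) y x
                            \<le> avar (cov_matrix P V) X Z y x)) \<and>
         (\<forall>Z. valid_adjustment_set X Y G Z \<longrightarrow>
           (\<forall>y\<in>Y. \<forall>x\<in>X. avar (cov_matrix P V) X (opt_set X Y G) y x
                            = avar (cov_matrix P V) X Z y x) \<longrightarrow>
           causal_linear_model P \<mu> V f fdo G \<longrightarrow>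
           faithful \<mu> f G \<longrightarrow>
           nonsingular_on (nodes G) (cov_matrix P V) \<longrightarrow>
           opt_set X Y G \<subseteq> Z)"
proof -
  have graph: "adjustable G X Y Z" if "valid_adjustment_set X Y G Z" for Z
    by unfold_locales (use assms that in auto)
  define \<nu> where "\<nu> i = (if i \<in> nodes G then \<mu> i else lborel)" for i
  have \<nu>: "Pi\<^sub>M (nodes G) \<nu> = Pi\<^sub>M (nodes G) \<mu>" unfolding \<nu>_def[abs_def] by (rule PiM_cong_nodes) simp
  have faithful: "faithful \<nu> f G \<longleftrightarrow> faithful \<mu> f G"
    unfolding faithful_def \<nu>_def[abs_def] cond_indep_cong_nodes ..
  have density: "density_model P \<nu> (nodes G) V f"
  proof (intro density_model.intro density_model_axioms.intro product_sigma_finite.intro)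
    show "prob_space P" by fact
    show "sigma_finite_measure (\<nu> i)" "sets (\<nu> i) = sets borel" for i
      using assms(7) lborel.sigma_finite_measure_axioms by (auto simp: reference_measures_def \<nu>_def)
    show "finite (nodes G)"
      using assms(1) by (auto simp: maximal_PDAG_def PDAG_def simple_graph_def)
    show "0 \<le> f v" for v using assms(8) by (simp add: has_density_def)
    show "distributed P (Pi\<^sub>M (nodes G) \<nu>) (\<lambda>\<omega>. \<lambda>i\<in>nodes G. V i \<omega>) (\<lambda>v. ennreal (f v))"
      unfolding \<nu> using assms(8) by (simp add: has_density_def)
  qed
  have model: "\<exists>D \<alpha> \<epsilon>. adjustable_linear_model G X Y Z P \<nu> V f D \<alpha> \<epsilon>"
    if Z: "valid_adjustment_set X Y G Z" and clm: "causal_linear_model P \<mu> V f fdo G"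
      and ns: "nonsingular_on (nodes G) (cov_matrix P V)" for Z
  proof -
    interpret adjustable G X Y Z by (rule graph[OF Z])
    obtain D \<alpha> \<epsilon> where D: "D \<in> DAG_class G"
      and \<epsilon>: "prob_space.indep_vars P (\<lambda>_. borel) \<epsilon> (nodes D)"
      "\<And>i. i \<in> nodes D \<Longrightarrow> integrable P (\<lambda>\<omega>. (\<epsilon> i \<omega>)\<^sup>2) \<and> (\<integral>\<omega>. \<epsilon> i \<omega> \<partial>P) = 0 \<and>
        (AE \<omega> in P. V i \<omega> = (\<Sum>j\<in>pa D {i}. \<alpha> i j * V j \<omega>) + \<epsilon> i \<omega>)"
      using clm unfolding causal_linear_model_def causal_linear_model_DAG_def by blast
    have pa: "pa D {i} = {k. (k, i) \<in> dir D}" for i by (simp add: pa_def)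
    have "linear_model P \<nu> (nodes G) V f (dir D) \<alpha> \<epsilon>"
      using \<epsilon> acyclic_D[OF D] SD(2,3)[OF D] ns unfolding pa nodes_D[OF D]
      by (intro linear_model.intro density linear_model_axioms.intro) auto
    then show ?thesis
      using D adjustable_axioms adjustable_linear_model.intro adjustable_linear_model_axioms.intro by blast
  qed
  show ?thesis
  proof (intro conjI allI impI ballI)
    show "valid_adjustment_set X Y G (opt_set X Y G) \<longleftrightarrow> (\<exists>Z. valid_adjustment_set X Y G Z)"
    proof
      assume "\<exists>Z. valid_adjustment_set X Y G Z"
      then obtain Z where "valid_adjustment_set X Y G Z" ..
      then interpret adjustable G X Y Z by (rule graph)
      show "valid_adjustment_set X Y G (opt_set X Y G)"
        using valid O_facts optimal_set_blocks by (auto simp: valid_adjustment_set_def forb_eq)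
    qed blast
  next
    fix Z y x
    assume "valid_adjustment_set X Y G Z" "causal_linear_model P \<mu> V f fdo G"
      "nonsingular_on (nodes G) (cov_matrix P V)" and yx: "y \<in> Y" "x \<in> X"
    then obtain D \<alpha> \<epsilon> where "adjustable_linear_model G X Y Z P \<nu> V f D \<alpha> \<epsilon>" using model by blast
    then interpret adjustable_linear_model G X Y Z P \<nu> V f D \<alpha> \<epsilon> .
    show "avar (cov_matrix P V) X (opt_set X Y G) y x \<le> avar (cov_matrix P V) X Z y x"
      by (rule optimal_set_efficient[OF yx])
  next
    fix Z
    assume "valid_adjustment_set X Y G Z" "causal_linear_model P \<mu> V f fdo G"
      "nonsingular_on (nodes G) (cov_matrix P V)"
      and eq: "\<forall>y\<in>Y. \<forall>x\<in>X. avar (cov_matrix P V) X (opt_set X Y G) y x = avar (cov_matrix P V) X Z y x"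
      and f: "faithful \<mu> f G"
    then obtain D \<alpha> \<epsilon> where "adjustable_linear_model G X Y Z P \<nu> V f D \<alpha> \<epsilon>" using model by blast
    then interpret adjustable_linear_model G X Y Z P \<nu> V f D \<alpha> \<epsilon> .
    show "opt_set X Y G \<subseteq> Z"
      by (rule equally_efficient_superset) (use eq f faithful in auto)
  qed
qed

end
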